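(* Assume that $(H_\Phi)$ and $(H_T)$ (stated in the context) hold. (a) For all $x\in\mathcal{X}$, $$\inf\{\Phi^*(\ell);\ \ell\in\mathcal{L},\ T\ell=x\}=\Lambda_0^*(x)\in[0,\infty].$$ Moreover, in restriction to $\mathcal{X}_1$, $\Lambda_0^*=\Lambda_1^*$, and $\Lambda_1^*$ is $\sigma(\mathcal{X}_1,\mathcal{Y}_1)$-inf-compact. (b) The problems $(P)$ and $(P_1)$ are equivalent: they have the same solutions and $\inf(P)=\inf(P_1)\in[0,\infty]$. (c) If $C$ is convex and $\sigma(\mathcal{X},\mathcal{Y})$-closed, then $\inf(P)=\sup(D_0)\in[0,\infty]$. Assume that $(H_\Phi)$, $(H_T)$ and $(H_C)$ hold. (d) $$\inf(P)=\inf(P_1)=\sup(D_1)=\sup(D_2)=\inf_{x\in C}\Lambda_0^*(x)\in[0,\infty].$$ (e) If in addition $\inf(P)<\infty$, then $(P)$ is attained in $\mathcal{L}_1$. Moreover, any minimizing sequence for $(P)$ has $\sigma(\mathcal{L}_1,\mathcal{U}_1)$-cluster points and every such cluster point solves $(P)$. (f) Let $\bar\ell\in\mathcal{L}_1$ be a solution to $(P)$. Then $\bar x:=T\bar\ell$ is a solution to $(P_{1,\mathcal{X}})$ and $\inf(P)=\Phi^*(\bar\ell)=\Lambda_0^*(\bar x)$.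
   Context: All vector spaces are real. $E^{\mathrm{alg}}$ denotes the algebraic dual of $E$; $\sigma(E,F)$ is the weak topology on $E$ given by a dual pairing with $F$; $\mathrm{dom}\,f=\{f<+\infty\}$. A function is inf-compact if all its sublevel sets $\{f\le r\}$, $r\in\mathbb{R}$, are compact. Data. $\mathcal{U},\mathcal{Y}$ are vector spaces, $\mathcal{L}=\mathcal{U}^{\mathrm{alg}}$, $\mathcal{X}=\mathcal{Y}^{\mathrm{alg}}$, $\Phi$ is a function on $\mathcal{U}$, $T:\mathcal{L}\to\mathcal{X}$ is linear, $C\subset\mathcal{X}$ is convex. The adjoint $T^*:\mathcal{Y}\to\mathcal{L}^{\mathrm{alg}}$ is given by $\langle T^*y,\ell\rangle=\langle y,T\ell\rangle$; $\mathcal{U}$ is identified with a subspace of $\mathcal{L}^{\mathrm{alg}}$. Hypotheses. $(H_\Phi)$: (1) $\Phi:\mathcal{U}\to[0,+\infty]$ is convex and $\Phi(0)=0$; (2) for all $u\in\mathcal{U}$ there is $\alpha>0$ with $\Phi(\alpha u)<\infty$; (3) for all $u\in\mathcal{U}$, $u\neq0$, there is $t\in\mathbb{R}$ with $\Phi(tu)>0$. $(H_T)$: (1) $T^*(\mathcal{Y})\subset\mathcal{U}$; (2) $\ker T^*=\{0\}$. $(H_C)$: $C_1:=C\cap\mathcal{X}_1$ is a convex $\sigma(\mathcal{X}_1,\mathcal{Y}_1)$-closed subset of $\mathcal{X}_1$. Norms and spaces. $\Phi_\pm(u)=\max(\Phi(u),\Phi(-u))$ and $|u|_\Phi=\inf\{\alpha>0;\Phi_\pm(u/\alpha)\le1\}$,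 a norm on $\mathcal{U}$. $\Lambda(y)=\Phi(T^*y)$, $\Lambda_\pm(y)=\max(\Lambda(y),\Lambda(-y))$, $|y|_\Lambda=\inf\{\alpha>0;\Lambda_\pm(y/\alpha)\le1\}=|T^*y|_\Phi$, a norm on $\mathcal{Y}$. $\mathcal{U}_1$ is the $|\cdot|_\Phi$-completion of $\mathcal{U}$ and $\mathcal{L}_1=(\mathcal{U},|\cdot|_\Phi)'\cong\mathcal{U}_1'$ its topological dual, seen as a subspace of $\mathcal{L}$. $\mathcal{Y}_1$ is the $|\cdot|_\Lambda$-completion of $\mathcal{Y}$ and $\mathcal{X}_1=(\mathcal{Y},|\cdot|_\Lambda)'\cong\mathcal{Y}_1'$, seen as a subspace of $\mathcal{X}$. Operators. One has $T\mathcal{L}_1\subset\mathcal{X}_1$. $T_2^*:\mathcal{X}_1^{\mathrm{alg}}\to\mathcal{L}_1^{\mathrm{alg}}$ is defined by $\langle\ell,T_2^*\omega\rangle=\langle T\ell,\omega\rangle$ for all $\ell\in\mathcal{L}_1$, and $T_1^*$ is its restriction to $\mathcal{Y}_1\subset\mathcal{X}_1^{\mathrm{alg}}$; one has $T_1^*\mathcal{Y}_1\subset\mathcal{U}_1$. Functions. $\Phi^*(\ell)=\sup_{u\in\mathcal{U}}\{\langle u,\ell\rangle-\Phi(u)\}$ for $\ell\in\mathcal{L}$. $\Phi_0(u)=\sup_{\ell\in\mathcal{L}}\{\langle u,\ell\rangle-\Phi^*(\ell)\}$ on $\mathcal{U}$; $\Phi_1(u)=\sup_{\ell\in\mathcal{L}_1}\{\langle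 u,\ell\rangle-\Phi^*(\ell)\}$ on $\mathcal{U}_1$; $\Phi_2(\zeta)=\sup_{\ell\in\mathcal{L}_1}\{\langle\ell,\zeta\rangle-\Phi^*(\ell)\}$ on $\mathcal{L}_1^{\mathrm{alg}}$. $\Lambda_0(y)=\Phi_0(T^*y)$ on $\mathcal{Y}$; $\Lambda_1(y)=\Phi_1(T_1^*y)$ on $\mathcal{Y}_1$; $\Lambda_2(\omega)=\Phi_2(T_2^*\omega)$ on $\mathcal{X}_1^{\mathrm{alg}}$. $\Phi_1^*(\ell)=\sup_{u\in\mathcal{U}_1}\{\langle u,\ell\rangle-\Phi_1(u)\}$ on $\mathcal{L}_1$; $\Lambda_0^*(x)=\sup_{y\in\mathcal{Y}}\{\langle y,x\rangle-\Lambda_0(y)\}$ on $\mathcal{X}$; $\Lambda_1^*(x)=\sup_{y\in\mathcal{Y}_1}\{\langle y,x\rangle-\Lambda_1(y)\}$ on $\mathcal{X}_1$. Problems (with values $\inf(\cdot)$ or $\sup(\cdot)$). $(P)$: minimize $\Phi^*(\ell)$ subject to $T\ell\in C$, $\ell\in\mathcal{L}$. $(P_1)$: minimize $\Phi_1^*(\ell)$ subject to $T\ell\in C_1$, $\ell\in\mathcal{L}_1$. $(P_{1,\mathcal{X}})$: minimize $\Lambda_0^*(x)$ subject to $x\in C_1$. $(D_0)$: maximize $\inf_{x\in C}\langle y,x\rangle-\Lambda_0(y)$, $y\in\mathcal{Y}$. $(D_1)$: maximize $\inf_{x\in C_1}\langle y,x\rangle-\Lambda_1(y)$, $y\in\mathcal{Y}_1$.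 $(D_2)$: maximize $\inf_{x\in C_1}\langle x,\omega\rangle-\Lambda_2(\omega)$, $\omega\in\mathcal{X}_1^{\mathrm{alg}}$. *)

theory Defs
  imports "HOL-Analysis.Analysis"
begin

section \<open>Algebraic duals\<close>

typedef (overloaded) ('a::real_vector) alg_dual = "{f :: 'a \<Rightarrow> real. linear f}"
  morphisms dual_app Abs_alg_dual
  by (rule exI[of _ "\<lambda>_. 0"]) (simp add: linear_iff)

setup_lifting type_definition_alg_dual

lemma linear_dual_app: "linear (dual_app l)"
  using dual_app[of l] by simp

instantiation alg_dual :: (real_vector) real_vector
begin

lift_definition zero_alg_dual :: "'a alg_dual" is "\<lambda>_. 0"
  by (simp add: linear_iff)

lift_definition plus_alg_dual :: "'a alg_dual \<Rightarrow> 'a alg_dual \<Rightarrow> 'a alg_dual"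
  is "\<lambda>f g x. f x + g x"
  by (simp add: linear_iff algebra_simps)

lift_definition minus_alg_dual :: "'a alg_dual \<Rightarrow> 'a alg_dual \<Rightarrow> 'a alg_dual"
  is "\<lambda>f g x. f x - g x"
  by (simp add: linear_iff algebra_simps)

lift_definition uminus_alg_dual :: "'a alg_dual \<Rightarrow> 'a alg_dual" is "\<lambda>f x. - f x"
  by (simp add: linear_iff)

lift_definition scaleR_alg_dual :: "real \<Rightarrow> 'a alg_dual \<Rightarrow> 'a alg_dual" is "\<lambda>c f x. c * f x"
  by (simp add: linear_iff algebra_simps)

instance
  by standard (transfer; simp add: fun_eq_iff algebra_simps)+

end

text \<open>The canonical map of a space into its algebraic bidual, and the adjoint
  \<open>T\<^sup>* : Y \<rightarrow> L\<^sup>a\<^sup>l\<^sup>g\<close> of a linear map \<open>T : L \<rightarrow> X = Y\<^sup>a\<^sup>l\<^sup>g\<close>.\<close>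

lift_definition bidual_embed :: "'a::real_vector \<Rightarrow> 'a alg_dual alg_dual"
  is "\<lambda>u l. dual_app l u"
  by (simp add: linear_iff plus_alg_dual.rep_eq scaleR_alg_dual.rep_eq)

lemma inj_bidual_embed: "inj bidual_embed"
proof (rule injI, rule ccontr)
  fix u v :: 'a
  assume eq: "bidual_embed u = bidual_embed v" and "u \<noteq> v"
  then have "independent {u - v}" by simp
  then obtain f :: "'a \<Rightarrow> real" where f: "linear f" "f (u - v) = 1"
    using linear_independent_extend[of "{u - v}" "\<lambda>_. 1"] by auto
  have "dual_app (Abs_alg_dual f) u = dual_app (Abs_alg_dual f) v"
    using eq by (metis bidual_embed.rep_eq)
  with f show False
    by (simp add: Abs_alg_dual_inverse linear_diff)
qed

definition alg_adjoint ::
  "('u::real_vector alg_dual \<Rightarrow> 'y::real_vector alg_dual) \<Rightarrow> 'y \<Rightarrow> 'u alg_dual alg_dual"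
  where "alg_adjoint T y = Abs_alg_dual (\<lambda>l. dual_app (T l) y)"

lemma dual_app_alg_adjoint:
  assumes "linear T"
  shows "dual_app (alg_adjoint T y) l = dual_app (T l) y"
proof -
  have "linear (\<lambda>l. dual_app (T l) y)"
    using assms by (simp add: linear_iff plus_alg_dual.rep_eq scaleR_alg_dual.rep_eq)
  then show ?thesis
    by (simp add: alg_adjoint_def Abs_alg_dual_inverse)
qed

text \<open>\<open>T\<^sup>* y\<close> read as an element of \<open>U\<close>; meaningful when \<open>T\<^sup>* y\<close> lies in the image of \<open>U\<close>.\<close>

definition adjoint_in ::
  "('u::real_vector alg_dual \<Rightarrow> 'y::real_vector alg_dual) \<Rightarrow> 'y \<Rightarrow> 'u"
  where "adjoint_in T y = inv bidual_embed (alg_adjoint T y)"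

text \<open>Algebraic dual of a subspace \<open>S\<close> of \<open>'a\<close>: linear functionals on \<open>S\<close>, represented by
  functions that take the value \<open>undefined\<close> outside \<open>S\<close>.\<close>

definition alg_dual_on :: "'a::real_vector set \<Rightarrow> ('a \<Rightarrow> real) set"
  where "alg_dual_on S = {f \<in> extensional S.
    (\<forall>x\<in>S. \<forall>y\<in>S. f (x + y) = f x + f y) \<and> (\<forall>c. \<forall>x\<in>S. f (c *\<^sub>R x) = c * f x)}"


section \<open>Gauge norms, topological duals, completions, weak topologies\<close>

definition sym_max :: "('a::real_vector \<Rightarrow> ereal) \<Rightarrow> 'a \<Rightarrow> ereal"
  where "sym_max F u = max (F u) (F (- u))"

definition gauge_norm :: "('a::real_vector \<Rightarrow> ereal) \<Rightarrow> 'a \<Rightarrow> real"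
  where "gauge_norm F u = Inf {\<alpha>. 0 < \<alpha> \<and> sym_max F (u /\<^sub>R \<alpha>) \<le> 1}"

text \<open>In the following, \<open>N\<close> is a norm on \<open>'a\<close>.  The topological dual consists of the linear
  functionals that are bounded with respect to \<open>N\<close>.\<close>

definition top_dual :: "('a::real_vector \<Rightarrow> real) \<Rightarrow> 'a alg_dual set"
  where "top_dual N = {l. \<exists>K. \<forall>u. \<bar>dual_app l u\<bar> \<le> K * N u}"

definition Cauchy_wrt :: "('a::real_vector \<Rightarrow> real) \<Rightarrow> (nat \<Rightarrow> 'a) \<Rightarrow> bool"
  where "Cauchy_wrt N s \<longleftrightarrow> (\<forall>e>0. \<exists>M. \<forall>m\<ge>M. \<forall>n\<ge>M. N (s m - s n) < e)"

definition null_diff :: "('a::real_vector \<Rightarrow> real) \<Rightarrow> ((nat \<Rightarrow> 'a) \<times> (nat \<Rightarrow> 'a)) set"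
  where "null_diff N = {(s, t). Cauchy_wrt N s \<and> Cauchy_wrt N t \<and>
    (\<lambda>n. N (s n - t n)) \<longlonglongrightarrow> 0}"

text \<open>The completion as the space of Cauchy sequences modulo null sequences.\<close>

definition completion :: "('a::real_vector \<Rightarrow> real) \<Rightarrow> (nat \<Rightarrow> 'a) set set"
  where "completion N = {s. Cauchy_wrt N s} // null_diff N"

text \<open>The continuous extension of \<open>l \<in> top_dual N\<close> to the completion, i.e. the pairing
  between \<open>(completion N)' \<cong> top_dual N\<close> and \<open>completion N\<close>.\<close>

definition compl_app :: "'a::real_vector alg_dual \<Rightarrow> (nat \<Rightarrow> 'a) set \<Rightarrow> real"
  where "compl_app l \<xi> = (THE c. \<forall>s\<in>\<xi>. (\<lambda>n. dual_app l (s n)) \<longlonglongrightarrow> c)"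

text \<open>The canonical map of the completion into \<open>(top_dual N)\<^sup>a\<^sup>l\<^sup>g\<close>.\<close>

definition compl_embed ::
  "('a::real_vector \<Rightarrow> real) \<Rightarrow> (nat \<Rightarrow> 'a) set \<Rightarrow> 'a alg_dual \<Rightarrow> real"
  where "compl_embed N \<xi> = (\<lambda>l\<in>top_dual N. compl_app l \<xi>)"

text \<open>\<open>\<sigma>(E,F)\<close>: the coarsest topology on \<open>E\<close> that makes \<open>e \<mapsto> b e f\<close> continuous for
  each \<open>f \<in> F\<close>.\<close>

definition weak_topology :: "'a set \<Rightarrow> 'b set \<Rightarrow> ('a \<Rightarrow> 'b \<Rightarrow> real) \<Rightarrow> 'a topology"
  where "weak_topology E F b =
    pullback_topology E (\<lambda>e. \<lambda>f\<in>F. b e f) (product_topology (\<lambda>_. euclideanreal) F)"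

definition inf_compact :: "'a topology \<Rightarrow> ('a \<Rightarrow> ereal) \<Rightarrow> bool"
  where "inf_compact X f \<longleftrightarrow> (\<forall>r::real. compactin X {x \<in> topspace X. f x \<le> ereal r})"

definition seq_cluster_point :: "'a topology \<Rightarrow> (nat \<Rightarrow> 'a) \<Rightarrow> 'a \<Rightarrow> bool"
  where "seq_cluster_point X s a \<longleftrightarrow> a \<in> topspace X \<and>
    (\<forall>O'. openin X O' \<and> a \<in> O' \<longrightarrow> (\<exists>\<^sub>F n in sequentially. s n \<in> O'))"


section \<open>Minimization problems\<close>

definition min_value :: "('a \<Rightarrow> ereal) \<Rightarrow> 'a set \<Rightarrow> ereal"
  where "min_value f S = (INF x\<in>S. f x)"

text \<open>As usual for extended-valued objectives, points of value \<open>\<infinity>\<close> are not regarded as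
  feasible, so a problem with value \<open>\<infinity>\<close> has no solution.\<close>

definition solutions :: "('a \<Rightarrow> ereal) \<Rightarrow> 'a set \<Rightarrow> 'a set"
  where "solutions f S = {x \<in> S. f x = min_value f S \<and> f x < \<infinity>}"

definition minimizing_seq :: "('a \<Rightarrow> ereal) \<Rightarrow> 'a set \<Rightarrow> (nat \<Rightarrow> 'a) \<Rightarrow> bool"
  where "minimizing_seq f S s \<longleftrightarrow> (\<forall>n. s n \<in> S) \<and> (\<lambda>n. f (s n)) \<longlonglongrightarrow> min_value f S"


section \<open>Hypotheses on \<open>\<Phi>\<close> and \<open>T\<close>\<close>

definition H_Phi :: "('u::real_vector \<Rightarrow> ereal) \<Rightarrow> bool"
  where "H_Phi \<Phi> \<longleftrightarrow>
    (\<forall>u. 0 \<le> \<Phi> u) \<and>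
    (\<forall>u v. \<forall>t::real. 0 \<le> t \<and> t \<le> 1 \<longrightarrow>
      \<Phi> ((1 - t) *\<^sub>R u + t *\<^sub>R v) \<le> ereal (1 - t) * \<Phi> u + ereal t * \<Phi> v) \<and>
    \<Phi> 0 = 0 \<and>
    (\<forall>u. \<exists>\<alpha>>0. \<Phi> (\<alpha> *\<^sub>R u) < \<infinity>) \<and>
    (\<forall>u. u \<noteq> 0 \<longrightarrow> (\<exists>t::real. \<Phi> (t *\<^sub>R u) > 0))"

definition H_T :: "('u::real_vector alg_dual \<Rightarrow> 'y::real_vector alg_dual) \<Rightarrow> bool"
  where "H_T T \<longleftrightarrow> range (alg_adjoint T) \<subseteq> range bidual_embed \<and> {y. alg_adjoint T y = 0} = {0}"


section \<open>The spaces\<close>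

definition norm_Phi :: "('u::real_vector \<Rightarrow> ereal) \<Rightarrow> 'u \<Rightarrow> real"
  where "norm_Phi \<Phi> = gauge_norm \<Phi>"

definition Lam ::
  "('u::real_vector \<Rightarrow> ereal) \<Rightarrow> ('u alg_dual \<Rightarrow> 'y::real_vector alg_dual) \<Rightarrow> 'y \<Rightarrow> ereal"
  where "Lam \<Phi> T y = \<Phi> (adjoint_in T y)"

definition norm_Lam ::
  "('u::real_vector \<Rightarrow> ereal) \<Rightarrow> ('u alg_dual \<Rightarrow> 'y::real_vector alg_dual) \<Rightarrow> 'y \<Rightarrow> real"
  where "norm_Lam \<Phi> T = gauge_norm (Lam \<Phi> T)"

definition U1 :: "('u::real_vector \<Rightarrow> ereal) \<Rightarrow> (nat \<Rightarrow> 'u) set set"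
  where "U1 \<Phi> = completion (norm_Phi \<Phi>)"

definition L1 :: "('u::real_vector \<Rightarrow> ereal) \<Rightarrow> 'u alg_dual set"
  where "L1 \<Phi> = top_dual (norm_Phi \<Phi>)"

definition Y1 ::
  "('u::real_vector \<Rightarrow> ereal) \<Rightarrow> ('u alg_dual \<Rightarrow> 'y::real_vector alg_dual) \<Rightarrow> (nat \<Rightarrow> 'y) set set"
  where "Y1 \<Phi> T = completion (norm_Lam \<Phi> T)"

definition X1 ::
  "('u::real_vector \<Rightarrow> ereal) \<Rightarrow> ('u alg_dual \<Rightarrow> 'y::real_vector alg_dual) \<Rightarrow> 'y alg_dual set"
  where "X1 \<Phi> T = top_dual (norm_Lam \<Phi> T)"

definition sigma_X_Y :: "'y::real_vector alg_dual topology"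
  where "sigma_X_Y = weak_topology UNIV UNIV dual_app"

definition sigma_X1_Y1 ::
  "('u::real_vector \<Rightarrow> ereal) \<Rightarrow> ('u alg_dual \<Rightarrow> 'y::real_vector alg_dual) \<Rightarrow> 'y alg_dual topology"
  where "sigma_X1_Y1 \<Phi> T = weak_topology (X1 \<Phi> T) (Y1 \<Phi> T) compl_app"

definition sigma_L1_U1 :: "('u::real_vector \<Rightarrow> ereal) \<Rightarrow> 'u alg_dual topology"
  where "sigma_L1_U1 \<Phi> = weak_topology (L1 \<Phi>) (U1 \<Phi>) compl_app"

definition C1 ::
  "('u::real_vector \<Rightarrow> ereal) \<Rightarrow> ('u alg_dual \<Rightarrow> 'y::real_vector alg_dual) \<Rightarrow>
    'y alg_dual set \<Rightarrow> 'y alg_dual set"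
  where "C1 \<Phi> T C = C \<inter> X1 \<Phi> T"

definition H_C ::
  "('u::real_vector \<Rightarrow> ereal) \<Rightarrow> ('u alg_dual \<Rightarrow> 'y::real_vector alg_dual) \<Rightarrow>
    'y alg_dual set \<Rightarrow> bool"
  where "H_C \<Phi> T C \<longleftrightarrow> convex (C1 \<Phi> T C) \<and> closedin (sigma_X1_Y1 \<Phi> T) (C1 \<Phi> T C)"


section \<open>The extended adjoints\<close>

text \<open>Elements of \<open>X\<^sub>1\<^sup>a\<^sup>l\<^sup>g\<close> and \<open>L\<^sub>1\<^sup>a\<^sup>l\<^sup>g\<close> are represented as in \<^const>\<open>alg_dual_on\<close>.\<close>

definition T2_adj ::
  "('u::real_vector \<Rightarrow> ereal) \<Rightarrow> ('u alg_dual \<Rightarrow> 'y::real_vector alg_dual) \<Rightarrow>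
    ('y alg_dual \<Rightarrow> real) \<Rightarrow> 'u alg_dual \<Rightarrow> real"
  where "T2_adj \<Phi> T \<omega> = (\<lambda>l\<in>L1 \<Phi>. \<omega> (T l))"

text \<open>\<open>T\<^sub>1\<^sup>*\<close> is the restriction of \<open>T\<^sub>2\<^sup>*\<close> to \<open>Y\<^sub>1 \<subseteq> X\<^sub>1\<^sup>a\<^sup>l\<^sup>g\<close>, its values being read in
  \<open>U\<^sub>1 \<subseteq> L\<^sub>1\<^sup>a\<^sup>l\<^sup>g\<close>; both inclusions are the canonical maps \<^const>\<open>compl_embed\<close>.\<close>

definition T1_adj ::
  "('u::real_vector \<Rightarrow> ereal) \<Rightarrow> ('u alg_dual \<Rightarrow> 'y::real_vector alg_dual) \<Rightarrow>
    (nat \<Rightarrow> 'y) set \<Rightarrow> (nat \<Rightarrow> 'u) set"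
  where "T1_adj \<Phi> T \<eta> =
    inv_into (U1 \<Phi>) (compl_embed (norm_Phi \<Phi>)) (T2_adj \<Phi> T (compl_embed (norm_Lam \<Phi> T) \<eta>))"


section \<open>The functions\<close>

definition Phi_conj :: "('u::real_vector \<Rightarrow> ereal) \<Rightarrow> 'u alg_dual \<Rightarrow> ereal"
  where "Phi_conj \<Phi> l = (SUP u. ereal (dual_app l u) - \<Phi> u)"

definition Phi0 :: "('u::real_vector \<Rightarrow> ereal) \<Rightarrow> 'u \<Rightarrow> ereal"
  where "Phi0 \<Phi> u = (SUP l. ereal (dual_app l u) - Phi_conj \<Phi> l)"

definition Phi1 :: "('u::real_vector \<Rightarrow> ereal) \<Rightarrow> (nat \<Rightarrow> 'u) set \<Rightarrow> ereal"
  where "Phi1 \<Phi> \<xi> = (SUP l\<in>L1 \<Phi>. ereal (compl_app l \<xi>) - Phi_conj \<Phi> l)"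

definition Phi2 :: "('u::real_vector \<Rightarrow> ereal) \<Rightarrow> ('u alg_dual \<Rightarrow> real) \<Rightarrow> ereal"
  where "Phi2 \<Phi> \<zeta> = (SUP l\<in>L1 \<Phi>. ereal (\<zeta> l) - Phi_conj \<Phi> l)"

definition Lam0 ::
  "('u::real_vector \<Rightarrow> ereal) \<Rightarrow> ('u alg_dual \<Rightarrow> 'y::real_vector alg_dual) \<Rightarrow> 'y \<Rightarrow> ereal"
  where "Lam0 \<Phi> T y = Phi0 \<Phi> (adjoint_in T y)"

definition Lam1 ::
  "('u::real_vector \<Rightarrow> ereal) \<Rightarrow> ('u alg_dual \<Rightarrow> 'y::real_vector alg_dual) \<Rightarrow>
    (nat \<Rightarrow> 'y) set \<Rightarrow> ereal"
  where "Lam1 \<Phi> T \<eta> = Phi1 \<Phi> (T1_adj \<Phi> T \<eta>)"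

definition Lam2 ::
  "('u::real_vector \<Rightarrow> ereal) \<Rightarrow> ('u alg_dual \<Rightarrow> 'y::real_vector alg_dual) \<Rightarrow>
    ('y alg_dual \<Rightarrow> real) \<Rightarrow> ereal"
  where "Lam2 \<Phi> T \<omega> = Phi2 \<Phi> (T2_adj \<Phi> T \<omega>)"

definition Phi1_conj :: "('u::real_vector \<Rightarrow> ereal) \<Rightarrow> 'u alg_dual \<Rightarrow> ereal"
  where "Phi1_conj \<Phi> l = (SUP \<xi>\<in>U1 \<Phi>. ereal (compl_app l \<xi>) - Phi1 \<Phi> \<xi>)"

definition Lam0_conj ::
  "('u::real_vector \<Rightarrow> ereal) \<Rightarrow> ('u alg_dual \<Rightarrow> 'y::real_vector alg_dual) \<Rightarrow>
    'y alg_dual \<Rightarrow> ereal"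
  where "Lam0_conj \<Phi> T x = (SUP y. ereal (dual_app x y) - Lam0 \<Phi> T y)"

definition Lam1_conj ::
  "('u::real_vector \<Rightarrow> ereal) \<Rightarrow> ('u alg_dual \<Rightarrow> 'y::real_vector alg_dual) \<Rightarrow>
    'y alg_dual \<Rightarrow> ereal"
  where "Lam1_conj \<Phi> T x = (SUP \<eta>\<in>Y1 \<Phi> T. ereal (compl_app x \<eta>) - Lam1 \<Phi> T \<eta>)"


section \<open>The problems\<close>

definition feas_P ::
  "('u::real_vector alg_dual \<Rightarrow> 'y::real_vector alg_dual) \<Rightarrow> 'y alg_dual set \<Rightarrow> 'u alg_dual set"
  where "feas_P T C = {l. T l \<in> C}"

definition feas_P1 ::
  "('u::real_vector \<Rightarrow> ereal) \<Rightarrow> ('u alg_dual \<Rightarrow> 'y::real_vector alg_dual) \<Rightarrow>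
    'y alg_dual set \<Rightarrow> 'u alg_dual set"
  where "feas_P1 \<Phi> T C = {l \<in> L1 \<Phi>. T l \<in> C1 \<Phi> T C}"

definition inf_P ::
  "('u::real_vector \<Rightarrow> ereal) \<Rightarrow> ('u alg_dual \<Rightarrow> 'y::real_vector alg_dual) \<Rightarrow>
    'y alg_dual set \<Rightarrow> ereal"
  where "inf_P \<Phi> T C = min_value (Phi_conj \<Phi>) (feas_P T C)"

definition inf_P1 ::
  "('u::real_vector \<Rightarrow> ereal) \<Rightarrow> ('u alg_dual \<Rightarrow> 'y::real_vector alg_dual) \<Rightarrow>
    'y alg_dual set \<Rightarrow> ereal"
  where "inf_P1 \<Phi> T C = min_value (Phi1_conj \<Phi>) (feas_P1 \<Phi> T C)"

definition sol_P ::
  "('u::real_vector \<Rightarrow> ereal) \<Rightarrow> ('u alg_dual \<Rightarrow> 'y::real_vector alg_dual) \<Rightarrow>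
    'y alg_dual set \<Rightarrow> 'u alg_dual set"
  where "sol_P \<Phi> T C = solutions (Phi_conj \<Phi>) (feas_P T C)"

definition sol_P1 ::
  "('u::real_vector \<Rightarrow> ereal) \<Rightarrow> ('u alg_dual \<Rightarrow> 'y::real_vector alg_dual) \<Rightarrow>
    'y alg_dual set \<Rightarrow> 'u alg_dual set"
  where "sol_P1 \<Phi> T C = solutions (Phi1_conj \<Phi>) (feas_P1 \<Phi> T C)"

definition sol_P1X ::
  "('u::real_vector \<Rightarrow> ereal) \<Rightarrow> ('u alg_dual \<Rightarrow> 'y::real_vector alg_dual) \<Rightarrow>
    'y alg_dual set \<Rightarrow> 'y alg_dual set"
  where "sol_P1X \<Phi> T C = solutions (Lam0_conj \<Phi> T) (C1 \<Phi> T C)"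

text \<open>The values subtracted below are nonnegative, since \<open>\<Phi>\<^sup>*(0) = 0\<close> under \<^const>\<open>H_Phi\<close>;
  and if \<open>C = {}\<close> the infima over \<open>C\<close> are \<open>\<infinity>\<close>, with dual value \<open>\<infinity>\<close> already at \<open>0\<close>.  So the
  conventions \<open>-\<infinity> - \<infinity> = -\<infinity>\<close> and \<open>\<infinity> - \<infinity> = \<infinity>\<close> of \<^typ>\<open>ereal\<close> do no harm.\<close>

definition sup_D0 ::
  "('u::real_vector \<Rightarrow> ereal) \<Rightarrow> ('u alg_dual \<Rightarrow> 'y::real_vector alg_dual) \<Rightarrow>
    'y alg_dual set \<Rightarrow> ereal"
  where "sup_D0 \<Phi> T C = (SUP y. (INF x\<in>C. ereal (dual_app x y)) - Lam0 \<Phi> T y)"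

definition sup_D1 ::
  "('u::real_vector \<Rightarrow> ereal) \<Rightarrow> ('u alg_dual \<Rightarrow> 'y::real_vector alg_dual) \<Rightarrow>
    'y alg_dual set \<Rightarrow> ereal"
  where "sup_D1 \<Phi> T C =
    (SUP \<eta>\<in>Y1 \<Phi> T. (INF x\<in>C1 \<Phi> T C. ereal (compl_app x \<eta>)) - Lam1 \<Phi> T \<eta>)"

definition sup_D2 ::
  "('u::real_vector \<Rightarrow> ereal) \<Rightarrow> ('u alg_dual \<Rightarrow> 'y::real_vector alg_dual) \<Rightarrow>
    'y alg_dual set \<Rightarrow> ereal"
  where "sup_D2 \<Phi> T C =
    (SUP \<omega>\<in>alg_dual_on (X1 \<Phi> T). (INF x\<in>C1 \<Phi> T C. ereal (\<omega> x)) - Lam2 \<Phi> T \<omega>)"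

end

theory Submission
  imports Defs
begin

text \<open>
  The dual problem is treated by a sandwich theorem on the space of dual variables itself.
  Because \<open>\<Phi>\<close> is finite near \<open>0\<close> on every line, the bound
  \<open>inf x\<in>C. \<langle>y, x\<rangle> \<le> c + \<Lambda> y\<close> for all \<open>y\<close>, with \<open>c\<close> the dual value, lets a linear functional \<open>x\<close>
  be inserted: \<open>inf z\<in>C. \<langle>y, z\<rangle> \<le> \<langle>y, x\<rangle> \<le> c + \<Lambda> y\<close>.  The second inequality says \<open>\<Lambda>\<^sup>* x \<le> c\<close>, and
  the first says \<open>x \<in> C\<close>, because \<open>C\<close> is convex and weakly closed.  On \<open>Y\<^sub>1\<close> the functional is
  moreover continuous, hence a point of \<open>X\<^sub>1\<close>.  Extending \<open>x\<close> from \<open>T\<^sup>* Y\<close> to \<open>U\<close> below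
  \<open>\<Phi> + c\<close> by the Hahn-Banach theorem gives \<open>l\<close> with \<open>T l = x\<close> and \<open>\<Phi>\<^sup>* l = \<Lambda>\<^sup>* x\<close>.
  Cluster points of minimizing sequences come from Tychonoff's theorem, as a bound on \<open>\<Phi>\<^sup>*\<close>
  bounds the norm of the functional.
\<close>

section \<open>The Hahn-Banach theorem\<close>

text \<open>Both \<open>\<Phi>\<close> and \<open>Lam \<Phi> T\<close> are nonnegative, convex, zero
  at the origin and finite somewhere on every ray, so one theory of such functions \<open>F\<close>
  serves \<open>U\<close> and \<open>Y\<close> alike. The constraint then moves from
  \<open>l\<close> to \<open>x\<close>: on each fibre \<open>T l = x\<close> the least value of
  \<open>Phi_conj \<Phi>\<close> is \<open>Phi_conj (Lam \<Phi> T) x\<close>, and what remains is to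
  minimize a single conjugate over \<open>C\<close>. A finite conjugate forces boundedness for the
  gauge norm. Points outside \<open>L1\<close> or \<open>X1\<close> therefore affect neither values
  nor solutions, which ties the algebraic problem to the topological one.

  The obstacle is the completion: it is a set of classes of Cauchy sequences without vector
  operations, whereas a Hahn-Banach argument needs a subspace of a real vector space. Hence the
  detour through the algebraic bidual, and the separation theorem for an index set \<open>G\<close>
  that has combinations only at the level of pairings.\<close>

definition sublinear :: "('a::real_vector \<Rightarrow> real) \<Rightarrow> bool"
  where "sublinear p \<longleftrightarrow> (\<forall>x y. p (x + y) \<le> p x + p y) \<and> (\<forall>c\<ge>0. \<forall>x. p (c *\<^sub>R x) = c * p x)"

lemma sublinear_add: "sublinear p \<Longrightarrow> p (x + y) \<le> p x + p y"
  and sublinear_scale: "sublinear p \<Longrightarrow> 0 \<le> c \<Longrightarrow> p (c *\<^sub>R x) = c * p x"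
  by (auto simp: sublinear_def)

lemma sublinear_zero: "sublinear p \<Longrightarrow> p 0 = 0"
  using sublinear_scale[of p 0 0] by simp

lemma sublinear_minus: "sublinear p \<Longrightarrow> - p (- x) \<le> p x"
  using sublinear_add[of p x "- x"] sublinear_zero[of p] by simp

text \<open>The common majorant \<open>q\<close> also gives a common minorant:
  \<open>- q (- x) \<le> - p (- x) \<le> p x\<close>, so the infima are real. For subadditivity two
  members of the chain are replaced by the smaller one.\<close>

lemma sublinear_Inf_chain:
  assumes "C \<noteq> {}" and sub: "\<And>p. p \<in> C \<Longrightarrow> sublinear p"
    and chain: "\<And>p q. p \<in> C \<Longrightarrow> q \<in> C \<Longrightarrow> p \<le> q \<or> q \<le> p"
    and le: "\<And>p. p \<in> C \<Longrightarrow> p \<le> q"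
  shows "sublinear (\<lambda>x. INF p\<in>C. p x)" and "\<And>p. p \<in> C \<Longrightarrow> (\<lambda>x. INF p\<in>C. p x) \<le> p"
proof -
  have bdd: "bdd_below ((\<lambda>p. p x) ` C)" for x
    by (rule bdd_belowI2[of _ "- q (- x)"])
      (meson le le_funD neg_le_iff_le order_trans sub sublinear_minus)
  have lower: "(INF p\<in>C. p x) \<le> p x" if "p \<in> C" for p x
    by (rule cINF_lower[OF bdd that])
  then show "\<And>p. p \<in> C \<Longrightarrow> (\<lambda>x. INF p\<in>C. p x) \<le> p"
    by (simp add: le_fun_def)
  show "sublinear (\<lambda>x. INF p\<in>C. p x)"
    unfolding sublinear_def
  proof (intro conjI allI impI)
    fix x y
    have "(INF p\<in>C. p (x + y)) \<le> p x + p' y" if "p \<in> C" "p' \<in> C" for p p'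
    proof -
      have "\<exists>p''\<in>C. p'' \<le> p \<and> p'' \<le> p'"
        using chain[OF that] that by auto
      then obtain p'' where "p'' \<in> C" "p'' \<le> p" "p'' \<le> p'"
        by blast
      then have "p'' (x + y) \<le> p x + p' y"
        using sublinear_add[OF sub, of p'' x y] by (meson add_mono le_funD order_trans)
      then show ?thesis
        using lower[OF \<open>p'' \<in> C\<close>, of "x + y"] by simp
    qed
    then have "(INF p\<in>C. p (x + y)) - p' y \<le> (INF p\<in>C. p x)" if "p' \<in> C" for p'
      using that by (intro cINF_greatest[OF \<open>C \<noteq> {}\<close>]) (simp add: algebra_simps)
    then have "(INF p\<in>C. p (x + y)) - (INF p\<in>C. p x) \<le> (INF p\<in>C. p y)"
      by (intro cINF_greatest[OF \<open>C \<noteq> {}\<close>]) (simp add: algebra_simps)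
    then show "(INF p\<in>C. p (x + y)) \<le> (INF p\<in>C. p x) + (INF p\<in>C. p y)"
      by simp
  next
    fix c :: real and x assume "0 \<le> c"
    have "(INF p\<in>C. p (c *\<^sub>R x)) = (INF p\<in>C. c * p x)"
      by (intro INF_cong refl sublinear_scale sub \<open>0 \<le> c\<close>)
    also have "\<dots> = c * (INF p\<in>C. p x)"
    proof -
      have "mono ((*) c)"
        using \<open>0 \<le> c\<close> by (simp add: mono_def mult_left_mono)
      moreover have "continuous (at_right z) ((*) c)" for z
        by (intro continuous_mult_left continuous_ident)
      ultimately show ?thesis
        using continuous_at_Inf_mono[of "(*) c" "(\<lambda>p. p x) ` C"] \<open>C \<noteq> {}\<close> bdd[of x]
        by (simp add: image_image)
    qed
    finally show "(INF p\<in>C. p (c *\<^sub>R x)) = c * (INF p\<in>C. p x)" .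
  qed
qed

text \<open>A minimal sublinear functional \<open>p\<close> coincides with each of the functionals below, and
  this forces \<open>p x + p a \<le> p (x + a)\<close>.\<close>

lemma sublinear_shift:
  assumes p: "sublinear p"
  shows "sublinear (\<lambda>x. INF t\<in>{0..}. p (x + t *\<^sub>R a) - t * p a)" (is "sublinear ?q")
    and "0 \<le> t \<Longrightarrow> (INF t\<in>{0..}. p (x + t *\<^sub>R a) - t * p a) \<le> p (x + t *\<^sub>R a) - t * p a"
proof -
  have bound: "- p (- x) \<le> p (x + t *\<^sub>R a) - t * p a" if "0 \<le> t" for t x
    using sublinear_add[OF p, of "x + t *\<^sub>R a" "- x"] sublinear_scale[OF p that, of a] by simp
  have bdd: "bdd_below ((\<lambda>t. p (x + t *\<^sub>R a) - t * p a) ` {0..})" for x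
    by (rule bdd_belowI2[of _ "- p (- x)"]) (use bound in auto)
  have lower: "?q x \<le> p (x + t *\<^sub>R a) - t * p a" if "0 \<le> t" for t x
    by (rule cINF_lower[OF bdd]) (use that in auto)
  then show "0 \<le> t \<Longrightarrow> ?q x \<le> p (x + t *\<^sub>R a) - t * p a" .
  have ne: "{0::real..} \<noteq> {}" by simp
  \<comment> \<open>The parameter \<open>t\<close> at \<open>x\<close> corresponds to
    \<open>c * t\<close> at \<open>c *\<^sub>R x\<close>. The opposite inequality is this one for
    \<open>1 / c\<close>.\<close>
  have scale_le: "?q (c *\<^sub>R x) \<le> c * ?q x" if "0 < c" for c x
  proof -
    have "?q (c *\<^sub>R x) / c \<le> ?q x"
    proof (rule cINF_greatest[OF ne])
      fix t :: real assume "t \<in> {0..}"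
      then have "?q (c *\<^sub>R x) \<le> p (c *\<^sub>R x + (c * t) *\<^sub>R a) - (c * t) * p a"
        using that by (intro lower) auto
      also have "\<dots> = c * (p (x + t *\<^sub>R a) - t * p a)"
        using sublinear_scale[OF p, of c "x + t *\<^sub>R a"] that by (simp add: algebra_simps)
      finally show "?q (c *\<^sub>R x) / c \<le> p (x + t *\<^sub>R a) - t * p a"
        using that by (simp add: field_simps)
    qed
    then show ?thesis using that by (simp add: field_simps)
  qed
  show "sublinear ?q"
    unfolding sublinear_def
  proof (intro conjI allI impI)
    fix x y
    have "?q (x + y) \<le> (p (x + s *\<^sub>R a) - s * p a) + (p (y + t *\<^sub>R a) - t * p a)"
      if "0 \<le> s" "0 \<le> t" for s t
    proof -
      have "?q (x + y) \<le> p ((x + y) + (s + t) *\<^sub>R a) - (s + t) * p a"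
        using that by (intro lower) auto
      also have "\<dots> \<le> (p (x + s *\<^sub>R a) + p (y + t *\<^sub>R a)) - (s + t) * p a"
        using sublinear_add[OF p, of "x + s *\<^sub>R a" "y + t *\<^sub>R a"] by (simp add: algebra_simps)
      finally show ?thesis by (simp add: algebra_simps)
    qed
    then have "?q (x + y) - (p (y + t *\<^sub>R a) - t * p a) \<le> ?q x" if "0 \<le> t" for t
      using that by (intro cINF_greatest[OF ne]) (simp add: algebra_simps)
    then have "?q (x + y) - ?q x \<le> ?q y"
      by (intro cINF_greatest[OF ne]) (simp add: algebra_simps)
    then show "?q (x + y) \<le> ?q x + ?q y" by simp
  next
    fix c :: real and x assume "0 \<le> c"
    show "?q (c *\<^sub>R x) = c * ?q x"
    proof (cases "c = 0")
      case True
      have "?q 0 = 0"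
      proof (rule antisym)
        show "?q 0 \<le> 0" using lower[of 0 0] sublinear_zero[OF p] by simp
        show "0 \<le> ?q 0"
          by (rule cINF_greatest[OF ne]) (use bound[of _ 0] sublinear_zero[OF p] in auto)
      qed
      then show ?thesis using True by simp
    next
      case False
      with \<open>0 \<le> c\<close> have "0 < c" by simp
      have "?q ((1 / c) *\<^sub>R (c *\<^sub>R x)) \<le> (1 / c) * ?q (c *\<^sub>R x)"
        using \<open>0 < c\<close> by (intro scale_le) simp
      then have "c * ?q x \<le> ?q (c *\<^sub>R x)"
        using \<open>0 < c\<close> by (simp add: field_simps)
      then show ?thesis using scale_le[OF \<open>0 < c\<close>, of x] by simp
    qed
  qed
qed

lemma sublinear_minimal_linear:
  assumes p: "sublinear p" and min: "\<And>p'. sublinear p' \<Longrightarrow> p' \<le> p \<Longrightarrow> p' = p"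
  shows "linear p"
proof -
  have add: "p (x + a) = p x + p a" for x a
  proof (rule antisym)
    let ?q = "\<lambda>x. INF t\<in>{0..}. p (x + t *\<^sub>R a) - t * p a"
    have "?q \<le> p"
      using sublinear_shift(2)[OF p, of 0 _ a] by (simp add: le_fun_def)
    then have "?q = p"
      by (rule min[OF sublinear_shift(1)[OF p]])
    then have "p x = ?q x"
      by (rule fun_cong[OF sym])
    also have "\<dots> \<le> p (x + 1 *\<^sub>R a) - 1 * p a"
      by (rule sublinear_shift(2)[OF p]) simp
    finally show "p x + p a \<le> p (x + a)" by simp
  qed (rule sublinear_add[OF p])
  have minus: "p (- x) = - p x" for x
    using add[of x "- x"] sublinear_zero[OF p] by simp
  have "p (c *\<^sub>R x) = c * p x" for c x
  proof (cases "0 \<le> c")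
    case False
    then have "p ((- c) *\<^sub>R x) = (- c) * p x" by (intro sublinear_scale[OF p]) simp
    then show ?thesis using minus[of "c *\<^sub>R x"] by simp
  qed (rule sublinear_scale[OF p])
  with add show ?thesis by (simp add: linear_iff)
qed

text \<open>Zorn's lemma for the reversed order yields a minimal sublinear function below
  \<open>q\<close>, and minimality already forces linearity; no extension by one dimension at a time
  occurs.\<close>

theorem sublinear_dominates_linear:
  assumes q: "sublinear q"
  shows "\<exists>f. linear f \<and> (\<forall>x. f x \<le> q x)"
proof -
  define A where "A = {p. sublinear p \<and> p \<le> q}"
  have "\<exists>m\<in>A. \<forall>a\<in>A. a \<le> m \<longrightarrow> a = m"
  proof (rule predicate_Zorn[of A "\<lambda>a b. b \<le> a"])
    show "partial_order_on A (relation_of (\<lambda>a b. b \<le> a) A)"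
      by (auto simp: partial_order_on_def preorder_on_def refl_on_def trans_def antisym_def
          relation_of_def intro: order_trans antisym)
    fix C assume C: "C \<in> Chains (relation_of (\<lambda>a b. b \<le> a) A)"
    show "\<exists>u\<in>A. \<forall>a\<in>C. u \<le> a"
    proof (cases "C = {}")
      case True
      then show ?thesis using q by (auto simp: A_def)
    next
      case False
      have CA: "sublinear p" "p \<le> q" if "p \<in> C" for p
        using C that by (auto simp: Chains_def relation_of_def A_def)
      have chain: "p \<le> p' \<or> p' \<le> p" if "p \<in> C" "p' \<in> C" for p p'
        using C that by (auto simp: Chains_def relation_of_def)
      let ?u = "\<lambda>x. INF p\<in>C. p x"
      have "sublinear ?u" "\<And>p. p \<in> C \<Longrightarrow> ?u \<le> p"
        using sublinear_Inf_chain[of C q] False CA chain by blast+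
      then show ?thesis
        using False CA(2) by (intro bexI[of _ ?u]) (auto simp: A_def intro: order_trans)
    qed
  qed
  then obtain m where m: "sublinear m" "m \<le> q" "\<And>a. sublinear a \<Longrightarrow> a \<le> m \<Longrightarrow> a = m"
    by (auto simp: A_def)
  then show ?thesis
    using sublinear_minimal_linear[of m] by (auto simp: le_fun_def)
qed

text \<open>The functional \<open>f\<close> is found below the gauge \<open>u \<mapsto> inf {r / t | (t u, r) \<in> A}\<close>.\<close>

lemma convex_epigraph_linear_minorant:
  fixes A :: "('a::real_vector \<times> real) set"
  assumes cvx: "convex A"
    and abs: "\<And>u. \<exists>t>0. \<exists>r. (t *\<^sub>R u, r) \<in> A"
    and zero: "\<And>r. (0, r) \<in> A \<Longrightarrow> 0 \<le> r"
  shows "\<exists>f. linear f \<and> (\<forall>(u, r)\<in>A. f u \<le> r)"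
proof -
  define R where "R u = {r / t | r t. 0 < t \<and> (t *\<^sub>R u, r) \<in> A}" for u
  have ne: "R u \<noteq> {}" for u
    using abs[of u] by (auto simp: R_def)
  have comb: "a + b \<in> R (u + v)" if "a \<in> R u" "b \<in> R v" for a b u v
  proof -
    obtain r s t w where *: "0 < t" "(t *\<^sub>R u, r) \<in> A" "a = r / t"
        "0 < s" "(s *\<^sub>R v, w) \<in> A" "b = w / s"
      using \<open>a \<in> R u\<close> \<open>b \<in> R v\<close> by (auto simp: R_def)
    \<comment> \<open>The weights \<open>s / (s + t)\<close> and \<open>t / (s + t)\<close> are
      chosen so that \<open>u\<close> and \<open>v\<close> receive the same factor
      \<open>k\<close>.\<close>
    define k where "k = s * t / (s + t)"
    have "0 < s + t" using * by simp
    then have "(s / (s + t)) *\<^sub>R (t *\<^sub>R u, r) + (t / (s + t)) *\<^sub>R (s *\<^sub>R v, w) \<in> A"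
      using * by (intro convexD[OF cvx]) (auto simp flip: add_divide_distrib)
    also have "(s / (s + t)) *\<^sub>R (t *\<^sub>R u, r) = (k *\<^sub>R u, k * a)"
      using * by (simp add: k_def)
    also have "(t / (s + t)) *\<^sub>R (s *\<^sub>R v, w) = (k *\<^sub>R v, k * b)"
      using * by (simp add: k_def)
    finally have "(k *\<^sub>R (u + v), k * (a + b)) \<in> A"
      by (simp add: algebra_simps)
    moreover have "0 < k" using * by (simp add: k_def)
    ultimately show ?thesis
      unfolding R_def by (intro CollectI exI[of _ "k * (a + b)"] exI[of _ k]) simp
  qed
  have nonneg: "0 \<le> a" if "a \<in> R 0" for a
    using that zero by (auto simp: R_def)
  \<comment> \<open>Any element of \<open>R (- u)\<close> bounds \<open>R u\<close> from below,
    because the sums lie in \<open>R 0\<close>, where \<open>zero\<close> applies.\<close>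
  have bdd: "bdd_below (R u)" for u
  proof -
    obtain b where "b \<in> R (- u)" using ne by blast
    then have "- b \<le> a" if "a \<in> R u" for a
      using nonneg[of "a + b"] comb[OF that, of b "- u"] by simp
    then show ?thesis by (auto simp: bdd_below_def)
  qed
  define q where "q u = Inf (R u)" for u
  have q_le: "q u \<le> a" if "a \<in> R u" for a u
    unfolding q_def by (rule cInf_lower[OF that bdd])
  have R_scale: "c * a \<in> R (c *\<^sub>R u)" if "a \<in> R u" "0 < c" for a c u
  proof -
    obtain r t where "0 < t" "(t *\<^sub>R u, r) \<in> A" "a = r / t"
      using \<open>a \<in> R u\<close> unfolding R_def by blast
    then show ?thesis
      using \<open>0 < c\<close> unfolding R_def
      by (intro CollectI exI[of _ r] exI[of _ "t / c"]) simp
  qed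
  have q_scale_le: "q (c *\<^sub>R u) \<le> c * q u" if "0 < c" for c u
  proof -
    have "q (c *\<^sub>R u) / c \<le> q u"
      unfolding q_def[of u]
      by (rule cInf_greatest[OF ne]) (use q_le[OF R_scale[OF _ that]] that in \<open>simp add: field_simps\<close>)
    then show ?thesis using that by (simp add: field_simps)
  qed
  have q_add: "q (u + v) \<le> q u + q v" for u v
  proof -
    have "q (u + v) - b \<le> q u" if "b \<in> R v" for b
      unfolding q_def[of u]
      by (rule cInf_greatest[OF ne]) (use q_le[OF comb[OF _ that]] in \<open>simp add: field_simps\<close>)
    then have "q (u + v) - q u \<le> q v"
      unfolding q_def[of v] by (intro cInf_greatest[OF ne]) (simp add: field_simps)
    then show ?thesis by simp
  qed
  have q_zero: "q 0 = 0"
  proof (rule antisym)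
    show "0 \<le> q 0" unfolding q_def by (intro cInf_greatest[OF ne] nonneg)
    \<comment> \<open>Scaling by \<open>1/2\<close> fixes the origin, so
      \<open>q 0 \<le> q 0 / 2\<close>.\<close>
    show "q 0 \<le> 0" using q_scale_le[of "1/2" 0] by simp
  qed
  have "sublinear q"
    unfolding sublinear_def
  proof (intro conjI allI impI q_add)
    fix c :: real and x assume "0 \<le> c"
    show "q (c *\<^sub>R x) = c * q x"
    proof (cases "c = 0")
      case False
      with \<open>0 \<le> c\<close> have "0 < c" by simp
      then show ?thesis
        using q_scale_le[of c x] q_scale_le[of "1 / c" "c *\<^sub>R x"] by (simp add: field_simps)
    qed (simp add: q_zero)
  qed
  then obtain f where f: "linear f" "\<And>x. f x \<le> q x"
    using sublinear_dominates_linear by blast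
  have "f u \<le> r" if "(u, r) \<in> A" for u r
  proof -
    have "r / 1 \<in> R u"
      unfolding R_def using that by (intro CollectI exI[of _ r] exI[of _ 1]) simp
    then show ?thesis using f(2)[of u] q_le[of r u] by simp
  qed
  with f(1) show ?thesis by blast
qed

text \<open>Composition with \<open>P\<close> turns objects living on a subspace into objects on the
  whole type.\<close>

lemma linear_projection_exists:
  fixes S :: "'a::real_vector set"
  assumes "subspace S"
  obtains P where "linear P" "range P \<subseteq> S" "\<And>x. x \<in> S \<Longrightarrow> P x = x"
proof -
  obtain P where "range P \<subseteq> S" "linear P" "\<forall>x\<in>S. P (id x) = x"
    using linear_exists_left_inverse_on[OF linear_id assms inj_on_id] by blast
  then show thesis by (intro that[of P]) auto
qed

text \<open>The preimage of \<open>A\<close> under \<open>P\<close> in the first component meets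
  every ray, since \<open>P u\<close> is always in \<open>S\<close>; and it contains
  \<open>A\<close>, since \<open>P\<close> fixes \<open>S\<close>.\<close>

lemma convex_epigraph_linear_minorant_on:
  fixes A :: "('a::real_vector \<times> real) set"
  assumes S: "subspace S" and A: "\<And>u r. (u, r) \<in> A \<Longrightarrow> u \<in> S" and cvx: "convex A"
    and abs: "\<And>u. u \<in> S \<Longrightarrow> \<exists>t>0. \<exists>r. (t *\<^sub>R u, r) \<in> A"
    and zero: "\<And>r. (0, r) \<in> A \<Longrightarrow> 0 \<le> r"
  shows "\<exists>f. linear f \<and> (\<forall>(u, r)\<in>A. f u \<le> r)"
proof -
  obtain P where P: "linear P" "range P \<subseteq> S" "\<And>x. x \<in> S \<Longrightarrow> P x = x"
    using linear_projection_exists[OF S] by blast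
  have lin: "linear (\<lambda>(u, r::real). (P u, r))"
    using P(1) by (auto simp: linear_iff)
  have "\<exists>f. linear f \<and> (\<forall>(u, r)\<in>(\<lambda>(u, r). (P u, r)) -` A. f u \<le> r)"
  proof (rule convex_epigraph_linear_minorant)
    show "convex ((\<lambda>(u, r). (P u, r)) -` A)"
      by (rule convex_linear_vimage[OF lin cvx])
    show "\<exists>t>0. \<exists>r. (t *\<^sub>R u, r) \<in> (\<lambda>(u, r). (P u, r)) -` A" for u
    proof -
      have "P u \<in> S" using P(2) by blast
      then show ?thesis using abs[of "P u"] P(1) by (simp add: linear_scale)
    qed
    show "0 \<le> r" if "(0, r) \<in> (\<lambda>(u, r). (P u, r)) -` A" for r
      using that zero linear_0[OF P(1)] by auto
  qed
  then obtain f where f: "linear f" "\<forall>(u, r)\<in>(\<lambda>(u, r). (P u, r)) -` A. f u \<le> r"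
    by blast
  have "f u \<le> r" if "(u, r) \<in> A" for u r
    using bspec[OF f(2), of "(u, r)"] P(3)[OF A[OF that]] that by simp
  with f(1) show ?thesis by blast
qed

text \<open>Removes an additive constant from an inequality between homogeneous quantities. This is
  how one affine bound yields both halves of a sandwich.\<close>

lemma le_of_scaled_le:
  fixes a b k :: real
  assumes "\<And>n. real n * a \<le> real n * b + k"
  shows "a \<le> b"
proof (rule ccontr)
  assume "\<not> a \<le> b"
  then obtain n where "k < real n * (a - b)"
    using reals_Archimedean3[of "a - b"] by auto
  then show False
    using assms[of n] by (simp add: algebra_simps)
qed

section \<open>Separation and sandwich theorems\<close>

text \<open>A functional that vanishes on the common kernel of finitely many functionals is a
  combination of them. Combinations are demanded of \<open>G\<close> only through their pairings
  with \<open>S\<close>, because \<open>G\<close> will be a completion, which has no addition of its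
  own.\<close>

lemma linear_eq_pairing_of_common_zeros:
  fixes f :: "'a::real_vector \<Rightarrow> real" and b :: "'a \<Rightarrow> 'b \<Rightarrow> real"
  assumes "finite I" and S: "subspace S" and f: "linear f"
    and lin: "\<And>g. g \<in> G \<Longrightarrow> \<exists>h. linear h \<and> (\<forall>x\<in>S. h x = b x g)"
    and zero: "\<exists>k\<in>G. \<forall>x\<in>S. b x k = 0"
    and comb: "\<And>g h c. g \<in> G \<Longrightarrow> h \<in> G \<Longrightarrow> \<exists>k\<in>G. \<forall>x\<in>S. b x k = b x g + c * b x h"
    and "I \<subseteq> G" and "\<And>x. x \<in> S \<Longrightarrow> (\<forall>g\<in>I. b x g = 0) \<Longrightarrow> f x = 0"
  shows "\<exists>k\<in>G. \<forall>x\<in>S. f x = b x k"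
  using \<open>finite I\<close> f assms(7,8)
proof (induction I arbitrary: f rule: finite_induct)
  case empty
  then show ?case using zero by auto
next
  case (insert g I)
  obtain h where h: "linear h" "\<And>x. x \<in> S \<Longrightarrow> h x = b x g"
    using lin insert.prems(2) by blast
  show ?case
  proof (cases "\<exists>z\<in>S. (\<forall>i\<in>I. b z i = 0) \<and> b z g \<noteq> 0")
    case False
    then show ?thesis
      using insert.prems by (intro insert.IH) auto
  next
    case True
    then obtain z where z: "z \<in> S" "\<And>i. i \<in> I \<Longrightarrow> b z i = 0" "b z g \<noteq> 0" by blast
    define c where "c = f z / h z"
    have "linear (\<lambda>x. f x - c * h x)"
      using insert.prems(1) h(1) by (simp add: linear_iff algebra_simps)
    moreover have "f x - c * h x = 0" if x: "x \<in> S" "\<forall>i\<in>I. b x i = 0" for x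
    proof -
      \<comment> \<open>Shifting \<open>x\<close> along \<open>z\<close> kills the pairing with
        \<open>g\<close> and keeps the zeros for \<open>I\<close>, so the hypothesis on
        \<open>f\<close> applies to \<open>y\<close>.\<close>
      define y where "y = x - (h x / h z) *\<^sub>R z"
      have y: "y \<in> S"
        using x z S by (simp add: y_def subspace_diff subspace_scale)
      have "b y i = 0" if "i \<in> I" for i
      proof -
        obtain k where k: "linear k" "\<And>x. x \<in> S \<Longrightarrow> k x = b x i"
          using lin insert.prems(2) \<open>i \<in> I\<close> by blast
        have "k y = k x - (h x / h z) * k z"
          using k(1) by (simp add: y_def linear_diff linear_scale)
        then show ?thesis using k(2) x y z \<open>i \<in> I\<close> by simp
      qed
      moreover have "h y = 0"
        using h z by (simp add: y_def linear_diff linear_scale)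
      ultimately have "f y = 0"
        using insert.prems(3) y h(2) by simp
      then show ?thesis
        using insert.prems(1) by (simp add: y_def c_def linear_diff linear_scale)
    qed
    ultimately obtain k where k: "k \<in> G" "\<forall>x\<in>S. f x - c * h x = b x k"
      using insert.IH insert.prems(2) by blast
    obtain k' where "k' \<in> G" "\<forall>x\<in>S. b x k' = b x k + c * b x g"
      using comb[OF k(1), of g c] insert.prems(2) by blast
    then have "\<forall>x\<in>S. f x = b x k'"
      using k h by (simp add: algebra_simps)
    with \<open>k' \<in> G\<close> show ?thesis by blast
  qed
qed

lemma topspace_weak_topology [simp]: "topspace (weak_topology E G b) = E"
  by (auto simp: weak_topology_def topspace_pullback_topology)

lemma openin_weak_topology_nbhd:
  assumes "openin (weak_topology E G b) V" "x0 \<in> V"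
  shows "\<exists>I e. finite I \<and> I \<subseteq> G \<and> 0 < e \<and>
    (\<forall>x\<in>E. (\<forall>i\<in>I. \<bar>b x i - b x0 i\<bar> < e) \<longrightarrow> x \<in> V)"
proof -
  let ?g = "\<lambda>x. \<lambda>i\<in>G. b x i"
  obtain U where U: "openin (product_topology (\<lambda>_. euclideanreal) G) U" "V = ?g -` U \<inter> E"
    using assms(1) by (auto simp: weak_topology_def openin_pullback_topology)
  have "?g x0 \<in> U" using U assms(2) by auto
  then obtain W where W: "finite {i \<in> G. W i \<noteq> (UNIV::real set)}" "\<And>i. i \<in> G \<Longrightarrow> open (W i)"
      "?g x0 \<in> Pi\<^sub>E G W" "Pi\<^sub>E G W \<subseteq> U"
    using U(1) unfolding openin_product_topology_alt by force
  define I where "I = {i \<in> G. W i \<noteq> UNIV}"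
  have "\<exists>d>0. \<forall>y. \<bar>y - b x0 i\<bar> < d \<longrightarrow> y \<in> W i" if "i \<in> I" for i
  proof -
    have "b x0 i \<in> W i" using W(3) that by (auto simp: I_def PiE_iff)
    then show ?thesis
      using W(2)[of i] that by (auto simp: I_def open_dist dist_real_def)
  qed
  then obtain d where d: "\<And>i. i \<in> I \<Longrightarrow> 0 < d i"
      "\<And>i y. i \<in> I \<Longrightarrow> \<bar>y - b x0 i\<bar> < d i \<Longrightarrow> y \<in> W i"
    by metis
  \<comment> \<open>The inserted \<open>1\<close> keeps the minimum meaningful when no coordinate is
    restricted.\<close>
  define e where "e = Min (insert 1 (d ` I))"
  have fin: "finite I" using W(1) by (simp add: I_def)
  show ?thesis
  proof (intro exI conjI ballI impI)
    show "finite I" by (rule fin)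
    show "I \<subseteq> G" by (auto simp: I_def)
    show "0 < e" using fin d(1) by (auto simp: e_def)
    fix x assume x: "x \<in> E" "\<forall>i\<in>I. \<bar>b x i - b x0 i\<bar> < e"
    have "b x i \<in> W i" if "i \<in> G" for i
    proof (cases "i \<in> I")
      case True
      have "e \<le> d i" using fin True by (auto simp: e_def)
      then show ?thesis using d(2)[OF True] bspec[OF x(2) True] by simp
    next
      case False
      then show ?thesis using that by (auto simp: I_def)
    qed
    then have "?g x \<in> U" using W(4) by (auto simp: PiE_iff)
    then show "x \<in> V" using U(2) x(1) by simp
  qed
qed

text \<open>A weak neighbourhood of \<open>x0\<close> that misses \<open>D\<close> contains a ball
  of a seminorm \<open>N\<close> built from finitely many pairings. A functional that separates
  \<open>D\<close> from this ball is dominated by \<open>N\<close>, hence vanishes where these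
  pairings do, hence is itself a pairing.\<close>

theorem weak_topology_separation:
  fixes b :: "'a::real_vector \<Rightarrow> 'b \<Rightarrow> real"
  assumes S: "subspace S"
    and lin: "\<And>g. g \<in> G \<Longrightarrow> \<exists>h. linear h \<and> (\<forall>x\<in>S. h x = b x g)"
    and zero: "\<exists>k\<in>G. \<forall>x\<in>S. b x k = 0"
    and comb: "\<And>g h c. g \<in> G \<Longrightarrow> h \<in> G \<Longrightarrow> \<exists>k\<in>G. \<forall>x\<in>S. b x k = b x g + c * b x h"
    and D: "closedin (weak_topology S G b) D" "convex D" and x0: "x0 \<in> S" "x0 \<notin> D"
  shows "\<exists>k\<in>G. \<exists>e>0. \<forall>x\<in>D. b x0 k + e \<le> b x k"
proof -
  have DS: "D \<subseteq> S" using closedin_subset[OF D(1)] by simp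
  have "openin (weak_topology S G b) (S - D)"
    using D(1) by (simp add: closedin_def)
  moreover have "x0 \<in> S - D" using x0 by simp
  ultimately obtain I e where I: "finite I" "I \<subseteq> G" "0 < e"
    "\<forall>x\<in>S. (\<forall>i\<in>I. \<bar>b x i - b x0 i\<bar> < e) \<longrightarrow> x \<in> S - D"
    using openin_weak_topology_nbhd by metis
  obtain h where h: "\<And>i. i \<in> I \<Longrightarrow> linear (h i)" "\<And>i x. i \<in> I \<Longrightarrow> x \<in> S \<Longrightarrow> h i x = b x i"
    using lin I(2) by (metis subsetD)
  \<comment> \<open>The functionals \<open>h i\<close> replace \<open>b _ i\<close>, which is linear
    only on \<open>S\<close>.\<close>
  define N where "N x = (\<Sum>i\<in>I. \<bar>h i x\<bar>)" for x
  have N_add: "N (x + y) \<le> N x + N y" for x y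
    unfolding N_def sum.distrib[symmetric]
    by (rule sum_mono) (simp add: h(1) linear_add abs_triangle_ineq)
  have N_scale: "N (c *\<^sub>R x) = \<bar>c\<bar> * N x" for c x
    by (simp add: N_def sum_distrib_left h(1) linear_scale abs_mult cong: sum.cong)
  have N_far: "e \<le> N (x - x0)" if "x \<in> D" for x
  proof (rule ccontr)
    assume "\<not> e \<le> N (x - x0)"
    have "\<bar>b x i - b x0 i\<bar> < e" if "i \<in> I" for i
    proof -
      have "\<bar>h i (x - x0)\<bar> \<le> N (x - x0)"
        unfolding N_def using I(1) that by (intro member_le_sum) auto
      then show ?thesis
        using \<open>\<not> e \<le> N (x - x0)\<close> h that \<open>x \<in> D\<close> DS x0 by (simp add: linear_diff subset_iff)
    qed
    then show False using I(4) \<open>x \<in> D\<close> DS by blast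
  qed
  show ?thesis
  proof (cases "D = {}")
    case True
    then show ?thesis using zero by (auto intro: zero_less_one)
  next
    case False
    then obtain d0 where d0: "d0 \<in> D" by blast
    \<comment> \<open>A first component \<open>0\<close> means \<open>v = d - x0\<close>, so the
      sign condition on \<open>?A\<close> is exactly \<open>N_far\<close>. Taking
      \<open>v = 0\<close> separates \<open>x0\<close> from \<open>D\<close> by the margin
      \<open>e\<close>; taking large multiples of \<open>v\<close> leaves
      \<open>f v \<le> N v\<close>.\<close>
    let ?A = "{(v - (d - x0), r - e) | v d r. v \<in> S \<and> d \<in> D \<and> N v \<le> r}"
    have "\<exists>f. linear f \<and> (\<forall>(u, r)\<in>?A. f u \<le> r)"
    proof (rule convex_epigraph_linear_minorant_on[OF S])
      show "u \<in> S" if "(u, r) \<in> ?A" for u r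
        using that S DS x0 by (auto intro!: subspace_diff)
      show "convex ?A"
      proof (rule convexI)
        fix p q and s t :: real
        assume "p \<in> ?A" "q \<in> ?A" and st: "0 \<le> s" "0 \<le> t" "s + t = 1"
        then obtain v d r v' d' r' where
          *: "v \<in> S" "d \<in> D" "N v \<le> r" "p = (v - (d - x0), r - e)"
             "v' \<in> S" "d' \<in> D" "N v' \<le> r'" "q = (v' - (d' - x0), r' - e)"
          by auto
        have "N (s *\<^sub>R v + t *\<^sub>R v') \<le> s * r + t * r'"
          using N_add[of "s *\<^sub>R v" "t *\<^sub>R v'"] N_scale[of s v] N_scale[of t v'] st *
            mult_left_mono[of "N v" r s] mult_left_mono[of "N v'" r' t] by simp
        moreover have "s *\<^sub>R p + t *\<^sub>R q =
          ((s *\<^sub>R v + t *\<^sub>R v') - ((s *\<^sub>R d + t *\<^sub>R d') - x0), (s * r + t * r') - e)"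
        proof -
          have "s *\<^sub>R x0 + t *\<^sub>R x0 = x0" "s * e + t * e = e"
            using st by (simp_all flip: scaleR_add_left distrib_right)
          then show ?thesis using * by (simp add: algebra_simps)
        qed
        ultimately show "s *\<^sub>R p + t *\<^sub>R q \<in> ?A"
          using * st S convexD[OF D(2) *(2) *(6) st]
          by (auto intro!: exI subspace_add subspace_scale)
      qed
      show "\<exists>t>0. \<exists>r. (t *\<^sub>R u, r) \<in> ?A" if "u \<in> S" for u
      proof -
        have "u + (d0 - x0) \<in> S"
          using that d0 DS x0 S by (auto intro!: subspace_diff subspace_add)
        then have "(1 *\<^sub>R u, N (u + (d0 - x0)) - e) \<in> ?A"
          using d0 by (intro CollectI exI[of _ "u + (d0 - x0)"] exI[of _ d0]
              exI[of _ "N (u + (d0 - x0))"]) auto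
        then show ?thesis by (intro exI[of _ 1] conjI exI zero_less_one)
      qed
      show "0 \<le> r" if "(0, r) \<in> ?A" for r
        using that N_far by fastforce
    qed
    then obtain f where f1: "linear f" "\<forall>(u, r)\<in>?A. f u \<le> r"
      by (elim exE conjE)
    have "f (v - (d - x0)) \<le> r - e" if "v \<in> S" "d \<in> D" "N v \<le> r" for v d r
    proof -
      have "(v - (d - x0), r - e) \<in> ?A" using that by blast
      from bspec[OF f1(2) this] show ?thesis by simp
    qed
    note f = f1(1) this
    have far: "f x0 + e \<le> f x" if "x \<in> D" for x
      using f(2)[of 0 x 0] that S by (simp add: N_def h(1) linear_0 f(1) linear_diff subspace_0)
    have dom: "f v \<le> N v" if "v \<in> S" for v
    proof (rule le_of_scaled_le)
      fix n
      show "real n * f v \<le> real n * N v + (f (d0 - x0) - e)"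
        using f(2)[of "real n *\<^sub>R v" d0 "real n * N v"] that d0 S f(1)
        by (simp add: N_scale subspace_scale linear_diff linear_scale)
    qed
    have "f v = 0" if "v \<in> S" "\<forall>i\<in>I. b v i = 0" for v
    proof -
      have "N v = 0" using that h by (simp add: N_def)
      then show ?thesis
        using dom[of v] dom[of "- v"] N_scale[of "-1" v] that S f(1)
        by (simp add: subspace_neg linear_neg)
    qed
    then obtain k where "k \<in> G" "\<forall>x\<in>S. f x = b x k"
      using linear_eq_pairing_of_common_zeros[OF I(1) S f(1) lin zero comb I(2)] by blast
    then show ?thesis using far x0 DS I(3) by (metis subsetD)
  qed
qed

text \<open>The concave lower function, the infimum over \<open>H\<close>, enters only through its
  real lower bounds \<open>m\<close>. The value \<open>-\<infinity>\<close> (no \<open>m\<close> at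
  all) and the case of empty \<open>H\<close> (every \<open>m\<close>) then need no separate
  treatment.\<close>

theorem sandwich:
  fixes E :: "('a::real_vector \<times> real) set" and H :: "('a \<Rightarrow> real) set"
  assumes S: "subspace S" and ES: "\<And>u r. (u, r) \<in> E \<Longrightarrow> u \<in> S"
    and cvx: "convex E" and zero: "(0, 0) \<in> E"
    and abs: "\<And>u. u \<in> S \<Longrightarrow> \<exists>t>0. \<exists>r. (t *\<^sub>R u, r) \<in> E"
    and H: "\<And>g. g \<in> H \<Longrightarrow> linear g"
    and le: "\<And>v r m. (v, r) \<in> E \<Longrightarrow> (\<And>g. g \<in> H \<Longrightarrow> m \<le> g v) \<Longrightarrow> m \<le> c + r"
  shows "\<exists>f. linear f \<and> (\<forall>(v, r)\<in>E. f v \<le> c + r) \<and>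
    (\<forall>w\<in>S. \<forall>m. (\<forall>g\<in>H. m \<le> g w) \<longrightarrow> m \<le> f w)"
proof -
  \<comment> \<open>The point \<open>w = 0\<close>, \<open>m = 0\<close> gives the upper inequality.
    The point \<open>v = 0\<close>, \<open>r = 0\<close> gives the lower one up to the constant
    \<open>c\<close>, which disappears by scaling \<open>w\<close> and \<open>m\<close>.\<close>
  let ?A = "{(v - w, r - m + c) | v w r m. (v, r) \<in> E \<and> w \<in> S \<and> (\<forall>g\<in>H. m \<le> g w)}"
  have H0: "\<forall>g\<in>H. 0 \<le> g 0" using H by (simp add: linear_0)
  have "\<exists>f. linear f \<and> (\<forall>(u, r)\<in>?A. f u \<le> r)"
  proof (rule convex_epigraph_linear_minorant_on[OF S])
    show "u \<in> S" if "(u, r) \<in> ?A" for u r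
      using that S ES by (auto intro!: subspace_diff)
    show "convex ?A"
    proof (rule convexI)
      fix p q and s t :: real
      assume "p \<in> ?A" "q \<in> ?A" and st: "0 \<le> s" "0 \<le> t" "s + t = 1"
      then obtain v w r m v' w' r' m' where
        *: "(v, r) \<in> E" "w \<in> S" "\<forall>g\<in>H. m \<le> g w" "p = (v - w, r - m + c)"
           "(v', r') \<in> E" "w' \<in> S" "\<forall>g\<in>H. m' \<le> g w'" "q = (v' - w', r' - m' + c)"
        by auto
      have "(s *\<^sub>R v + t *\<^sub>R v', s * r + t * r') \<in> E"
        using convexD[OF cvx *(1) *(5) st] by simp
      moreover have "\<forall>g\<in>H. s * m + t * m' \<le> g (s *\<^sub>R w + t *\<^sub>R w')"
        using * st H by (auto simp: linear_add linear_scale intro!: add_mono mult_left_mono)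
      moreover have "s *\<^sub>R p + t *\<^sub>R q = ((s *\<^sub>R v + t *\<^sub>R v') - (s *\<^sub>R w + t *\<^sub>R w'),
          (s * r + t * r') - (s * m + t * m') + c)"
      proof -
        have "s * c + t * c = c" using st by (simp flip: distrib_right)
        then show ?thesis using * by (simp add: algebra_simps)
      qed
      ultimately show "s *\<^sub>R p + t *\<^sub>R q \<in> ?A"
        using * S by (auto intro!: exI subspace_add subspace_scale)
    qed
    show "\<exists>t>0. \<exists>r. (t *\<^sub>R u, r) \<in> ?A" if u: "u \<in> S" for u
    proof -
      obtain t r where "0 < t" "(t *\<^sub>R u, r) \<in> E" using abs[OF u] by blast
      then have "(t *\<^sub>R u, r + c) \<in> ?A"
        using H0 subspace_0[OF S] by (intro CollectI exI[of _ "t *\<^sub>R u"] exI[of _ 0] exI[of _ r]) auto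
      then show ?thesis using \<open>0 < t\<close> by blast
    qed
    show "0 \<le> r" if "(0, r) \<in> ?A" for r
      using that le by fastforce
  qed
  then obtain f where f1: "linear f" "\<forall>(u, r)\<in>?A. f u \<le> r"
    by (elim exE conjE)
  have "f (v - w) \<le> r - m + c" if "(v, r) \<in> E" "w \<in> S" "\<forall>g\<in>H. m \<le> g w" for v w r m
  proof -
    have "(v - w, r - m + c) \<in> ?A" using that by blast
    from bspec[OF f1(2) this] show ?thesis by simp
  qed
  note f = f1(1) this
  show ?thesis
  proof (intro exI[of _ f] conjI ballI allI impI)
    show "linear f" by (rule f(1))
    show "case p of (v, r) \<Rightarrow> f v \<le> c + r" if "p \<in> E" for p
      using f(2)[of "fst p" "snd p" 0 0] that subspace_0[OF S] H0 by (simp add: case_prod_beta)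
    show "m \<le> f w" if w: "w \<in> S" "\<forall>g\<in>H. m \<le> g w" for w m
    proof (rule le_of_scaled_le)
      fix n
      have "\<forall>g\<in>H. real n * m \<le> g (real n *\<^sub>R w)"
        using w H by (auto simp: linear_scale intro: mult_left_mono)
      then show "real n * m \<le> real n * f w + c"
        using f(2)[OF zero subspace_scale[OF S w(1)], of "real n * m" "real n"] f(1)
        by (simp add: linear_diff linear_scale linear_neg linear_0)
    qed
  qed
qed

section \<open>Gauge functions and their conjugates\<close>

lemmas alg_dual_rep_eq = zero_alg_dual.rep_eq plus_alg_dual.rep_eq minus_alg_dual.rep_eq
  uminus_alg_dual.rep_eq scaleR_alg_dual.rep_eq

lemmas dual_app_linear = linear_dual_app[THEN linear_add] linear_dual_app[THEN linear_diff]
  linear_dual_app[THEN linear_neg] linear_dual_app[THEN linear_0] linear_dual_app[THEN linear_scale]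

lemma dual_app_Abs: "linear f \<Longrightarrow> dual_app (Abs_alg_dual f) = f"
  by (simp add: Abs_alg_dual_inverse)

lemma linear_dual_app_left: "linear (\<lambda>x. dual_app x u)"
  by (simp add: linear_iff alg_dual_rep_eq)

locale gauge_function =
  fixes F :: "'a::real_vector \<Rightarrow> ereal"
  assumes nonneg: "0 \<le> F u"
    and convex: "0 \<le> t \<Longrightarrow> t \<le> 1 \<Longrightarrow>
      F ((1 - t) *\<^sub>R u + t *\<^sub>R v) \<le> ereal (1 - t) * F u + ereal t * F v"
    and zero: "F 0 = 0"
    and absorbing: "\<exists>\<alpha>>0. F (\<alpha> *\<^sub>R u) < \<infinity>"
begin

abbreviation N :: "'a \<Rightarrow> real"
  where "N \<equiv> gauge_norm F"

lemma convex_comb_le: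
  assumes "F u \<le> ereal a" "F v \<le> ereal b" "0 \<le> s" "0 \<le> t" "s + t = 1"
  shows "F (s *\<^sub>R u + t *\<^sub>R v) \<le> ereal (s * a + t * b)"
proof -
  have s: "1 - t = s" and "t \<le> 1" using assms by simp_all
  have "F (s *\<^sub>R u + t *\<^sub>R v) \<le> ereal s * F u + ereal t * F v"
    using convex[OF assms(4) \<open>t \<le> 1\<close>, of u v] unfolding s .
  also have "\<dots> \<le> ereal s * ereal a + ereal t * ereal b"
    using assms by (intro add_mono ereal_mult_left_mono) auto
  finally show ?thesis by simp
qed

lemma scale_le:
  assumes "F u \<le> ereal a" "0 \<le> t" "t \<le> 1"
  shows "F (t *\<^sub>R u) \<le> ereal (t * a)"
  using convex_comb_le[OF assms(1), of 0 0 t "1 - t"] assms zero by simp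

lemma ex_scale_le_1: "\<exists>t>0. F (t *\<^sub>R u) \<le> 1"
proof -
  obtain \<alpha> where \<alpha>: "0 < \<alpha>" "F (\<alpha> *\<^sub>R u) < \<infinity>" using absorbing by blast
  then obtain a where a: "F (\<alpha> *\<^sub>R u) = ereal a"
    using nonneg[of "\<alpha> *\<^sub>R u"] by (cases "F (\<alpha> *\<^sub>R u)") auto
  then have "0 \<le> a" using nonneg[of "\<alpha> *\<^sub>R u"] by simp
  \<comment> \<open>Convexity along the ray from the origin, where \<open>F\<close> vanishes,
    reduces the bound \<open>a\<close> to \<open>a / (1 + a)\<close>, which is below
    \<open>1\<close>.\<close>
  have "F ((1 / (1 + a)) *\<^sub>R \<alpha> *\<^sub>R u) \<le> ereal ((1 / (1 + a)) * a)"
    using a \<open>0 \<le> a\<close> by (intro scale_le) auto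
  also have "\<dots> \<le> 1" using \<open>0 \<le> a\<close> by (simp add: one_ereal_def)
  finally have "F ((1 / (1 + a) * \<alpha>) *\<^sub>R u) \<le> 1" by simp
  then show ?thesis
    using \<alpha> \<open>0 \<le> a\<close> by (intro exI[of _ "1 / (1 + a) * \<alpha>"]) simp
qed

definition gauge_set :: "'a \<Rightarrow> real set"
  where "gauge_set u = {\<alpha>. 0 < \<alpha> \<and> sym_max F (u /\<^sub>R \<alpha>) \<le> 1}"

lemma gauge_set_iff:
  "\<alpha> \<in> gauge_set u \<longleftrightarrow> 0 < \<alpha> \<and> F (u /\<^sub>R \<alpha>) \<le> 1 \<and> F (- (u /\<^sub>R \<alpha>)) \<le> 1"
  by (simp add: gauge_set_def sym_max_def)

lemma gauge_set_mono:
  assumes "\<alpha> \<in> gauge_set u" "\<alpha> \<le> \<beta>"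
  shows "\<beta> \<in> gauge_set u"
proof -
  have \<alpha>: "0 < \<alpha>" "F (u /\<^sub>R \<alpha>) \<le> ereal 1" "F (- (u /\<^sub>R \<alpha>)) \<le> ereal 1"
    using assms by (auto simp: gauge_set_iff one_ereal_def)
  have eq: "u /\<^sub>R \<beta> = (\<alpha> / \<beta>) *\<^sub>R (u /\<^sub>R \<alpha>)" "- (u /\<^sub>R \<beta>) = (\<alpha> / \<beta>) *\<^sub>R (- (u /\<^sub>R \<alpha>))"
    using \<alpha>(1) assms(2) by (simp_all add: field_simps)
  have "F ((\<alpha> / \<beta>) *\<^sub>R (u /\<^sub>R \<alpha>)) \<le> ereal (\<alpha> / \<beta> * 1)"
      "F ((\<alpha> / \<beta>) *\<^sub>R (- (u /\<^sub>R \<alpha>))) \<le> ereal (\<alpha> / \<beta> * 1)"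
    using \<alpha> assms(2) by (intro scale_le; simp)+
  then have "F (u /\<^sub>R \<beta>) \<le> ereal (\<alpha> / \<beta> * 1)" "F (- (u /\<^sub>R \<beta>)) \<le> ereal (\<alpha> / \<beta> * 1)"
    unfolding eq[symmetric] .
  moreover have "ereal (\<alpha> / \<beta> * 1) \<le> 1" using \<alpha>(1) assms(2) by (simp add: one_ereal_def)
  ultimately show ?thesis
    using \<alpha>(1) assms(2) unfolding gauge_set_iff by (meson less_le_trans order_trans)
qed

lemma gauge_set_nonempty: "gauge_set u \<noteq> {}"
proof -
  obtain t t' where t: "0 < t" "F (t *\<^sub>R u) \<le> ereal 1" "0 < t'" "F (t' *\<^sub>R (- u)) \<le> ereal 1"
    using ex_scale_le_1[of u] ex_scale_le_1[of "- u"] by (auto simp: one_ereal_def)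
  define s where "s = min t t'"
  have s: "0 < s" "s \<le> t" "s \<le> t'" using t by (auto simp: s_def)
  have "F ((s / t) *\<^sub>R t *\<^sub>R u) \<le> ereal (s / t * 1)" "F ((s / t') *\<^sub>R t' *\<^sub>R (- u)) \<le> ereal (s / t' * 1)"
    using t s by (intro scale_le; simp)+
  moreover have "ereal (s / t * 1) \<le> 1" "ereal (s / t' * 1) \<le> 1"
    using t s by (auto simp: one_ereal_def)
  ultimately have "F (s *\<^sub>R u) \<le> 1" "F (- (s *\<^sub>R u)) \<le> 1"
    using t by (auto intro: order_trans)
  then have "1 / s \<in> gauge_set u"
    using s by (simp add: gauge_set_iff divide_inverse)
  then show ?thesis by blast
qed

lemma N_eq_Inf: "N u = Inf (gauge_set u)"
  by (simp add: gauge_norm_def gauge_set_def)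

lemma N_le: "\<alpha> \<in> gauge_set u \<Longrightarrow> N u \<le> \<alpha>"
  unfolding N_eq_Inf by (intro cInf_lower bdd_belowI[of _ 0]) (auto simp: gauge_set_iff)

lemma N_nonneg: "0 \<le> N u"
  unfolding N_eq_Inf by (intro cInf_greatest gauge_set_nonempty) (auto simp: gauge_set_iff)

text \<open>\<open>gauge_set u\<close> is closed upwards, so everything strictly above its infimum
  belongs to it. \<open>F\<close> is not assumed lower semicontinuous, so the infimum itself may be
  missing; this is why the norm estimates carry an \<open>e\<close>.\<close>

lemma N_less: "N u < \<beta> \<Longrightarrow> \<beta> \<in> gauge_set u"
  using cInf_lessD[OF gauge_set_nonempty, of u \<beta>] gauge_set_mono unfolding N_eq_Inf
  by (meson less_imp_le)

lemma N_minus: "N (- u) = N u"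
  by (simp add: N_eq_Inf gauge_set_def sym_max_def max.commute)

lemma N_zero: "N 0 = 0"
proof (rule antisym)
  show "N 0 \<le> 0"
    by (rule field_le_epsilon) (simp add: N_le gauge_set_iff zero)
qed (rule N_nonneg)

lemma N_scale_pos_le:
  assumes "0 < c"
  shows "N (c *\<^sub>R u) \<le> c * N u"
proof (rule field_le_epsilon)
  fix e :: real assume "0 < e"
  then have "N u + e / c \<in> gauge_set u"
    using assms by (intro N_less) simp
  moreover have "(c *\<^sub>R u) /\<^sub>R (c * \<alpha>) = u /\<^sub>R \<alpha>" for \<alpha>
    using assms by (simp add: field_simps)
  ultimately have "c * (N u + e / c) \<in> gauge_set (c *\<^sub>R u)"
    using assms by (simp only: gauge_set_iff mult_pos_pos simp_thms)
  from N_le[OF this] show "N (c *\<^sub>R u) \<le> c * N u + e"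
    using assms by (simp add: algebra_simps)
qed

lemma N_scale: "N (c *\<^sub>R u) = \<bar>c\<bar> * N u"
proof -
  have pos: "N (c *\<^sub>R u) = c * N u" if "0 < c" for c
    using N_scale_pos_le[OF that, of u] N_scale_pos_le[of "1 / c" "c *\<^sub>R u"] that
    by (simp add: field_simps)
  consider "c = 0" | "0 < c" | "0 < - c" by linarith
  then show ?thesis
  proof cases
    case 3
    then show ?thesis using pos[of "- c"] N_minus[of "c *\<^sub>R u"] by simp
  qed (auto simp: N_zero pos)
qed

lemma N_triangle: "N (u + v) \<le> N u + N v"
proof (rule field_le_epsilon)
  fix e :: real assume "0 < e"
  define \<alpha> \<beta> where "\<alpha> = N u + e / 2" and "\<beta> = N v + e / 2"
  have "\<alpha> \<in> gauge_set u" "\<beta> \<in> gauge_set v"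
    using \<open>0 < e\<close> by (auto simp: \<alpha>_def \<beta>_def intro!: N_less)
  then have *: "0 < \<alpha>" "0 < \<beta>" "F (u /\<^sub>R \<alpha>) \<le> ereal 1" "F (- (u /\<^sub>R \<alpha>)) \<le> ereal 1"
      "F (v /\<^sub>R \<beta>) \<le> ereal 1" "F (- (v /\<^sub>R \<beta>)) \<le> ereal 1"
    by (auto simp: gauge_set_iff one_ereal_def)
  \<comment> \<open>Weights proportional to the radii make
    \<open>(u + v) /\<^sub>R (\<alpha> + \<beta>)\<close> a convex combination of the two normalized
    vectors.\<close>
  define s t where "s = \<alpha> / (\<alpha> + \<beta>)" and "t = \<beta> / (\<alpha> + \<beta>)"
  have st: "0 \<le> s" "0 \<le> t" "s + t = 1"
    using * by (auto simp: s_def t_def simp flip: add_divide_distrib)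
  have "s * inverse \<alpha> = inverse (\<alpha> + \<beta>)" "t * inverse \<beta> = inverse (\<alpha> + \<beta>)"
    using * by (simp_all add: s_def t_def divide_simps)
  then have eq: "(u + v) /\<^sub>R (\<alpha> + \<beta>) = s *\<^sub>R (u /\<^sub>R \<alpha>) + t *\<^sub>R (v /\<^sub>R \<beta>)"
      "- ((u + v) /\<^sub>R (\<alpha> + \<beta>)) = s *\<^sub>R (- (u /\<^sub>R \<alpha>)) + t *\<^sub>R (- (v /\<^sub>R \<beta>))"
    by (simp_all add: scaleR_add_right)
  have "F ((u + v) /\<^sub>R (\<alpha> + \<beta>)) \<le> ereal (s * 1 + t * 1)"
      "F (- ((u + v) /\<^sub>R (\<alpha> + \<beta>))) \<le> ereal (s * 1 + t * 1)"
    unfolding eq(1) eq(2)[unfolded eq(1)] by (intro convex_comb_le * st)+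
  then have "\<alpha> + \<beta> \<in> gauge_set (u + v)"
    using * st by (simp add: gauge_set_iff one_ereal_def)
  from N_le[OF this] show "N (u + v) \<le> N u + N v + e"
    by (simp add: \<alpha>_def \<beta>_def)
qed

text \<open>Trades the extended-real supremum for real inequalities over the epigraph of
  \<open>F\<close>, the form that linear minorants of epigraphs deliver.\<close>

lemma conj_le_iff:
  "Phi_conj F x \<le> ereal c \<longleftrightarrow> (\<forall>v r. F v \<le> ereal r \<longrightarrow> dual_app x v \<le> c + r)"
proof -
  have "ereal (dual_app x v) - F v \<le> ereal c \<longleftrightarrow> (\<forall>r. F v \<le> ereal r \<longrightarrow> dual_app x v \<le> c + r)" for v
  proof (cases "F v")
    case (real r)
    then show ?thesis by (auto simp: algebra_simps)
  next
    case MInf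
    then show ?thesis using nonneg[of v] by simp
  qed simp
  then show ?thesis
    by (simp add: Phi_conj_def SUP_le_iff)
qed

lemma conj_nonneg: "0 \<le> Phi_conj F x"
  unfolding Phi_conj_def
  by (rule SUP_upper2[of 0]) (simp_all add: zero dual_app_linear flip: zero_ereal_def)

lemma conj_real: "Phi_conj F x < \<infinity> \<Longrightarrow> \<exists>c\<ge>0. Phi_conj F x = ereal c"
  using conj_nonneg[of x] by (cases "Phi_conj F x") auto

text \<open>If \<open>N v < 1\<close> then \<open>F v \<le> 1\<close>, so \<open>x\<close> is at
  most \<open>q + 1\<close> there; this is the origin of the constant, and homogeneity does the
  rest.\<close>

lemma conj_bound:
  assumes "Phi_conj F x \<le> ereal q"
  shows "\<bar>dual_app x v\<bar> \<le> (q + 1) * N v"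
proof -
  have "0 \<le> ereal q" using order_trans[OF conj_nonneg assms] .
  then have "0 \<le> q" by simp
  have le: "dual_app x v \<le> (q + 1) * \<beta>" if "\<beta> \<in> gauge_set v" for v \<beta>
  proof -
    have "dual_app x (v /\<^sub>R \<beta>) \<le> q + 1"
      using assms that by (auto simp: conj_le_iff gauge_set_iff one_ereal_def)
    then show ?thesis
      using that by (simp add: dual_app_linear gauge_set_iff field_simps)
  qed
  have "dual_app x v \<le> (q + 1) * N v" for v
  proof (rule field_le_epsilon)
    fix e :: real assume "0 < e"
    then have "N v + e / (q + 1) \<in> gauge_set v"
      using \<open>0 \<le> q\<close> by (intro N_less) simp
    from le[OF this] show "dual_app x v \<le> (q + 1) * N v + e"
      unfolding distrib_left[of "q + 1"] using \<open>0 \<le> q\<close> by simp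
  qed
  from this[of v] this[of "- v"] show ?thesis
    by (simp add: N_minus dual_app_linear)
qed

lemma conj_finite_top_dual: "Phi_conj F x < \<infinity> \<Longrightarrow> x \<in> top_dual N"
  using conj_real[of x] conj_bound[of x] unfolding top_dual_def by fastforce

lemma top_dual_bound:
  assumes "x \<in> top_dual N"
  obtains K where "0 < K" "\<And>u. \<bar>dual_app x u\<bar> \<le> K * N u"
proof -
  obtain K where K: "\<And>u. \<bar>dual_app x u\<bar> \<le> K * N u"
    using assms by (auto simp: top_dual_def)
  have "K * N u \<le> (\<bar>K\<bar> + 1) * N u" for u
    by (intro mult_right_mono N_nonneg) simp
  then show thesis
    using K by (intro that[of "\<bar>K\<bar> + 1"]) (auto intro: order_trans)
qed

lemma subspace_top_dual: "subspace (top_dual N)"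
proof (rule subspaceI)
  show "0 \<in> top_dual N"
    by (auto simp: top_dual_def alg_dual_rep_eq intro!: exI[of _ 0])
  fix x y and c :: real
  assume x: "x \<in> top_dual N"
  then obtain K where K: "0 < K" "\<And>u. \<bar>dual_app x u\<bar> \<le> K * N u"
    using top_dual_bound by blast
  have "\<bar>dual_app (c *\<^sub>R x) u\<bar> \<le> (\<bar>c\<bar> * K) * N u" for u
    using mult_left_mono[OF K(2)[of u], of "\<bar>c\<bar>"] by (simp add: alg_dual_rep_eq abs_mult mult.assoc)
  then show "c *\<^sub>R x \<in> top_dual N"
    unfolding top_dual_def by blast
  assume "y \<in> top_dual N"
  then obtain K' where K': "0 < K'" "\<And>u. \<bar>dual_app y u\<bar> \<le> K' * N u"
    using top_dual_bound by blast
  have "\<bar>dual_app (x + y) u\<bar> \<le> (K + K') * N u" for u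
    using K(2)[of u] K'(2)[of u] by (simp add: alg_dual_rep_eq distrib_right)
  then show "x + y \<in> top_dual N"
    unfolding top_dual_def by blast
qed

section \<open>The completion and its pairing with the dual\<close>

abbreviation cls :: "(nat \<Rightarrow> 'a) \<Rightarrow> (nat \<Rightarrow> 'a) set"
  where "cls s \<equiv> null_diff N `` {s}"

lemma cls_in_completion: "Cauchy_wrt N s \<Longrightarrow> cls s \<in> completion N"
  by (auto simp: completion_def quotient_def)

lemma completionE:
  assumes "\<xi> \<in> completion N"
  obtains s where "Cauchy_wrt N s" "\<xi> = cls s"
  using assms by (auto simp: completion_def quotient_def)

lemma Cauchy_wrt_const: "Cauchy_wrt N (\<lambda>_. u)"
  by (simp add: Cauchy_wrt_def N_zero)

lemma Cauchy_wrt_comb: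
  assumes s: "Cauchy_wrt N s" and t: "Cauchy_wrt N t"
  shows "Cauchy_wrt N (\<lambda>n. c *\<^sub>R s n + t n)"
  unfolding Cauchy_wrt_def
proof (intro allI impI)
  fix e :: real assume "0 < e"
  \<comment> \<open>The added \<open>1\<close> makes \<open>k\<close> positive also for
    \<open>c = 0\<close>.\<close>
  define k where "k = \<bar>c\<bar> + 1"
  define d where "d = e / 2 / k"
  have "0 < k" by (simp add: k_def)
  then have "0 < d" using \<open>0 < e\<close> by (simp add: d_def)
  obtain M where M: "\<And>m n. M \<le> m \<Longrightarrow> M \<le> n \<Longrightarrow> N (s m - s n) < d"
    using s \<open>0 < d\<close> unfolding Cauchy_wrt_def by blast
  obtain M' where M': "\<And>m n. M' \<le> m \<Longrightarrow> M' \<le> n \<Longrightarrow> N (t m - t n) < e / 2"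
    using t half_gt_zero[OF \<open>0 < e\<close>] unfolding Cauchy_wrt_def by blast
  have "N ((c *\<^sub>R s m + t m) - (c *\<^sub>R s n + t n)) < e" if "max M M' \<le> m" "max M M' \<le> n" for m n
  proof -
    have "N ((c *\<^sub>R s m + t m) - (c *\<^sub>R s n + t n)) = N (c *\<^sub>R (s m - s n) + (t m - t n))"
      by (simp add: algebra_simps)
    also have "\<dots> \<le> \<bar>c\<bar> * N (s m - s n) + N (t m - t n)"
      using N_triangle[of "c *\<^sub>R (s m - s n)" "t m - t n"] by (simp only: N_scale)
    also have "\<bar>c\<bar> * N (s m - s n) \<le> k * d"
      using M[of m n] that N_nonneg[of "s m - s n"] by (intro mult_mono) (auto simp: k_def)
    also have "k * d = e / 2" using \<open>0 < k\<close> by (simp add: d_def)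
    also have "N (t m - t n) < e / 2" using M' that by simp
    finally show ?thesis by simp
  qed
  then show "\<exists>M. \<forall>m\<ge>M. \<forall>n\<ge>M. N ((c *\<^sub>R s m + t m) - (c *\<^sub>R s n + t n)) < e"
    by blast
qed

text \<open>For a fixed late \<open>m\<close> the sequence \<open>s n - s m\<close> represents the
  difference between the limit class and \<open>s m\<close>, so this says that the constants
  approximate the class.\<close>

lemma Cauchy_wrt_tail:
  assumes "Cauchy_wrt N s" "0 < e"
  shows "\<forall>\<^sub>F m in sequentially. \<forall>\<^sub>F n in sequentially. N (s n - s m) \<le> e"
proof -
  obtain M where "\<And>m n. M \<le> m \<Longrightarrow> M \<le> n \<Longrightarrow> N (s m - s n) < e"
    using assms unfolding Cauchy_wrt_def by blast
  then show ?thesis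
    unfolding eventually_sequentially by (meson less_imp_le)
qed

lemma Cauchy_wrt_bounded:
  assumes "Cauchy_wrt N s"
  obtains B where "0 < B" "\<forall>\<^sub>F n in sequentially. N (s n) \<le> B"
proof -
  obtain m where m: "\<forall>\<^sub>F n in sequentially. N (s n - s m) \<le> 1"
    using Cauchy_wrt_tail[OF assms zero_less_one] eventually_happens'[OF sequentially_bot] by blast
  have "\<forall>\<^sub>F n in sequentially. N (s n) \<le> 1 + N (s m)"
    using m
  proof eventually_elim
    case (elim n)
    then show ?case using N_triangle[of "s n - s m" "s m"] by simp
  qed
  then show thesis using N_nonneg[of "s m"] by (intro that[of "1 + N (s m)"]) auto
qed

text \<open>Shows that the definite description in \<open>compl_app\<close> denotes: boundedness
  makes the values along \<open>s\<close> a real Cauchy sequence, and equivalent sequences have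
  values differing by a null sequence.\<close>

lemma compl_app_tendsto:
  assumes x: "x \<in> top_dual N" and s: "Cauchy_wrt N s"
  shows "(\<lambda>n. dual_app x (s n)) \<longlonglongrightarrow> compl_app x (cls s)"
proof -
  obtain K where K: "0 < K" "\<And>u. \<bar>dual_app x u\<bar> \<le> K * N u"
    using top_dual_bound[OF x] by blast
  have "Cauchy (\<lambda>n. dual_app x (s n))"
    unfolding Cauchy_def
  proof (intro allI impI)
    fix e :: real assume "0 < e"
    then obtain M where M: "\<And>m n. M \<le> m \<Longrightarrow> M \<le> n \<Longrightarrow> N (s m - s n) < e / K"
      using s K(1) unfolding Cauchy_wrt_def by (meson divide_pos_pos)
    have "dist (dual_app x (s m)) (dual_app x (s n)) < e" if "M \<le> m" "M \<le> n" for m n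
    proof -
      have "dist (dual_app x (s m)) (dual_app x (s n)) \<le> K * N (s m - s n)"
        using K(2)[of "s m - s n"] by (simp add: dist_real_def dual_app_linear)
      also have "\<dots> < e" using M[OF that] K(1) by (simp add: field_simps)
      finally show ?thesis .
    qed
    then show "\<exists>M. \<forall>m\<ge>M. \<forall>n\<ge>M. dist (dual_app x (s m)) (dual_app x (s n)) < e" by blast
  qed
  then obtain c where c: "(\<lambda>n. dual_app x (s n)) \<longlonglongrightarrow> c"
    using Cauchy_convergent convergent_def by blast
  have all: "(\<lambda>n. dual_app x (t n)) \<longlonglongrightarrow> c" if "t \<in> cls s" for t
  proof -
    have "(\<lambda>n. K * N (s n - t n)) \<longlonglongrightarrow> 0"
      using that tendsto_mult_right_zero[of "\<lambda>n. N (s n - t n)" sequentially K]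
      by (auto simp: null_diff_def)
    then have "(\<lambda>n. dual_app x (s n - t n)) \<longlonglongrightarrow> 0"
      by (rule Lim_null_comparison[rotated]) (use K(2) in auto)
    from tendsto_diff[OF c this] show ?thesis by (simp add: dual_app_linear)
  qed
  moreover have "s \<in> cls s"
    using s by (simp add: null_diff_def N_zero)
  ultimately have "compl_app x (cls s) = c"
    unfolding compl_app_def using c LIMSEQ_unique by (intro the_equality) blast+
  with c show ?thesis by simp
qed

lemma compl_app_eqI:
  "x \<in> top_dual N \<Longrightarrow> Cauchy_wrt N s \<Longrightarrow> (\<lambda>n. dual_app x (s n)) \<longlonglongrightarrow> c \<Longrightarrow>
    compl_app x (cls s) = c"
  using compl_app_tendsto LIMSEQ_unique by blast

lemma compl_app_const: "x \<in> top_dual N \<Longrightarrow> compl_app x (cls (\<lambda>_. u)) = dual_app x u"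
  by (rule compl_app_eqI[OF _ Cauchy_wrt_const]) auto

lemma compl_app_comb_right:
  assumes "x \<in> top_dual N" "Cauchy_wrt N s" "Cauchy_wrt N t"
  shows "compl_app x (cls (\<lambda>n. c *\<^sub>R s n + t n)) = c * compl_app x (cls s) + compl_app x (cls t)"
  by (rule compl_app_eqI[OF assms(1) Cauchy_wrt_comb[OF assms(2,3)]])
    (auto simp: dual_app_linear intro!: tendsto_intros compl_app_tendsto assms)

lemma compl_app_add_left:
  assumes "x \<in> top_dual N" "y \<in> top_dual N" "\<xi> \<in> completion N"
  shows "compl_app (x + y) \<xi> = compl_app x \<xi> + compl_app y \<xi>"
proof -
  obtain s where s: "Cauchy_wrt N s" "\<xi> = cls s" using assms(3) by (rule completionE)
  show ?thesis
    unfolding s(2)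
    by (rule compl_app_eqI[OF subspace_add[OF subspace_top_dual assms(1,2)] s(1)])
      (auto simp: alg_dual_rep_eq intro!: tendsto_intros compl_app_tendsto assms s)
qed

lemma compl_app_scale_left:
  assumes "x \<in> top_dual N" "\<xi> \<in> completion N"
  shows "compl_app (c *\<^sub>R x) \<xi> = c * compl_app x \<xi>"
proof -
  obtain s where s: "Cauchy_wrt N s" "\<xi> = cls s" using assms(2) by (rule completionE)
  show ?thesis
    unfolding s(2)
    by (rule compl_app_eqI[OF subspace_scale[OF subspace_top_dual assms(1)] s(1)])
      (auto simp: alg_dual_rep_eq intro!: tendsto_intros compl_app_tendsto assms s)
qed

text \<open>An eventual bound on \<open>N (s n)\<close> stands in for a norm on the completion,
  which is never introduced.\<close>

lemma compl_app_bound: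
  assumes x: "Phi_conj F x \<le> ereal q" and s: "Cauchy_wrt N s"
    and e: "\<forall>\<^sub>F n in sequentially. N (s n) \<le> e"
  shows "\<bar>compl_app x (cls s)\<bar> \<le> (q + 1) * e"
proof (rule tendsto_upperbound)
  have "x \<in> top_dual N" by (rule conj_finite_top_dual[OF le_less_trans[OF x]]) simp
  then show "(\<lambda>n. \<bar>dual_app x (s n)\<bar>) \<longlonglongrightarrow> \<bar>compl_app x (cls s)\<bar>"
    by (intro tendsto_intros compl_app_tendsto s)
  have "0 \<le> ereal q" using order_trans[OF conj_nonneg x] .
  then show "\<forall>\<^sub>F n in sequentially. \<bar>dual_app x (s n)\<bar> \<le> (q + 1) * e"
    using e by (auto elim!: eventually_mono intro: order_trans[OF conj_bound[OF x]] mult_left_mono)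
qed simp

text \<open>Pairing with a class is linear on \<open>top_dual N\<close> only; the projection extends
  it to all functionals. The extension depends on the projection, its values on
  \<open>top_dual N\<close> do not.\<close>

lemma compl_app_extension:
  assumes "\<xi> \<in> completion N"
  obtains \<omega> where "\<And>x. x \<in> top_dual N \<Longrightarrow> dual_app \<omega> x = compl_app x \<xi>"
proof -
  obtain P where P: "linear P" "range P \<subseteq> top_dual N" "\<And>x. x \<in> top_dual N \<Longrightarrow> P x = x"
    using linear_projection_exists[OF subspace_top_dual] by blast
  have "linear (\<lambda>x. compl_app (P x) \<xi>)"
  proof (rule linearI)
    have mem: "P x \<in> top_dual N" for x using P(2) by blast
    show "compl_app (P (x + y)) \<xi> = compl_app (P x) \<xi> + compl_app (P y) \<xi>" for x y
      unfolding linear_add[OF P(1)] by (rule compl_app_add_left[OF mem mem assms])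
    show "compl_app (P (c *\<^sub>R x)) \<xi> = c *\<^sub>R compl_app (P x) \<xi>" for c x
      unfolding linear_scale[OF P(1)] by (simp add: compl_app_scale_left[OF mem assms])
  qed
  then show thesis
    by (intro that[of "Abs_alg_dual (\<lambda>x. compl_app (P x) \<xi>)"]) (simp add: dual_app_Abs P(3))
qed

end

section \<open>Strong duality\<close>

context gauge_function
begin

text \<open>If \<open>L\<close> is the value at the class of \<open>s\<close> of a functional
  bounded by \<open>k\<close> times the norm, and \<open>a m\<close> its value at the constant
  \<open>s m\<close>, then \<open>L - a m\<close> is its value at the class of
  \<open>s n - s m\<close>. Such a functional is thus determined by its values on constants.\<close>

lemma tendsto_of_tail_bound:
  fixes a :: "nat \<Rightarrow> real"
  assumes s: "Cauchy_wrt N s" and k: "0 < k"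
    and bound: "\<And>m e. 0 < e \<Longrightarrow> \<forall>\<^sub>F n in sequentially. N (s n - s m) \<le> e \<Longrightarrow> \<bar>L - a m\<bar> \<le> k * e"
  shows "a \<longlonglongrightarrow> L"
proof (rule tendstoI)
  fix e :: real assume "0 < e"
  define d where "d = e / 2 / k"
  have "0 < d" using \<open>0 < e\<close> k by (simp add: d_def)
  show "\<forall>\<^sub>F m in sequentially. dist (a m) L < e"
    using Cauchy_wrt_tail[OF s \<open>0 < d\<close>]
  proof eventually_elim
    case (elim m)
    have "k * d < e" using \<open>0 < e\<close> k by (simp add: d_def)
    then show ?case
      using bound[OF \<open>0 < d\<close> elim] by (simp add: dist_real_def abs_minus_commute)
  qed
qed

lemma convex_epigraph: "convex {(v, r). F v \<le> ereal r}"
  by (rule convexI) (auto intro: convex_comb_le)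

theorem strong_duality:
  assumes D: "closedin sigma_X_Y D" "convex D"
    and le: "\<And>y m r. F y \<le> ereal r \<Longrightarrow> (\<And>x. x \<in> D \<Longrightarrow> m \<le> dual_app x y) \<Longrightarrow> m \<le> c + r"
  shows "\<exists>x\<in>D. Phi_conj F x \<le> ereal c"
proof -
  let ?E = "{(v, r). F v \<le> ereal r}"
  have "\<exists>f. linear f \<and> (\<forall>(v, r)\<in>?E. f v \<le> c + r) \<and>
      (\<forall>w\<in>UNIV. \<forall>m. (\<forall>g\<in>dual_app ` D. m \<le> g w) \<longrightarrow> m \<le> f w)"
  proof (rule sandwich[of UNIV ?E "dual_app ` D" c])
    show "\<exists>t>0. \<exists>r. (t *\<^sub>R u, r) \<in> ?E" for u
      using ex_scale_le_1[of u] by (auto simp: one_ereal_def)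
    show "m \<le> c + r" if "(v, r) \<in> ?E" "\<And>g. g \<in> dual_app ` D \<Longrightarrow> m \<le> g v" for v r m
      using le[of v r m] that by auto
  qed (auto simp: convex_epigraph linear_dual_app zero)
  then obtain f where f: "linear f" "\<forall>(v, r)\<in>?E. f v \<le> c + r"
      "\<forall>w\<in>UNIV. \<forall>m. (\<forall>g\<in>dual_app ` D. m \<le> g w) \<longrightarrow> m \<le> f w"
    by (elim exE conjE)
  define x where "x = Abs_alg_dual f"
  have x: "dual_app x = f" by (simp add: x_def dual_app_Abs f(1))
  have "x \<in> D"
  proof (rule ccontr)
    assume "x \<notin> D"
    have "\<exists>k\<in>UNIV. \<exists>e>0. \<forall>d\<in>D. dual_app x k + e \<le> dual_app d k"
    proof (rule weak_topology_separation[where S = UNIV])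
      show "\<exists>h. linear h \<and> (\<forall>x\<in>UNIV. h x = dual_app x g)" for g :: 'a
        using linear_dual_app_left by blast
      show "\<exists>k\<in>UNIV. \<forall>x\<in>UNIV. dual_app x (k::'a) = 0"
        by (intro bexI[of _ 0]) (auto simp: dual_app_linear)
      show "\<exists>k\<in>UNIV. \<forall>x\<in>UNIV. dual_app x k = dual_app x g + a * dual_app x h" for g h :: 'a and a
        by (intro bexI[of _ "g + a *\<^sub>R h"]) (auto simp: dual_app_linear)
    qed (use D \<open>x \<notin> D\<close> in \<open>auto simp: sigma_X_Y_def\<close>)
    then obtain k e where "0 < e" "\<forall>d\<in>D. f k + e \<le> dual_app d k"
      by (auto simp: x)
    \<comment> \<open>\<open>f k + e\<close> is a lower bound for the pairings of \<open>D\<close>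
      with \<open>k\<close>, and the lower half of the sandwich puts such bounds below
      \<open>f k\<close>.\<close>
    then have "f k + e \<le> f k" by (intro f(3)[rule_format]) auto
    with \<open>0 < e\<close> show False by simp
  qed
  moreover have "Phi_conj F x \<le> ereal c"
    using f(2) by (simp add: conj_le_iff x)
  ultimately show ?thesis by blast
qed

lemma completion_separation:
  assumes D: "closedin (weak_topology (top_dual N) (completion N) compl_app) D" "convex D"
    and x: "x \<in> top_dual N" "x \<notin> D"
  shows "\<exists>\<xi>\<in>completion N. \<exists>e>0. \<forall>d\<in>D. compl_app x \<xi> + e \<le> compl_app d \<xi>"
proof (rule weak_topology_separation[OF subspace_top_dual _ _ _ D x])
  show "\<exists>h. linear h \<and> (\<forall>x\<in>top_dual N. h x = compl_app x \<xi>)" if "\<xi> \<in> completion N" for \<xi>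
    using compl_app_extension[OF that] linear_dual_app by metis
  show "\<exists>k\<in>completion N. \<forall>x\<in>top_dual N. compl_app x k = 0"
    by (rule bexI[OF _ cls_in_completion[OF Cauchy_wrt_const[of 0]]])
      (simp add: compl_app_const dual_app_linear)
  show "\<exists>k\<in>completion N. \<forall>x\<in>top_dual N. compl_app x k = compl_app x \<xi> + c * compl_app x \<eta>"
    if \<xi>: "\<xi> \<in> completion N" and \<eta>: "\<eta> \<in> completion N" for \<xi> \<eta> c
  proof -
    obtain s t where "Cauchy_wrt N s" "\<xi> = cls s" "Cauchy_wrt N t" "\<eta> = cls t"
      using completionE[OF \<xi>] completionE[OF \<eta>] by metis
    then show ?thesis
      by (intro bexI[OF _ cls_in_completion[OF Cauchy_wrt_comb[of t s c]]])
        (simp_all add: compl_app_comb_right)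
  qed
qed

text \<open>The completion is represented in the algebraic bidual by \<open>W\<close>.  On \<open>W\<close> the function
  \<open>sup x. \<omega> x - Phi_conj F x\<close> is at most \<open>1\<close> on the unit ball, so that the functional
  given by the sandwich theorem is continuous and hence is the extension of some \<open>x\<close>.\<close>

theorem strong_duality_completion:
  assumes D: "closedin (weak_topology (top_dual N) (completion N) compl_app) D" "convex D"
    and le: "\<And>\<xi> m r. \<xi> \<in> completion N \<Longrightarrow>
      (\<And>x q. Phi_conj F x \<le> ereal q \<Longrightarrow> compl_app x \<xi> \<le> r + q) \<Longrightarrow>
      (\<And>x. x \<in> D \<Longrightarrow> m \<le> compl_app x \<xi>) \<Longrightarrow> m \<le> c + r"
  shows "\<exists>x\<in>D. Phi_conj F x \<le> ereal c"
proof -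
  \<comment> \<open>Only the values on \<open>top_dual N\<close> are prescribed, so that
    \<open>W\<close> is a subspace without any choice of extensions; \<open>f_eq\<close> below shows
    that \<open>f\<close> depends on the class alone.\<close>
  define W where "W = {\<omega>. \<exists>s. Cauchy_wrt N s \<and> (\<forall>x\<in>top_dual N. dual_app \<omega> x = compl_app x (cls s))}"
  \<comment> \<open>The epigraph of the biconjugate \<open>Phi1\<close> carried over to
    \<open>W\<close>, with real bounds \<open>q\<close> in place of the conjugate values.\<close>
  define E where "E = {(\<omega>, r). \<omega> \<in> W \<and> (\<forall>x q. Phi_conj F x \<le> ereal q \<longrightarrow> dual_app \<omega> x \<le> r + q)}"
  have DX: "D \<subseteq> top_dual N" using closedin_subset[OF D(1)] by simp
  have fin: "x \<in> top_dual N" if "Phi_conj F x \<le> ereal q" for x q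
    by (rule conj_finite_top_dual[OF le_less_trans[OF that]]) simp
  have conj_q: "0 \<le> q" if "Phi_conj F x \<le> ereal q" for x q
    using order_trans[OF conj_nonneg that] by simp
  have W_comb: "a *\<^sub>R \<omega> + \<omega>' \<in> W" if \<omega>: "\<omega> \<in> W" and \<omega>': "\<omega>' \<in> W" for a \<omega> \<omega>'
  proof -
    obtain s where s: "Cauchy_wrt N s" "\<And>x. x \<in> top_dual N \<Longrightarrow> dual_app \<omega> x = compl_app x (cls s)"
      using \<omega> by (auto simp: W_def)
    obtain t where t: "Cauchy_wrt N t" "\<And>x. x \<in> top_dual N \<Longrightarrow> dual_app \<omega>' x = compl_app x (cls t)"
      using \<omega>' by (auto simp: W_def)
    show ?thesis
      unfolding W_def
      by (intro CollectI exI[of _ "\<lambda>n. a *\<^sub>R s n + t n"] conjI Cauchy_wrt_comb s(1) t(1) ballI)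
        (simp add: alg_dual_rep_eq s t compl_app_comb_right)
  qed
  have const_W: "bidual_embed v \<in> W" for v
    unfolding W_def
    by (auto simp: bidual_embed.rep_eq compl_app_const Cauchy_wrt_const intro!: exI[of _ "\<lambda>_. v"])
  have W0: "0 \<in> W"
    using const_W[of 0] by (simp add: bidual_embed_def map_fun_def dual_app_linear
        flip: zero_alg_dual_def)
  have S: "subspace W"
    using W_comb[OF _ W0] W_comb[of _ _ 1] by (intro subspaceI W0) auto
  \<comment> \<open>After division by a tail bound \<open>e\<close> of the norms, the estimate
    \<open>(q + 1) * e\<close> becomes \<open>1 + q\<close>, which is level \<open>1\<close> in
    \<open>E\<close>. This makes \<open>E\<close> absorbing and, later, \<open>f\<close>
    continuous.\<close>
  have E_unit: "((1 / e) *\<^sub>R \<omega>, 1) \<in> E"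
    if \<omega>: "\<omega> \<in> W" and s: "Cauchy_wrt N s" "\<And>x. x \<in> top_dual N \<Longrightarrow> dual_app \<omega> x = compl_app x (cls s)"
      and e: "0 < e" "\<forall>\<^sub>F n in sequentially. N (s n) \<le> e" for \<omega> s e
    unfolding E_def
  proof (intro CollectI case_prodI conjI allI impI)
    show "(1 / e) *\<^sub>R \<omega> \<in> W" by (rule subspace_scale[OF S \<omega>])
    fix x q assume x: "Phi_conj F x \<le> ereal q"
    have "dual_app \<omega> x \<le> (q + 1) * e"
      using compl_app_bound[OF x s(1) e(2)] s(2)[OF fin[OF x]] by simp
    then show "dual_app ((1 / e) *\<^sub>R \<omega>) x \<le> 1 + q"
      using e(1) by (simp add: alg_dual_rep_eq field_simps)
  qed
  have "\<exists>f. linear f \<and> (\<forall>(\<omega>, r)\<in>E. f \<omega> \<le> c + r) \<and>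
      (\<forall>w\<in>W. \<forall>m. (\<forall>g\<in>(\<lambda>x \<omega>. dual_app \<omega> x) ` D. m \<le> g w) \<longrightarrow> m \<le> f w)"
  proof (rule sandwich[OF S, of E "(\<lambda>x \<omega>. dual_app \<omega> x) ` D" c])
    show "\<omega> \<in> W" if "(\<omega>, r) \<in> E" for \<omega> r using that by (simp add: E_def)
    show "convex E"
    proof (rule convexI)
      fix p p' and a b :: real
      assume "p \<in> E" "p' \<in> E" and ab: "0 \<le> a" "0 \<le> b" "a + b = 1"
      then obtain \<omega> r \<omega>' r' where *: "p = (\<omega>, r)" "p' = (\<omega>', r')" "\<omega> \<in> W" "\<omega>' \<in> W"
        "\<And>x q. Phi_conj F x \<le> ereal q \<Longrightarrow> dual_app \<omega> x \<le> r + q"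
        "\<And>x q. Phi_conj F x \<le> ereal q \<Longrightarrow> dual_app \<omega>' x \<le> r' + q"
        unfolding E_def by auto
      have "dual_app (a *\<^sub>R \<omega> + b *\<^sub>R \<omega>') x \<le> (a * r + b * r') + q"
        if x: "Phi_conj F x \<le> ereal q" for x q
      proof -
        have "dual_app (a *\<^sub>R \<omega> + b *\<^sub>R \<omega>') x \<le> a * (r + q) + b * (r' + q)"
          using * x ab by (simp add: alg_dual_rep_eq add_mono mult_left_mono)
        also have "\<dots> = (a * r + b * r') + (a + b) * q" by (simp add: algebra_simps)
        finally show ?thesis by (simp add: ab)
      qed
      then show "a *\<^sub>R p + b *\<^sub>R p' \<in> E"
        using * by (simp add: E_def subspace_add[OF S] subspace_scale[OF S])
    qed
    show "(0, 0) \<in> E"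
      using W0 by (auto simp: E_def alg_dual_rep_eq conj_q)
    show "\<exists>t>0. \<exists>r. (t *\<^sub>R \<omega>, r) \<in> E" if "\<omega> \<in> W" for \<omega>
    proof -
      obtain s where s: "Cauchy_wrt N s" "\<And>x. x \<in> top_dual N \<Longrightarrow> dual_app \<omega> x = compl_app x (cls s)"
        using \<open>\<omega> \<in> W\<close> by (auto simp: W_def)
      obtain B where "0 < B" "\<forall>\<^sub>F n in sequentially. N (s n) \<le> B"
        using s(1) by (rule Cauchy_wrt_bounded)
      from E_unit[OF that s this] \<open>0 < B\<close> show ?thesis
        by (intro exI[of _ "1 / B"]) auto
    qed
    show "linear g" if "g \<in> (\<lambda>x \<omega>. dual_app \<omega> x) ` D" for g
      using that by (auto simp: linear_dual_app_left)
    show "m \<le> c + r" if E: "(\<omega>, r) \<in> E" and m: "\<And>g. g \<in> (\<lambda>x \<omega>. dual_app \<omega> x) ` D \<Longrightarrow> m \<le> g \<omega>"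
      for \<omega> r m
    proof -
      have "\<omega> \<in> W" and bd: "\<And>x q. Phi_conj F x \<le> ereal q \<Longrightarrow> dual_app \<omega> x \<le> r + q"
        using E by (auto simp: E_def)
      then obtain s where s: "Cauchy_wrt N s" "\<And>x. x \<in> top_dual N \<Longrightarrow> dual_app \<omega> x = compl_app x (cls s)"
        by (auto simp: W_def)
      show ?thesis
      proof (rule le[OF cls_in_completion[OF s(1)]])
        show "compl_app x (cls s) \<le> r + q" if "Phi_conj F x \<le> ereal q" for x q
          using bd[OF that] s(2)[OF fin[OF that]] by simp
        show "m \<le> compl_app x (cls s)" if "x \<in> D" for x
          using m[OF imageI[OF that]] s(2)[of x] that DX by auto
      qed
    qed
  qed
  then obtain f where f0: "linear f" "\<forall>(\<omega>, r)\<in>E. f \<omega> \<le> c + r"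
      "\<forall>w\<in>W. \<forall>m. (\<forall>g\<in>(\<lambda>x \<omega>. dual_app \<omega> x) ` D. m \<le> g w) \<longrightarrow> m \<le> f w"
    by (elim exE conjE)
  have f: "linear f" "\<And>\<omega> r. (\<omega>, r) \<in> E \<Longrightarrow> f \<omega> \<le> c + r"
      "\<And>w m. w \<in> W \<Longrightarrow> \<forall>x\<in>D. m \<le> dual_app w x \<Longrightarrow> m \<le> f w"
    using f0 by auto
  have embed_lin: "linear (bidual_embed :: 'a \<Rightarrow> _)"
    by (rule linearI; transfer; auto simp: fun_eq_iff dual_app_linear)
  \<comment> \<open>The candidate is \<open>f\<close> on constants. The upper half of the sandwich
    there is the bound on its conjugate, which in turn puts \<open>x\<close> in
    \<open>top_dual N\<close>.\<close>
  define x where "x = Abs_alg_dual (\<lambda>v. f (bidual_embed v))"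
  have x: "dual_app x v = f (bidual_embed v)" for v
    using linear_compose[OF embed_lin f(1)] by (simp add: x_def dual_app_Abs comp_def)
  have conj_x: "Phi_conj F x \<le> ereal c"
    unfolding conj_le_iff
  proof (intro allI impI)
    fix v r assume v: "F v \<le> ereal r"
    have "(bidual_embed v, r) \<in> E"
      using v by (auto simp: E_def const_W bidual_embed.rep_eq conj_le_iff add.commute)
    then show "dual_app x v \<le> c + r" using f(2) by (simp add: x)
  qed
  have x_dual: "x \<in> top_dual N" by (rule fin[OF conj_x])
  have "0 \<le> c" by (rule conj_q[OF conj_x])
  \<comment> \<open>On level \<open>1\<close> of \<open>E\<close> the functional \<open>f\<close> is
    at most \<open>c + 1\<close>. Applied to the difference from \<open>s m\<close> and to its
    negative, this bounds \<open>f\<close> by \<open>c + 1\<close> times the tail norm.\<close>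
  have f_eq: "f \<omega> = compl_app x (cls s)"
    if \<omega>: "\<omega> \<in> W" and s: "Cauchy_wrt N s" "\<And>x. x \<in> top_dual N \<Longrightarrow> dual_app \<omega> x = compl_app x (cls s)"
    for \<omega> s
  proof (rule compl_app_eqI[OF x_dual s(1), symmetric], rule tendsto_of_tail_bound[OF s(1)])
    show "0 < c + 1" using \<open>0 \<le> c\<close> by simp
    fix m and e :: real
    assume e: "0 < e" "\<forall>\<^sub>F n in sequentially. N (s n - s m) \<le> e"
    define \<omega>' where "\<omega>' = \<omega> - bidual_embed (s m)"
    have f\<omega>': "f \<omega>' = f \<omega> - dual_app x (s m)"
      by (simp add: \<omega>'_def x linear_diff[OF f(1)])
    have mem: "\<omega>' \<in> W" "- \<omega>' \<in> W"
      using \<omega> const_W by (auto simp: \<omega>'_def intro!: subspace_diff[OF S] subspace_neg[OF S])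
    \<comment> \<open>Both differences are written in the shape of
      \<open>compl_app_comb_right\<close>.\<close>
    let ?t = "\<lambda>n. (-1) *\<^sub>R s m + s n" and ?t' = "\<lambda>n. (-1) *\<^sub>R s n + s m"
    have t: "Cauchy_wrt N ?t" "Cauchy_wrt N ?t'"
      by (intro Cauchy_wrt_comb Cauchy_wrt_const s(1))+
    have "((1 / e) *\<^sub>R \<omega>', 1) \<in> E"
    proof (rule E_unit[OF mem(1) t(1) _ e(1)])
      show "dual_app \<omega>' z = compl_app z (cls ?t)" if "z \<in> top_dual N" for z
        using that s by (simp only: compl_app_comb_right[OF that Cauchy_wrt_const s(1)])
          (simp add: \<omega>'_def alg_dual_rep_eq bidual_embed.rep_eq compl_app_const)
      show "\<forall>\<^sub>F n in sequentially. N (?t n) \<le> e" using e(2) by simp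
    qed
    from f(2)[OF this] have "f \<omega>' \<le> (c + 1) * e"
      using e(1) by (simp add: linear_scale[OF f(1)] field_simps)
    moreover have "((1 / e) *\<^sub>R (- \<omega>'), 1) \<in> E"
    proof (rule E_unit[OF mem(2) t(2) _ e(1)])
      show "dual_app (- \<omega>') z = compl_app z (cls ?t')" if "z \<in> top_dual N" for z
        using that s by (simp only: compl_app_comb_right[OF that s(1) Cauchy_wrt_const])
          (simp add: \<omega>'_def alg_dual_rep_eq bidual_embed.rep_eq compl_app_const)
      show "\<forall>\<^sub>F n in sequentially. N (?t' n) \<le> e"
        using e(2) N_minus[of "s _ - s m"] by simp
    qed
    from f(2)[OF this] have "- f \<omega>' \<le> (c + 1) * e"
      using e(1) by (simp add: linear_scale[OF f(1)] linear_neg[OF f(1)] field_simps)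
    ultimately show "\<bar>f \<omega> - dual_app x (s m)\<bar> \<le> (c + 1) * e"
      unfolding f\<omega>' by linarith
  qed
  have "x \<in> D"
  proof (rule ccontr)
    assume "x \<notin> D"
    then obtain \<xi> e where \<xi>: "\<xi> \<in> completion N" "0 < e"
        "\<And>d. d \<in> D \<Longrightarrow> compl_app x \<xi> + e \<le> compl_app d \<xi>"
      using completion_separation[OF D x_dual] by blast
    obtain s where s: "Cauchy_wrt N s" "\<xi> = cls s" using \<xi>(1) by (rule completionE)
    obtain \<omega> where \<omega>: "\<And>z. z \<in> top_dual N \<Longrightarrow> dual_app \<omega> z = compl_app z \<xi>"
      using compl_app_extension[OF \<xi>(1)] by blast
    have "\<omega> \<in> W" using s \<omega> by (auto simp: W_def)
    have "compl_app x \<xi> + e \<le> f \<omega>"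
      using \<xi>(3) \<omega> DX by (intro f(3)[OF \<open>\<omega> \<in> W\<close>]) auto
    moreover have "f \<omega> = compl_app x \<xi>"
      using f_eq[OF \<open>\<omega> \<in> W\<close> s(1)] \<omega> s(2) by simp
    ultimately show False using \<xi>(2) by simp
  qed
  with conj_x show ?thesis by blast
qed

end

section \<open>Weak compactness of sublevel sets\<close>

text \<open>Weakly open sets are the preimages of open sets of the product, so a cover of
  \<open>K\<close> comes from a cover of its image.\<close>

lemma compactin_weak_topology:
  assumes K: "K \<subseteq> E"
    and cpt: "compactin (product_topology (\<lambda>_. euclideanreal) G) ((\<lambda>x. \<lambda>g\<in>G. b x g) ` K)"
  shows "compactin (weak_topology E G b) K"
  unfolding compactin_def
proof (intro conjI allI impI)
  show "K \<subseteq> topspace (weak_topology E G b)" using K by simp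
  let ?h = "\<lambda>x. \<lambda>g\<in>G. b x g"
  fix \<U> assume \<U>: "Ball \<U> (openin (weak_topology E G b)) \<and> K \<subseteq> \<Union>\<U>"
  then have "\<forall>U\<in>\<U>. \<exists>V. openin (product_topology (\<lambda>_. euclideanreal) G) V \<and> U = ?h -` V \<inter> E"
    by (simp add: weak_topology_def openin_pullback_topology)
  then obtain V where V: "\<And>U. U \<in> \<U> \<Longrightarrow> openin (product_topology (\<lambda>_. euclideanreal) G) (V U)"
      "\<And>U. U \<in> \<U> \<Longrightarrow> U = ?h -` V U \<inter> E"
    by metis
  have "?h ` K \<subseteq> \<Union>(V ` \<U>)"
  proof
    fix y assume "y \<in> ?h ` K"
    then obtain x where x: "x \<in> K" "y = ?h x" by blast
    then obtain U where "U \<in> \<U>" "x \<in> U" using \<U> by blast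
    then show "y \<in> \<Union>(V ` \<U>)" using V(2) x(2) by blast
  qed
  moreover have "Ball (V ` \<U>) (openin (product_topology (\<lambda>_. euclideanreal) G))"
    using V(1) by blast
  ultimately obtain \<F> where \<F>: "finite \<F>" "\<F> \<subseteq> V ` \<U>" "?h ` K \<subseteq> \<Union>\<F>"
    using cpt unfolding compactin_def by meson
  then obtain \<F>' where \<F>': "finite \<F>'" "\<F>' \<subseteq> \<U>" "\<F> = V ` \<F>'"
    by (meson finite_subset_image)
  have "K \<subseteq> \<Union>\<F>'"
  proof
    fix x assume "x \<in> K"
    then obtain U where "U \<in> \<F>'" "?h x \<in> V U" using \<F>(3) \<F>'(3) by blast
    moreover from this have "x \<in> U"
      using V(2)[of U] \<F>'(2) \<open>x \<in> K\<close> K by blast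
    ultimately show "x \<in> \<Union>\<F>'" by blast
  qed
  with \<F>' show "\<exists>\<F>. finite \<F> \<and> \<F> \<subseteq> \<U> \<and> K \<subseteq> \<Union>\<F>" by blast
qed

lemma closedin_constraints:
  assumes "\<And>i. i \<in> I \<Longrightarrow> continuous_map X euclideanreal (\<phi> i)" "\<And>i. i \<in> I \<Longrightarrow> closed (A i)"
  shows "closedin X {h \<in> topspace X. \<forall>i\<in>I. \<phi> i h \<in> A i}"
proof -
  \<comment> \<open>Inserting \<open>topspace X\<close> keeps the family nonempty when
    \<open>I\<close> is empty.\<close>
  have "{h \<in> topspace X. \<forall>i\<in>I. \<phi> i h \<in> A i} =
      \<Inter>(insert (topspace X) ((\<lambda>i. {h \<in> topspace X. \<phi> i h \<in> A i}) ` I))"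
    by auto
  also have "closedin X \<dots>"
    using assms closedin_continuous_map_preimage[of X euclideanreal]
    by (intro closedin_Inter) auto
  finally show ?thesis .
qed

context gauge_function
begin

text \<open>The argument of Banach and Alaoglu: inside a product of compact intervals the functions
  that come from the sublevel set are cut out by closed conditions, each involving finitely many
  coordinates.\<close>

theorem compactin_conj_sublevel:
  "compactin (weak_topology (top_dual N) (completion N) compl_app) {x. Phi_conj F x \<le> ereal q}"
proof (rule compactin_weak_topology)
  have fin: "x \<in> top_dual N" if "Phi_conj F x \<le> ereal q" for x
    by (rule conj_finite_top_dual[OF le_less_trans[OF that]]) simp
  then show "{x. Phi_conj F x \<le> ereal q} \<subseteq> top_dual N" by blast
  let ?Z = "product_topology (\<lambda>_. euclideanreal) (completion N)"
  let ?g = "\<lambda>x. \<lambda>\<xi>\<in>completion N. compl_app x \<xi>"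
  \<comment> \<open>The conditions are linearity, the bound from \<open>conj_bound\<close>, and the
    conjugate inequality on constants. The second one both supplies the compact intervals and makes
    \<open>h\<close> recoverable from its values on constants.\<close>
  define K where "K = {h \<in> topspace ?Z.
    (\<forall>s t c. Cauchy_wrt N s \<longrightarrow> Cauchy_wrt N t \<longrightarrow>
      h (cls (\<lambda>n. c *\<^sub>R s n + t n)) = c * h (cls s) + h (cls t)) \<and>
    (\<forall>s e. Cauchy_wrt N s \<longrightarrow> (\<forall>\<^sub>F n in sequentially. N (s n) \<le> e) \<longrightarrow>
      \<bar>h (cls s)\<bar> \<le> (q + 1) * e) \<and>
    (\<forall>v r. F v \<le> ereal r \<longrightarrow> h (cls (\<lambda>_. v)) \<le> q + r)}"
  have proj: "continuous_map ?Z euclideanreal (\<lambda>h. h (cls s))" if "Cauchy_wrt N s" for s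
    by (rule continuous_map_product_projection[OF cls_in_completion[OF that]])
  \<comment> \<open>Each condition is recast as a continuous real function of \<open>h\<close>
    taking values in a closed set.\<close>
  have "K =
    {h \<in> topspace ?Z. \<forall>p\<in>{(s, t, c). Cauchy_wrt N s \<and> Cauchy_wrt N t}.
       h (cls (\<lambda>n. snd (snd p) *\<^sub>R fst p n + fst (snd p) n))
         - snd (snd p) * h (cls (fst p)) - h (cls (fst (snd p))) \<in> {0}} \<inter>
    {h \<in> topspace ?Z. \<forall>p\<in>{(s, e). Cauchy_wrt N s \<and> (\<forall>\<^sub>F n in sequentially. N (s n) \<le> e)}.
       h (cls (fst p)) \<in> {- ((q + 1) * snd p)..(q + 1) * snd p}} \<inter>
    {h \<in> topspace ?Z. \<forall>p\<in>{(v, r). F v \<le> ereal r}. h (cls (\<lambda>_. fst p)) \<in> {..q + snd p}}"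
    unfolding K_def by (simp add: set_eq_iff abs_le_iff minus_le_iff algebra_simps conj_ac) blast
  also have "closedin ?Z \<dots>"
    by (intro closedin_Int closedin_constraints)
      (auto intro!: proj continuous_map_diff continuous_map_real_mult_left Cauchy_wrt_comb
        Cauchy_wrt_const)
  finally have "closedin ?Z K" .
  have K_comb: "h (cls (\<lambda>n. c *\<^sub>R s n + t n)) = c * h (cls s) + h (cls t)"
    if "h \<in> K" "Cauchy_wrt N s" "Cauchy_wrt N t" for h s t c
    using that unfolding K_def by blast
  have K_bound: "\<bar>h (cls s)\<bar> \<le> (q + 1) * e"
    if "h \<in> K" "Cauchy_wrt N s" "\<forall>\<^sub>F n in sequentially. N (s n) \<le> e" for h s e
    using that unfolding K_def by blast
  have K_const: "h (cls (\<lambda>_. v)) \<le> q + r" if "h \<in> K" "F v \<le> ereal r" for h v r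
    using that unfolding K_def by blast
  have "\<exists>B. \<forall>h\<in>K. \<bar>h \<xi>\<bar> \<le> B" if "\<xi> \<in> completion N" for \<xi>
  proof -
    obtain s where s: "Cauchy_wrt N s" "\<xi> = cls s" using \<open>\<xi> \<in> completion N\<close> by (rule completionE)
    obtain e where "\<forall>\<^sub>F n in sequentially. N (s n) \<le> e"
      using s(1) by (rule Cauchy_wrt_bounded)
    then show ?thesis using K_bound s by blast
  qed
  then obtain B where B: "\<And>\<xi> h. \<xi> \<in> completion N \<Longrightarrow> h \<in> K \<Longrightarrow> \<bar>h \<xi>\<bar> \<le> B \<xi>"
    by metis
  have "compactin ?Z (\<Pi>\<^sub>E \<xi>\<in>completion N. {- B \<xi>..B \<xi>})"
    by (simp add: compactin_PiE)
  moreover have "K \<subseteq> (\<Pi>\<^sub>E \<xi>\<in>completion N. {- B \<xi>..B \<xi>})"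
  proof
    fix h assume "h \<in> K"
    then have "h \<in> extensional (completion N)" by (auto simp: K_def PiE_def)
    then show "h \<in> (\<Pi>\<^sub>E \<xi>\<in>completion N. {- B \<xi>..B \<xi>})"
      using B[OF _ \<open>h \<in> K\<close>] by (auto simp: PiE_def abs_le_iff) (metis minus_le_iff)
  qed
  ultimately have "compactin ?Z K"
    using \<open>closedin ?Z K\<close> closed_compactin by blast
  also have "K = ?g ` {x. Phi_conj F x \<le> ereal q}"
  proof (intro set_eqI iffI)
    fix h assume "h \<in> ?g ` {x. Phi_conj F x \<le> ereal q}"
    then obtain x where x: "Phi_conj F x \<le> ereal q" "h = ?g x" by blast
    have h: "h (cls s) = compl_app x (cls s)" if "Cauchy_wrt N s" for s
      using cls_in_completion[OF that] by (simp add: x(2))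
    have "h \<in> topspace ?Z" by (simp add: x(2))
    moreover have "\<bar>h (cls s)\<bar> \<le> (q + 1) * e"
      if "Cauchy_wrt N s" "\<forall>\<^sub>F n in sequentially. N (s n) \<le> e" for s e
      using compl_app_bound[OF x(1) that] h[OF that(1)] by simp
    moreover have "h (cls (\<lambda>_. v)) \<le> q + r" if "F v \<le> ereal r" for v r
      using x(1) that h[OF Cauchy_wrt_const[of v]] fin[OF x(1)]
      by (simp add: conj_le_iff compl_app_const)
    ultimately show "h \<in> K"
      using fin[OF x(1)] by (simp add: K_def h Cauchy_wrt_comb compl_app_comb_right)
  next
    fix h assume hK: "h \<in> K"
    \<comment> \<open>The functional is read off on constants; the bound in \<open>K\<close> then
      shows that its continuous extension is \<open>h\<close> on every class.\<close>
    define f where "f v = h (cls (\<lambda>_. v))" for v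
    have comb: "f (c *\<^sub>R u + v) = c * f u + f v" for c u v
      using K_comb[OF hK Cauchy_wrt_const[of u] Cauchy_wrt_const[of v], of c] by (simp add: f_def)
    have "f 0 = 0" using comb[of 1 0 0] by simp
    then have "linear f"
      using comb[of 1] comb[of _ _ 0] by (intro linearI) auto
    define x where "x = Abs_alg_dual f"
    have x: "dual_app x = f" by (simp add: x_def dual_app_Abs \<open>linear f\<close>)
    have conj_x: "Phi_conj F x \<le> ereal q"
      using K_const[OF hK] by (simp add: conj_le_iff x f_def)
    have "0 \<le> ereal q" using order_trans[OF conj_nonneg conj_x] .
    then have "0 < q + 1" by simp
    have "h \<xi> = compl_app x \<xi>" if "\<xi> \<in> completion N" for \<xi>
    proof -
      obtain s where s: "Cauchy_wrt N s" "\<xi> = cls s" using \<open>\<xi> \<in> completion N\<close> by (rule completionE)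
      have "(\<lambda>m. dual_app x (s m)) \<longlonglongrightarrow> h (cls s)"
      proof (rule tendsto_of_tail_bound[OF s(1) \<open>0 < q + 1\<close>])
        fix m and e :: real
        assume "\<forall>\<^sub>F n in sequentially. N (s n - s m) \<le> e"
        then have "\<bar>h (cls (\<lambda>n. (-1) *\<^sub>R s m + s n))\<bar> \<le> (q + 1) * e"
          by (intro K_bound[OF hK] Cauchy_wrt_comb Cauchy_wrt_const s(1)) simp
        then show "\<bar>h (cls s) - dual_app x (s m)\<bar> \<le> (q + 1) * e"
          unfolding K_comb[OF hK Cauchy_wrt_const s(1)] by (simp add: x f_def)
      qed
      then show ?thesis
        using compl_app_eqI[OF fin[OF conj_x] s(1)] s(2) by simp
    qed
    moreover have "h \<in> extensional (completion N)"
      using hK by (auto simp: K_def PiE_def)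
    ultimately have "h = ?g x"
      by (auto simp: fun_eq_iff extensional_def)
    with conj_x show "h \<in> ?g ` {x. Phi_conj F x \<le> ereal q}" by blast
  qed
  finally show "compactin ?Z (?g ` {x. Phi_conj F x \<le> ereal q})" .
qed

end

text \<open>The exchange of a function and its conjugate in Young's inequality. Nonnegativity
  excludes the value \<open>-\<infinity>\<close>, so only the conventions for
  \<open>\<infinity>\<close> come into play.\<close>

lemma ereal_minus_le_swap:
  fixes p q :: ereal
  assumes "ereal a - q \<le> p" "0 \<le> p" "0 \<le> q"
  shows "ereal a - p \<le> q"
  using assms by (cases p; cases q) auto

section \<open>Weak continuity, cluster points and comparison of infima\<close>

lemma continuous_map_weak_topology_pairing:
  assumes "g \<in> G"
  shows "continuous_map (weak_topology E G b) euclideanreal (\<lambda>x. b x g)"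
proof -
  have "continuous_map (weak_topology E G b) euclideanreal ((\<lambda>h. h g) \<circ> (\<lambda>x. \<lambda>g\<in>G. b x g))"
    unfolding weak_topology_def
    by (intro continuous_map_pullback continuous_map_product_projection assms)
  then show ?thesis using assms by (simp add: comp_def)
qed

lemma continuous_map_into_weak_topology:
  assumes "\<And>x. x \<in> topspace X \<Longrightarrow> f x \<in> E"
    and "\<And>g. g \<in> G \<Longrightarrow> continuous_map X euclideanreal (\<lambda>x. b (f x) g)"
  shows "continuous_map X (weak_topology E G b) f"
  unfolding weak_topology_def
proof (rule continuous_map_pullback')
  show "continuous_map X (product_topology (\<lambda>_. euclideanreal) G) ((\<lambda>x. \<lambda>g\<in>G. b x g) \<circ> f)"
    using assms(2) by (auto simp: continuous_map_componentwise)
qed (use assms(1) in auto)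

text \<open>Otherwise every point of \<open>K\<close> has an open neighbourhood that the sequence
  eventually avoids; finitely many of these cover \<open>K\<close>, and the sequence eventually
  avoids \<open>K\<close>. Cluster points take the place of convergent subsequences, as the weak
  topology need not be metrizable.\<close>

lemma compactin_ex_seq_cluster_point:
  assumes K: "compactin X K" and s: "\<forall>\<^sub>F n in sequentially. s n \<in> K"
  shows "\<exists>a. seq_cluster_point X s a"
proof (rule ccontr)
  assume no: "\<nexists>a. seq_cluster_point X s a"
  have "\<exists>U. openin X U \<and> a \<in> U \<and> (\<forall>\<^sub>F n in sequentially. s n \<notin> U)" if "a \<in> K" for a
  proof -
    have "a \<in> topspace X" using compactin_subset_topspace[OF K] that by blast
    then show ?thesis
      using no by (auto simp: seq_cluster_point_def not_frequently)
  qed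
  then obtain U where U: "\<And>a. a \<in> K \<Longrightarrow> openin X (U a)" "\<And>a. a \<in> K \<Longrightarrow> a \<in> U a"
      "\<And>a. a \<in> K \<Longrightarrow> \<forall>\<^sub>F n in sequentially. s n \<notin> U a"
    by metis
  have cover: "\<forall>\<U>. Ball \<U> (openin X) \<and> K \<subseteq> \<Union>\<U> \<longrightarrow>
      (\<exists>\<F>. finite \<F> \<and> \<F> \<subseteq> \<U> \<and> K \<subseteq> \<Union>\<F>)"
    using K unfolding compactin_def by (rule conjunct2)
  have "\<exists>\<F>. finite \<F> \<and> \<F> \<subseteq> U ` K \<and> K \<subseteq> \<Union>\<F>"
    by (rule cover[rule_format]) (use U(1,2) in auto)
  then obtain I where I: "finite I" "I \<subseteq> K" "K \<subseteq> \<Union>(U ` I)"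
    by (metis finite_subset_image)
  have "\<forall>\<^sub>F n in sequentially. \<forall>a\<in>I. s n \<notin> U a"
    using I U(3) by (intro eventually_ball_finite) auto
  with s have "\<forall>\<^sub>F n in sequentially. False"
    by eventually_elim (use I(3) in blast)
  then show False by simp
qed

text \<open>Points of infinite value do not influence an infimum. This compares problems whose
  feasible sets differ only at such points.\<close>

lemma min_value_le_if_finite_part:
  assumes "\<And>x. x \<in> S' \<Longrightarrow> g x < \<infinity> \<Longrightarrow> x \<in> S \<and> f x = g x"
  shows "min_value f S \<le> min_value g S'"
  unfolding min_value_def
proof (rule INF_greatest)
  fix x assume x: "x \<in> S'"
  show "(INF x\<in>S. f x) \<le> g x"
  proof (cases "g x < \<infinity>")
    case True
    then show ?thesis using assms[OF x True] by (metis INF_lower)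
  qed simp
qed

section \<open>Biconjugates on the space and on its completion\<close>

context gauge_function
begin

lemma Phi_conj_0: "Phi_conj F 0 = 0"
proof (rule antisym)
  have "0 \<le> r" if "F v \<le> ereal r" for v r
    using order_trans[OF nonneg that] by simp
  then show "Phi_conj F 0 \<le> 0"
    by (simp add: zero_ereal_def conj_le_iff alg_dual_rep_eq)
qed (rule conj_nonneg)

lemma young: "ereal (dual_app x v) - Phi_conj F x \<le> F v"
proof (rule ereal_minus_le_swap)
  show "ereal (dual_app x v) - F v \<le> Phi_conj F x"
    unfolding Phi_conj_def by (rule SUP_upper) simp
qed (rule nonneg conj_nonneg)+

lemma Phi0_le: "Phi0 F v \<le> F v"
  unfolding Phi0_def by (intro SUP_least young)

lemma Phi0_nonneg: "0 \<le> Phi0 F v"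
  unfolding Phi0_def
  by (rule SUP_upper2[of 0]) (simp_all add: Phi_conj_0 alg_dual_rep_eq)

lemma compl_app_0: "\<xi> \<in> completion N \<Longrightarrow> compl_app 0 \<xi> = 0"
  using compl_app_scale_left[OF subspace_0[OF subspace_top_dual], of \<xi> 0] by simp

lemma Phi1_nonneg: "\<xi> \<in> completion N \<Longrightarrow> 0 \<le> Phi1 F \<xi>"
  unfolding Phi1_def L1_def norm_Phi_def
  by (rule SUP_upper2[OF subspace_0[OF subspace_top_dual]]) (simp add: Phi_conj_0 compl_app_0)

lemma Phi1_const_le: "Phi1 F (cls (\<lambda>_. v)) \<le> F v"
  unfolding Phi1_def L1_def norm_Phi_def
  by (rule SUP_least) (simp add: compl_app_const young)

text \<open>A third conjugate equals the first. One inequality holds because \<open>l\<close> itself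
  takes part in the supremum defining \<open>Phi1\<close>; the other tests on constants, where
  \<open>Phi1\<close> is at most \<open>F\<close>.\<close>

lemma Phi1_conj_eq:
  assumes l: "l \<in> L1 F"
  shows "Phi1_conj F l = Phi_conj F l"
proof (rule antisym)
  have l': "l \<in> top_dual N" using l by (simp add: L1_def norm_Phi_def)
  show "Phi1_conj F l \<le> Phi_conj F l"
    unfolding Phi1_conj_def
  proof (rule SUP_least)
    fix \<xi> assume "\<xi> \<in> U1 F"
    then have \<xi>: "\<xi> \<in> completion N" by (simp add: U1_def norm_Phi_def)
    show "ereal (compl_app l \<xi>) - Phi1 F \<xi> \<le> Phi_conj F l"
      by (rule ereal_minus_le_swap[OF _ Phi1_nonneg[OF \<xi>] conj_nonneg])
        (auto simp: Phi1_def intro: SUP_upper l)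
  qed
  show "Phi_conj F l \<le> Phi1_conj F l"
    unfolding Phi_conj_def
  proof (rule SUP_least)
    fix v
    have "ereal (dual_app l v) - F v \<le> ereal (compl_app l (cls (\<lambda>_. v))) - Phi1 F (cls (\<lambda>_. v))"
      by (simp add: compl_app_const[OF l'] ereal_minus_mono Phi1_const_le)
    also have "\<dots> \<le> Phi1_conj F l"
      unfolding Phi1_conj_def U1_def norm_Phi_def
      by (rule SUP_upper[OF cls_in_completion[OF Cauchy_wrt_const]])
    finally show "ereal (dual_app l v) - F v \<le> Phi1_conj F l" .
  qed
qed

end

section \<open>The primal and dual problems\<close>

locale constrained_problem =
  fixes \<Phi> :: "'u::real_vector \<Rightarrow> ereal"
    and T :: "'u alg_dual \<Rightarrow> 'y::real_vector alg_dual"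
  assumes lin_T: "linear T" and H_Phi: "H_Phi \<Phi>" and H_T: "H_T T"
begin

abbreviation adj :: "'y \<Rightarrow> 'u"
  where "adj \<equiv> adjoint_in T"

text \<open>\<open>H_T\<close> puts the adjoint in the range of \<open>bidual_embed\<close>, so the
  inverse in \<open>adjoint_in\<close> is a true preimage.\<close>

lemma dual_app_T: "dual_app (T l) y = dual_app l (adj y)"
proof -
  have "alg_adjoint T y \<in> range bidual_embed"
    using H_T by (auto simp: H_T_def)
  then have "bidual_embed (adj y) = alg_adjoint T y"
    unfolding adjoint_in_def by (rule f_inv_into_f)
  then show ?thesis
    by (metis bidual_embed.rep_eq dual_app_alg_adjoint lin_T)
qed

lemma eq_if_dual_app_eq: "(\<And>l. dual_app l u = dual_app l v) \<Longrightarrow> u = v" for u v :: "'b::real_vector"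
  by (rule injD[OF inj_bidual_embed]) (simp add: dual_app_inject[symmetric] bidual_embed.rep_eq fun_eq_iff)

lemma linear_adj: "linear adj"
  by (rule linearI; rule eq_if_dual_app_eq) (simp_all add: dual_app_linear flip: dual_app_T)

lemma inj_adj: "inj adj"
proof (rule linear_injective_0[THEN iffD2, OF linear_adj], intro allI impI)
  fix y assume "adj y = 0"
  then have "alg_adjoint T y = 0"
    by (simp add: dual_app_inject[symmetric] fun_eq_iff dual_app_alg_adjoint lin_T dual_app_T
        dual_app_linear alg_dual_rep_eq)
  then show "y = 0" using H_T by (auto simp: H_T_def)
qed

sublocale gP: gauge_function \<Phi>
  using H_Phi by unfold_locales (auto simp: H_Phi_def)

sublocale gL: gauge_function "Lam \<Phi> T"
  using gP.nonneg gP.convex gP.zero gP.absorbing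
  by unfold_locales (auto simp: Lam_def linear_add[OF linear_adj] linear_scale[OF linear_adj]
      linear_0[OF linear_adj])

lemma N_Lam: "gL.N y = gP.N (adj y)"
  by (simp add: gauge_norm_def sym_max_def Lam_def linear_scale[OF linear_adj] linear_neg[OF linear_adj])

lemma L1_eq: "L1 \<Phi> = top_dual gP.N" and U1_eq: "U1 \<Phi> = completion gP.N"
  and X1_eq: "X1 \<Phi> T = top_dual gL.N" and Y1_eq: "Y1 \<Phi> T = completion gL.N"
  by (simp_all add: L1_def U1_def X1_def Y1_def norm_Phi_def norm_Lam_def)

lemma T_L1: "l \<in> L1 \<Phi> \<Longrightarrow> T l \<in> X1 \<Phi> T"
  by (auto simp: L1_eq X1_eq top_dual_def dual_app_T N_Lam)

lemma conj_finite_L1: "Phi_conj \<Phi> l < \<infinity> \<Longrightarrow> l \<in> L1 \<Phi>"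
  and conj_finite_X1: "Phi_conj (Lam \<Phi> T) x < \<infinity> \<Longrightarrow> x \<in> X1 \<Phi> T"
  unfolding L1_eq X1_eq by (fact gP.conj_finite_top_dual gL.conj_finite_top_dual)+

lemma conj_T_le: "Phi_conj (Lam \<Phi> T) (T l) \<le> Phi_conj \<Phi> l"
  unfolding Phi_conj_def[of "Lam \<Phi> T"]
  by (rule SUP_least) (auto simp: Lam_def dual_app_T Phi_conj_def intro: SUP_upper)

text \<open>\<open>x\<close> prescribes a functional on the range of \<open>adj\<close>. The
  extension must stay below the extended-valued convex function \<open>\<Phi> + c\<close>, which is
  why an epigraph is used in place of a sublinear majorant.\<close>

theorem conj_Lam_attained: "\<exists>l. T l = x \<and> Phi_conj \<Phi> l = Phi_conj (Lam \<Phi> T) x"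
proof (cases "Phi_conj (Lam \<Phi> T) x < \<infinity>")
  case False
  \<comment> \<open>Here any preimage of \<open>x\<close> will do, as its conjugate is infinite by
    \<open>conj_T_le\<close>; a left inverse of \<open>adj\<close> provides one.\<close>
  obtain g where g: "linear g" "\<And>y. g (adj y) = y"
    using linear_injective_left_inverse[OF linear_adj inj_adj] by (auto simp: fun_eq_iff)
  define l where "l = Abs_alg_dual (\<lambda>u. dual_app x (g u))"
  have "dual_app l = (\<lambda>u. dual_app x (g u))"
    unfolding l_def
    by (rule dual_app_Abs) (use linear_compose[OF g(1) linear_dual_app[of x]] in \<open>simp add: comp_def\<close>)
  then have "T l = x"
    by (simp add: dual_app_inject[symmetric] fun_eq_iff dual_app_T g(2))
  then show ?thesis using False conj_T_le[of l] by auto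
next
  case True
  then obtain c where c: "Phi_conj (Lam \<Phi> T) x = ereal c" using gL.conj_real by blast
  \<comment> \<open>The epigraph of \<open>\<Phi>\<close> raised by \<open>c\<close>, minus the
    graph of \<open>x\<close> over the range of \<open>adj\<close>. A first component
    \<open>0\<close> means \<open>u = adj y\<close>, and the sign condition becomes
    \<open>Phi_conj (Lam \<Phi> T) x \<le> c\<close>.\<close>
  let ?A = "{(u - adj y, c + r - dual_app x y) | u y r. \<Phi> u \<le> ereal r}"
  have "\<exists>f. linear f \<and> (\<forall>(u, r)\<in>?A. f u \<le> r)"
  proof (rule convex_epigraph_linear_minorant)
    show "convex ?A"
    proof (rule convexI)
      fix p p' and s t :: real
      assume "p \<in> ?A" "p' \<in> ?A" and st: "0 \<le> s" "0 \<le> t" "s + t = 1"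
      then obtain u y r u' y' r' where *: "\<Phi> u \<le> ereal r" "p = (u - adj y, c + r - dual_app x y)"
          "\<Phi> u' \<le> ereal r'" "p' = (u' - adj y', c + r' - dual_app x y')"
        by auto
      have "s * c + t * c = c" using st by (simp flip: distrib_right)
      then have "s *\<^sub>R p + t *\<^sub>R p' = ((s *\<^sub>R u + t *\<^sub>R u') - adj (s *\<^sub>R y + t *\<^sub>R y'),
          c + (s * r + t * r') - dual_app x (s *\<^sub>R y + t *\<^sub>R y'))"
        using * by (simp add: linear_add[OF linear_adj] linear_scale[OF linear_adj]
            dual_app_linear algebra_simps)
      then show "s *\<^sub>R p + t *\<^sub>R p' \<in> ?A"
        using gP.convex_comb_le[OF *(1) *(3) st] by blast
    qed
    show "\<exists>t>0. \<exists>r. (t *\<^sub>R u, r) \<in> ?A" for u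
    proof -
      obtain t where "0 < t" "\<Phi> (t *\<^sub>R u) \<le> ereal 1"
        using gP.ex_scale_le_1[of u] by (auto simp: one_ereal_def)
      then have "(t *\<^sub>R u - adj 0, c + 1 - dual_app x 0) \<in> ?A" by blast
      then show ?thesis using \<open>0 < t\<close> unfolding linear_0[OF linear_adj] diff_0_right by blast
    qed
    show "0 \<le> r" if r: "(0, r) \<in> ?A" for r
    proof -
      obtain u y r' where "\<Phi> u \<le> ereal r'" "0 = u - adj y" "r = c + r' - dual_app x y"
        using r by blast
      then have "Lam \<Phi> T y \<le> ereal r'" by (simp add: Lam_def)
      then show ?thesis
        using c gL.conj_le_iff[of x c] \<open>r = _\<close> by fastforce
    qed
  qed
  then obtain f where f0: "linear f" "\<forall>(u, r)\<in>?A. f u \<le> r"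
    by (elim exE conjE)
  have f: "f (u - adj y) \<le> c + r - dual_app x y" if "\<Phi> u \<le> ereal r" for u y r
  proof -
    have "(u - adj y, c + r - dual_app x y) \<in> ?A" using that by blast
    from bspec[OF f0(2) this] show ?thesis by simp
  qed
  define l where "l = Abs_alg_dual f"
  have l: "dual_app l = f" by (simp add: l_def dual_app_Abs f0(1))
  \<comment> \<open>With \<open>u = 0\<close> and \<open>r = 0\<close> the error is the constant
    \<open>c\<close>, removed by scaling \<open>y\<close>; replacing \<open>y\<close> by
    \<open>- y\<close> turns the inequality into equality.\<close>
  have ge: "dual_app x y \<le> f (adj y)" for y
  proof (rule le_of_scaled_le)
    fix n
    show "real n * dual_app x y \<le> real n * f (adj y) + c"
      using f[of 0 0 "real n *\<^sub>R y"] gP.zero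
      by (simp add: dual_app_linear linear_scale[OF linear_adj] linear_neg[OF f0(1)]
          linear_scale[OF f0(1)])
  qed
  have "f (adj y) = dual_app x y" for y
    using ge[of y] ge[of "- y"]
    by (simp add: dual_app_linear linear_neg[OF linear_adj] linear_neg[OF f0(1)])
  then have "T l = x"
    by (simp add: dual_app_inject[symmetric] fun_eq_iff dual_app_T l)
  moreover have "Phi_conj \<Phi> l \<le> ereal c"
    using f[of _ _ 0] by (simp add: gP.conj_le_iff l dual_app_linear linear_0[OF linear_adj])
  ultimately show ?thesis
    using conj_T_le[of l] c by (metis antisym)
qed

section \<open>The functions of the dual problems and their conjugates\<close>

lemma Lam0_nonneg: "0 \<le> Lam0 \<Phi> T y" and Lam0_le: "Lam0 \<Phi> T y \<le> Lam \<Phi> T y"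
  by (simp_all add: Lam0_def Lam_def gP.Phi0_nonneg gP.Phi0_le)

text \<open>\<open>Lam0\<close> is a supremum over functionals \<open>l\<close> on \<open>U\<close>,
  so comparing its conjugate with a function of \<open>x\<close> requires an \<open>l\<close> over
  \<open>x\<close> of the same conjugate value; attainment on the fibre provides it.\<close>

lemma Lam0_conj_eq: "Lam0_conj \<Phi> T x = Phi_conj (Lam \<Phi> T) x"
proof (rule antisym)
  obtain l where l: "T l = x" "Phi_conj \<Phi> l = Phi_conj (Lam \<Phi> T) x"
    using conj_Lam_attained by blast
  show "Lam0_conj \<Phi> T x \<le> Phi_conj (Lam \<Phi> T) x"
    unfolding Lam0_conj_def l(2)[symmetric]
  proof (rule SUP_least)
    fix y
    show "ereal (dual_app x y) - Lam0 \<Phi> T y \<le> Phi_conj \<Phi> l"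
      unfolding l(1)[symmetric]
      by (rule ereal_minus_le_swap[OF _ Lam0_nonneg gP.conj_nonneg])
        (auto simp: Lam0_def Phi0_def dual_app_T intro: SUP_upper)
  qed
  show "Phi_conj (Lam \<Phi> T) x \<le> Lam0_conj \<Phi> T x"
    unfolding Phi_conj_def Lam0_conj_def by (intro SUP_mono) (auto intro: ereal_minus_mono Lam0_le)
qed

lemma Cauchy_adj: "Cauchy_wrt gL.N s \<Longrightarrow> Cauchy_wrt gP.N (\<lambda>n. adj (s n))"
  by (simp add: Cauchy_wrt_def N_Lam linear_diff[OF linear_adj])

text \<open>The class of the images \<open>adj (s n)\<close> has the required pairings with
  \<open>L1\<close>, so \<open>inv_into\<close> in \<open>T1_adj\<close> acts on an element of the
  range of \<open>compl_embed\<close>.\<close>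

lemma T1_adj_pairing:
  assumes \<eta>: "\<eta> \<in> Y1 \<Phi> T"
  shows "T1_adj \<Phi> T \<eta> \<in> U1 \<Phi>"
    and "l \<in> L1 \<Phi> \<Longrightarrow> compl_app l (T1_adj \<Phi> T \<eta>) = compl_app (T l) \<eta>"
proof -
  let ?\<zeta> = "T2_adj \<Phi> T (compl_embed (norm_Lam \<Phi> T) \<eta>)"
  have \<zeta>: "?\<zeta> = (\<lambda>l\<in>L1 \<Phi>. compl_app (T l) \<eta>)"
    using T_L1 by (auto simp: T2_adj_def compl_embed_def X1_def fun_eq_iff)
  obtain s where s: "Cauchy_wrt gL.N s" "\<eta> = gL.cls s"
    using \<eta> unfolding Y1_eq by (rule gL.completionE)
  have "compl_app l (gP.cls (\<lambda>n. adj (s n))) = compl_app (T l) \<eta>" if "l \<in> L1 \<Phi>" for l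
  proof (rule gP.compl_app_eqI[OF _ Cauchy_adj[OF s(1)]])
    show "l \<in> top_dual gP.N" using that by (simp add: L1_eq)
    show "(\<lambda>n. dual_app l (adj (s n))) \<longlonglongrightarrow> compl_app (T l) \<eta>"
      using gL.compl_app_tendsto[OF _ s(1), of "T l"] T_L1[OF that] by (simp add: X1_eq s(2) dual_app_T)
  qed
  then have "compl_embed (norm_Phi \<Phi>) (gP.cls (\<lambda>n. adj (s n))) = ?\<zeta>"
    by (subst \<zeta>) (simp add: compl_embed_def L1_def fun_eq_iff)
  then have im: "?\<zeta> \<in> compl_embed (norm_Phi \<Phi>) ` U1 \<Phi>"
    using gP.cls_in_completion[OF Cauchy_adj[OF s(1)]] unfolding U1_eq by (metis imageI)
  show "T1_adj \<Phi> T \<eta> \<in> U1 \<Phi>"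
    unfolding T1_adj_def by (rule inv_into_into[OF im])
  have "compl_embed (norm_Phi \<Phi>) (T1_adj \<Phi> T \<eta>) = ?\<zeta>"
    unfolding T1_adj_def by (rule f_inv_into_f[OF im])
  from fun_cong[OF this, of l]
  show "l \<in> L1 \<Phi> \<Longrightarrow> compl_app l (T1_adj \<Phi> T \<eta>) = compl_app (T l) \<eta>"
    unfolding \<zeta> by (simp add: compl_embed_def L1_def)
qed

lemma Lam1_eq: "\<eta> \<in> Y1 \<Phi> T \<Longrightarrow>
    Lam1 \<Phi> T \<eta> = (SUP l\<in>L1 \<Phi>. ereal (compl_app (T l) \<eta>) - Phi_conj \<Phi> l)"
  unfolding Lam1_def Phi1_def by (intro SUP_cong refl) (simp add: T1_adj_pairing)

lemma Lam1_eq_Lam2: "\<eta> \<in> Y1 \<Phi> T \<Longrightarrow> Lam1 \<Phi> T \<eta> = Lam2 \<Phi> T (compl_embed (norm_Lam \<Phi> T) \<eta>)"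
  unfolding Lam1_eq Lam2_def Phi2_def
  by (intro SUP_cong refl) (simp add: T2_adj_def compl_embed_def T_L1[unfolded X1_def])

lemma Lam1_nonneg: "\<eta> \<in> Y1 \<Phi> T \<Longrightarrow> 0 \<le> Lam1 \<Phi> T \<eta>"
  using gP.Phi1_nonneg[of "T1_adj \<Phi> T \<eta>"] T1_adj_pairing(1) by (simp add: Lam1_def U1_eq)

lemma const_Y1: "gL.cls (\<lambda>_. y) \<in> Y1 \<Phi> T"
  unfolding Y1_eq by (rule gL.cls_in_completion[OF gL.Cauchy_wrt_const])

lemma Lam1_const_le: "Lam1 \<Phi> T (gL.cls (\<lambda>_. y)) \<le> Lam \<Phi> T y"
  unfolding Lam1_eq[OF const_Y1]
proof (rule SUP_least)
  fix l assume "l \<in> L1 \<Phi>"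
  from T_L1[OF this] show "ereal (compl_app (T l) (gL.cls (\<lambda>_. y))) - Phi_conj \<Phi> l \<le> Lam \<Phi> T y"
    by (simp add: X1_eq gL.compl_app_const dual_app_T Lam_def gP.young)
qed

text \<open>As for \<open>Lam0\<close>, except that the optimal \<open>l\<close> must lie in
  \<open>L1\<close> to take part in the supremum; it does when its conjugate is finite, and
  otherwise the upper bound is trivial.\<close>

lemma Lam1_conj_eq:
  assumes x: "x \<in> X1 \<Phi> T"
  shows "Lam1_conj \<Phi> T x = Phi_conj (Lam \<Phi> T) x"
proof (rule antisym)
  obtain l where l: "T l = x" "Phi_conj \<Phi> l = Phi_conj (Lam \<Phi> T) x"
    using conj_Lam_attained by blast
  show "Lam1_conj \<Phi> T x \<le> Phi_conj (Lam \<Phi> T) x"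
  proof (cases "Phi_conj \<Phi> l < \<infinity>")
    case True
    then have "l \<in> L1 \<Phi>" by (rule conj_finite_L1)
    show ?thesis
      unfolding Lam1_conj_def l(2)[symmetric]
    proof (rule SUP_least)
      fix \<eta> assume \<eta>: "\<eta> \<in> Y1 \<Phi> T"
      show "ereal (compl_app x \<eta>) - Lam1 \<Phi> T \<eta> \<le> Phi_conj \<Phi> l"
        unfolding l(1)[symmetric]
        by (rule ereal_minus_le_swap[OF _ Lam1_nonneg[OF \<eta>] gP.conj_nonneg])
          (auto simp: Lam1_eq[OF \<eta>] intro: SUP_upper \<open>l \<in> L1 \<Phi>\<close>)
    qed
  qed (use l in auto)
  show "Phi_conj (Lam \<Phi> T) x \<le> Lam1_conj \<Phi> T x"
    unfolding Phi_conj_def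
  proof (rule SUP_least)
    fix y
    have "ereal (dual_app x y) - Lam \<Phi> T y
        \<le> ereal (compl_app x (gL.cls (\<lambda>_. y))) - Lam1 \<Phi> T (gL.cls (\<lambda>_. y))"
      using x by (simp add: X1_eq gL.compl_app_const ereal_minus_mono Lam1_const_le)
    also have "\<dots> \<le> Lam1_conj \<Phi> T x"
      unfolding Lam1_conj_def by (rule SUP_upper[OF const_Y1])
    finally show "ereal (dual_app x y) - Lam \<Phi> T y \<le> Lam1_conj \<Phi> T x" .
  qed
qed

lemma inf_compact_Lam1_conj: "inf_compact (sigma_X1_Y1 \<Phi> T) (Lam1_conj \<Phi> T)"
  unfolding inf_compact_def
proof
  fix r :: real
  have "x \<in> X1 \<Phi> T" if "Phi_conj (Lam \<Phi> T) x \<le> ereal r" for x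
    by (rule conj_finite_X1[OF le_less_trans[OF that]]) simp
  then have "{x \<in> topspace (sigma_X1_Y1 \<Phi> T). Lam1_conj \<Phi> T x \<le> ereal r} =
      {x. Phi_conj (Lam \<Phi> T) x \<le> ereal r}"
    by (auto simp: sigma_X1_Y1_def Lam1_conj_eq)
  then show "compactin (sigma_X1_Y1 \<Phi> T) {x \<in> topspace (sigma_X1_Y1 \<Phi> T). Lam1_conj \<Phi> T x \<le> ereal r}"
    using gL.compactin_conj_sublevel[of r] by (simp add: sigma_X1_Y1_def X1_eq Y1_eq)
qed

section \<open>The value of the primal problem and its equivalent forms\<close>

lemma INF_conj_eq: "(INF l\<in>{l. T l = x}. Phi_conj \<Phi> l) = Phi_conj (Lam \<Phi> T) x"
proof (rule antisym)
  show "(INF l\<in>{l. T l = x}. Phi_conj \<Phi> l) \<le> Phi_conj (Lam \<Phi> T) x"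
    using conj_Lam_attained[of x] by (metis (mono_tags, lifting) INF_lower mem_Collect_eq)
  show "Phi_conj (Lam \<Phi> T) x \<le> (INF l\<in>{l. T l = x}. Phi_conj \<Phi> l)"
    by (rule INF_greatest) (use conj_T_le in auto)
qed

lemma inf_P_eq: "inf_P \<Phi> T C = (INF x\<in>C. Phi_conj (Lam \<Phi> T) x)"
  unfolding inf_P_def min_value_def
proof (rule antisym)
  show "(INF l\<in>feas_P T C. Phi_conj \<Phi> l) \<le> (INF x\<in>C. Phi_conj (Lam \<Phi> T) x)"
  proof (rule INF_greatest)
    fix x assume "x \<in> C"
    obtain l where l: "T l = x" "Phi_conj \<Phi> l = Phi_conj (Lam \<Phi> T) x"
      using conj_Lam_attained by blast
    then show "(INF l\<in>feas_P T C. Phi_conj \<Phi> l) \<le> Phi_conj (Lam \<Phi> T) x"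
      using \<open>x \<in> C\<close> by (intro INF_lower2[of l]) (auto simp: feas_P_def)
  qed
  show "(INF x\<in>C. Phi_conj (Lam \<Phi> T) x) \<le> (INF l\<in>feas_P T C. Phi_conj \<Phi> l)"
    by (rule INF_greatest) (auto simp: feas_P_def intro: INF_lower2 conj_T_le)
qed

lemma inf_P_le: "l \<in> feas_P T C \<Longrightarrow> inf_P \<Phi> T C \<le> Phi_conj \<Phi> l"
  unfolding inf_P_def min_value_def by (rule INF_lower)

lemma inf_P_nonneg: "0 \<le> inf_P \<Phi> T C"
  unfolding inf_P_eq by (intro INF_greatest gL.conj_nonneg)

lemma inf_P_eq_C1: "inf_P \<Phi> T C = (INF x\<in>C1 \<Phi> T C. Phi_conj (Lam \<Phi> T) x)"
  unfolding inf_P_eq min_value_def[symmetric]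
  by (intro antisym min_value_le_if_finite_part) (auto simp: C1_def conj_finite_X1)

text \<open>The feasible sets differ only where \<open>Phi_conj \<Phi>\<close> is infinite. As
  \<open>solutions\<close> excludes infinite values, the solution sets agree also when the common
  value is \<open>\<infinity>\<close>: both are empty.\<close>

lemma P_P1:
  shows "inf_P \<Phi> T C = inf_P1 \<Phi> T C" and "sol_P \<Phi> T C = sol_P1 \<Phi> T C"
proof -
  have P: "l \<in> feas_P1 \<Phi> T C \<and> Phi1_conj \<Phi> l = Phi_conj \<Phi> l" if "l \<in> feas_P T C" "Phi_conj \<Phi> l < \<infinity>" for l
    using that T_L1 conj_finite_L1[OF that(2)]
    by (simp add: feas_P_def feas_P1_def C1_def gP.Phi1_conj_eq)
  have P1: "l \<in> feas_P T C \<and> Phi_conj \<Phi> l = Phi1_conj \<Phi> l" if "l \<in> feas_P1 \<Phi> T C" for l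
    using that by (simp add: feas_P_def feas_P1_def C1_def gP.Phi1_conj_eq)
  show eq: "inf_P \<Phi> T C = inf_P1 \<Phi> T C"
    unfolding inf_P_def inf_P1_def
  proof (rule antisym)
    show "min_value (Phi_conj \<Phi>) (feas_P T C) \<le> min_value (Phi1_conj \<Phi>) (feas_P1 \<Phi> T C)"
      by (rule min_value_le_if_finite_part) (rule P1)
    show "min_value (Phi1_conj \<Phi>) (feas_P1 \<Phi> T C) \<le> min_value (Phi_conj \<Phi>) (feas_P T C)"
      by (rule min_value_le_if_finite_part) (rule P)
  qed
  have sol: "l \<in> sol_P \<Phi> T C \<longleftrightarrow> l \<in> feas_P T C \<and> Phi_conj \<Phi> l = inf_P \<Phi> T C \<and> Phi_conj \<Phi> l < \<infinity>"
      "l \<in> sol_P1 \<Phi> T C \<longleftrightarrow>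
        l \<in> feas_P1 \<Phi> T C \<and> Phi1_conj \<Phi> l = inf_P \<Phi> T C \<and> Phi1_conj \<Phi> l < \<infinity>" for l
    by (simp add: sol_P_def solutions_def inf_P_def)
      (simp add: eq sol_P1_def solutions_def inf_P1_def)
  show "sol_P \<Phi> T C = sol_P1 \<Phi> T C"
  proof (intro set_eqI iffI)
    fix l assume "l \<in> sol_P \<Phi> T C"
    then have *: "l \<in> feas_P T C" "Phi_conj \<Phi> l = inf_P \<Phi> T C" "Phi_conj \<Phi> l < \<infinity>"
      unfolding sol by blast+
    from P[OF *(1,3)] * show "l \<in> sol_P1 \<Phi> T C" unfolding sol by (metis (full_types))
  next
    fix l assume "l \<in> sol_P1 \<Phi> T C"
    then have *: "l \<in> feas_P1 \<Phi> T C" "Phi1_conj \<Phi> l = inf_P \<Phi> T C" "Phi1_conj \<Phi> l < \<infinity>"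
      unfolding sol by blast+
    from P1[OF *(1)] * show "l \<in> sol_P \<Phi> T C" unfolding sol by (metis (full_types))
  qed
qed

section \<open>Absence of a duality gap\<close>

theorem inf_P_eq_sup_D0:
  assumes C: "convex C" "closedin sigma_X_Y C"
  shows "inf_P \<Phi> T C = sup_D0 \<Phi> T C"
proof (rule antisym)
  show "sup_D0 \<Phi> T C \<le> inf_P \<Phi> T C"
    unfolding sup_D0_def inf_P_eq
  proof (intro SUP_least INF_greatest)
    fix y x assume "x \<in> C"
    then have "(INF x\<in>C. ereal (dual_app x y)) - Lam0 \<Phi> T y \<le> ereal (dual_app x y) - Lam0 \<Phi> T y"
      by (intro ereal_minus_mono INF_lower order_refl)
    also have "\<dots> \<le> Lam0_conj \<Phi> T x" unfolding Lam0_conj_def by (rule SUP_upper) simp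
    finally show "(INF x\<in>C. ereal (dual_app x y)) - Lam0 \<Phi> T y \<le> Phi_conj (Lam \<Phi> T) x"
      by (simp add: Lam0_conj_eq)
  qed
  \<comment> \<open>Tests the dual problem with \<open>Lam\<close> in place of \<open>Lam0\<close>,
    which can only lower the value; this is the hypothesis of \<open>strong_duality\<close> once the
    dual value is real.\<close>
  have le: "ereal m - ereal r \<le> sup_D0 \<Phi> T C"
    if "Lam \<Phi> T y \<le> ereal r" "\<And>x. x \<in> C \<Longrightarrow> m \<le> dual_app x y" for y m r
    unfolding sup_D0_def
    using that order_trans[OF Lam0_le that(1)]
    by (intro SUP_upper2[of y] ereal_minus_mono INF_greatest) auto
  show "inf_P \<Phi> T C \<le> sup_D0 \<Phi> T C"
  proof (cases "sup_D0 \<Phi> T C")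
    case (real c)
    have "\<exists>x\<in>C. Phi_conj (Lam \<Phi> T) x \<le> ereal c"
    proof (rule gL.strong_duality[OF C(2,1)])
      show "m \<le> c + r" if "Lam \<Phi> T y \<le> ereal r" "\<And>x. x \<in> C \<Longrightarrow> m \<le> dual_app x y" for y m r
        using le[OF that] by (simp add: real algebra_simps)
    qed
    then show ?thesis by (auto simp: real inf_P_eq intro: INF_lower2)
  next
    case MInf
    \<comment> \<open>The dual variable \<open>0\<close> shows that the dual value is never
      negative.\<close>
    have "ereal (0 - 0) \<le> sup_D0 \<Phi> T C"
      using le[of 0 0 0] gL.zero by (simp add: dual_app_linear flip: zero_ereal_def)
    then show ?thesis using MInf by simp
  qed simp
qed

text \<open>A point of \<open>C1\<close> is produced, not merely a bound on an infimum: it later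
  serves both for the equality of values and for the existence of a solution.\<close>

theorem D1_attaining:
  assumes H: "H_C \<Phi> T C" and fin: "sup_D1 \<Phi> T C < \<infinity>"
  shows "\<exists>x\<in>C1 \<Phi> T C. Phi_conj (Lam \<Phi> T) x \<le> sup_D1 \<Phi> T C"
proof -
  have le: "ereal m - ereal r \<le> sup_D1 \<Phi> T C"
    if "\<eta> \<in> Y1 \<Phi> T" "Lam1 \<Phi> T \<eta> \<le> ereal r" "\<And>x. x \<in> C1 \<Phi> T C \<Longrightarrow> m \<le> compl_app x \<eta>" for \<eta> m r
    unfolding sup_D1_def
    using that by (intro SUP_upper2[of \<eta>] ereal_minus_mono INF_greatest) auto
  have "ereal 0 - ereal 0 \<le> sup_D1 \<Phi> T C"
  proof (rule le[OF const_Y1[of 0]])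
    show "Lam1 \<Phi> T (gL.cls (\<lambda>_. 0)) \<le> ereal 0"
      using Lam1_const_le[of 0] gL.zero by (simp flip: zero_ereal_def)
    show "0 \<le> compl_app x (gL.cls (\<lambda>_. 0))" if "x \<in> C1 \<Phi> T C" for x
      using that by (simp add: C1_def X1_eq gL.compl_app_const dual_app_linear)
  qed
  then obtain c where c: "sup_D1 \<Phi> T C = ereal c"
    using fin by (cases "sup_D1 \<Phi> T C") auto
  show ?thesis
    unfolding c
  proof (rule gL.strong_duality_completion)
    show "closedin (weak_topology (top_dual gL.N) (completion gL.N) compl_app) (C1 \<Phi> T C)" "convex (C1 \<Phi> T C)"
      using H by (auto simp: H_C_def sigma_X1_Y1_def X1_eq Y1_eq)
    fix \<eta> m r
    assume \<eta>: "\<eta> \<in> completion gL.N"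
      and bd: "\<And>x q. Phi_conj (Lam \<Phi> T) x \<le> ereal q \<Longrightarrow> compl_app x \<eta> \<le> r + q"
      and m: "\<And>x. x \<in> C1 \<Phi> T C \<Longrightarrow> m \<le> compl_app x \<eta>"
    have \<eta>': "\<eta> \<in> Y1 \<Phi> T" using \<eta> by (simp add: Y1_eq)
    \<comment> \<open>\<open>bd\<close> bounds the pairing with every \<open>x\<close> of finite
      conjugate; \<open>conj_T_le\<close> makes \<open>x = T l\<close> admissible with the conjugate
      value of \<open>l\<close>.\<close>
    have "Lam1 \<Phi> T \<eta> \<le> ereal r"
      unfolding Lam1_eq[OF \<eta>']
    proof (rule SUP_least)
      fix l
      show "ereal (compl_app (T l) \<eta>) - Phi_conj \<Phi> l \<le> ereal r"
      proof (cases "Phi_conj \<Phi> l < \<infinity>")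
        case True
        then obtain q where q: "Phi_conj \<Phi> l = ereal q" using gP.conj_real by blast
        then show ?thesis using bd[of "T l" q] conj_T_le[of l] by simp
      qed simp
    qed
    from le[OF \<eta>' this m] show "m \<le> c + r" by (simp add: c algebra_simps)
  qed
qed

lemma compl_embed_alg_dual_on:
  assumes \<eta>: "\<eta> \<in> Y1 \<Phi> T"
  shows "compl_embed (norm_Lam \<Phi> T) \<eta> \<in> alg_dual_on (X1 \<Phi> T)"
  using \<eta> subspace_add[OF gL.subspace_top_dual] subspace_scale[OF gL.subspace_top_dual]
  by (auto simp: alg_dual_on_def compl_embed_def X1_def norm_Lam_def Y1_eq
      gL.compl_app_add_left gL.compl_app_scale_left)

lemma sup_D1_le_sup_D2: "sup_D1 \<Phi> T C \<le> sup_D2 \<Phi> T C"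
  unfolding sup_D1_def
proof (rule SUP_least)
  fix \<eta> assume \<eta>: "\<eta> \<in> Y1 \<Phi> T"
  have "(INF x\<in>C1 \<Phi> T C. ereal (compl_app x \<eta>)) =
      (INF x\<in>C1 \<Phi> T C. ereal (compl_embed (norm_Lam \<Phi> T) \<eta> x))"
    by (intro INF_cong refl) (simp add: C1_def compl_embed_def X1_def)
  then show "(INF x\<in>C1 \<Phi> T C. ereal (compl_app x \<eta>)) - Lam1 \<Phi> T \<eta> \<le> sup_D2 \<Phi> T C"
    unfolding sup_D2_def Lam1_eq_Lam2[OF \<eta>]
    by (intro SUP_upper2[OF compl_embed_alg_dual_on[OF \<eta>]]) simp
qed

text \<open>Weak duality for dual variables without continuity. An \<open>x\<close> of finite value
  is \<open>T l\<close> with \<open>l\<close> in \<open>L1\<close>, so \<open>\<omega> x\<close> is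
  a value of \<open>T2_adj\<close>.\<close>

lemma sup_D2_le_inf_P: "sup_D2 \<Phi> T C \<le> inf_P \<Phi> T C"
  unfolding sup_D2_def inf_P_eq_C1
proof (intro SUP_least INF_greatest)
  fix \<omega> x assume \<omega>: "\<omega> \<in> alg_dual_on (X1 \<Phi> T)" and x: "x \<in> C1 \<Phi> T C"
  obtain l where l: "T l = x" "Phi_conj \<Phi> l = Phi_conj (Lam \<Phi> T) x"
    using conj_Lam_attained by blast
  have X0: "0 \<in> X1 \<Phi> T" and L0: "0 \<in> L1 \<Phi>"
    using subspace_0[OF gL.subspace_top_dual] subspace_0[OF gP.subspace_top_dual]
    by (simp_all add: X1_eq L1_eq)
  \<comment> \<open>\<open>\<omega>\<close> is linear only on \<open>X1\<close>, so its value at the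
    origin comes from scaling by \<open>0\<close> there.\<close>
  have "\<forall>c. \<forall>x\<in>X1 \<Phi> T. \<omega> (c *\<^sub>R x) = c * \<omega> x"
    using \<omega> by (simp add: alg_dual_on_def)
  with X0 have "\<omega> (0 *\<^sub>R 0) = 0 * \<omega> 0" by blast
  then have \<omega>0: "\<omega> 0 = 0" by simp
  have Lam2_nonneg: "0 \<le> Lam2 \<Phi> T \<omega>"
    unfolding Lam2_def Phi2_def
    by (rule SUP_upper2[OF L0]) (simp add: T2_adj_def L0 gP.Phi_conj_0 linear_0[OF lin_T] \<omega>0)
  show "(INF x\<in>C1 \<Phi> T C. ereal (\<omega> x)) - Lam2 \<Phi> T \<omega> \<le> Phi_conj (Lam \<Phi> T) x"
  proof (cases "Phi_conj \<Phi> l < \<infinity>")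
    case True
    then have "l \<in> L1 \<Phi>" by (rule conj_finite_L1)
    have "(INF x\<in>C1 \<Phi> T C. ereal (\<omega> x)) - Lam2 \<Phi> T \<omega> \<le> ereal (\<omega> x) - Lam2 \<Phi> T \<omega>"
      by (intro ereal_minus_mono INF_lower x order_refl)
    also have "\<dots> \<le> Phi_conj \<Phi> l"
    proof (rule ereal_minus_le_swap[OF _ Lam2_nonneg gP.conj_nonneg])
      show "ereal (\<omega> x) - Phi_conj \<Phi> l \<le> Lam2 \<Phi> T \<omega>"
        unfolding Lam2_def Phi2_def
        by (rule SUP_upper2[OF \<open>l \<in> L1 \<Phi>\<close>]) (simp add: T2_adj_def \<open>l \<in> L1 \<Phi>\<close> l(1))
    qed
    finally show ?thesis by (simp add: l(2))
  qed (use l in auto)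
qed

text \<open>The inequalities (D1) \<le> (D2) \<le> (P) are closed into a circle by
  \<open>D1_attaining\<close>.\<close>

lemma dual_values:
  assumes "H_C \<Phi> T C"
  shows "inf_P \<Phi> T C = sup_D1 \<Phi> T C" and "sup_D2 \<Phi> T C = sup_D1 \<Phi> T C"
proof -
  have "inf_P \<Phi> T C \<le> sup_D1 \<Phi> T C"
  proof (cases "sup_D1 \<Phi> T C < \<infinity>")
    case True
    from D1_attaining[OF assms True] show ?thesis
      unfolding inf_P_eq_C1 by (auto intro: INF_lower2)
  qed simp
  then show "inf_P \<Phi> T C = sup_D1 \<Phi> T C" "sup_D2 \<Phi> T C = sup_D1 \<Phi> T C"
    using sup_D1_le_sup_D2[of C] sup_D2_le_inf_P[of C] by auto
qed

section \<open>Existence of solutions and behaviour of minimizing sequences\<close>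

lemma P_attained:
  assumes H: "H_C \<Phi> T C" and fin: "inf_P \<Phi> T C < \<infinity>"
  shows "\<exists>l\<in>L1 \<Phi>. l \<in> sol_P \<Phi> T C"
proof -
  obtain x where x: "x \<in> C1 \<Phi> T C" "Phi_conj (Lam \<Phi> T) x \<le> inf_P \<Phi> T C"
    using D1_attaining[OF H] fin unfolding dual_values(1)[OF H] by blast
  obtain l where l: "T l = x" "Phi_conj \<Phi> l = Phi_conj (Lam \<Phi> T) x"
    using conj_Lam_attained by blast
  have feas: "l \<in> feas_P T C" using x l by (simp add: feas_P_def C1_def)
  have "Phi_conj \<Phi> l < \<infinity>" using le_less_trans[OF x(2) fin] l(2) by simp
  moreover have "Phi_conj \<Phi> l = inf_P \<Phi> T C"
    using x(2) l(2) inf_P_le[OF feas] by (intro antisym) simp_all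
  ultimately show ?thesis
    using feas conj_finite_L1[of l] by (auto simp: sol_P_def solutions_def inf_P_def)
qed

text \<open>Pairing \<open>T l\<close> with \<open>\<eta>\<close> is pairing \<open>l\<close> with
  \<open>T1_adj \<Phi> T \<eta>\<close>, an element of \<open>U1\<close> and hence weakly
  continuous.\<close>

lemma continuous_map_T: "continuous_map (sigma_L1_U1 \<Phi>) (sigma_X1_Y1 \<Phi> T) T"
  unfolding sigma_X1_Y1_def
proof (rule continuous_map_into_weak_topology)
  show "T l \<in> X1 \<Phi> T" if "l \<in> topspace (sigma_L1_U1 \<Phi>)" for l
    using that by (simp add: sigma_L1_U1_def T_L1)
  fix \<eta> assume \<eta>: "\<eta> \<in> Y1 \<Phi> T"
  show "continuous_map (sigma_L1_U1 \<Phi>) euclideanreal (\<lambda>l. compl_app (T l) \<eta>)"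
    unfolding sigma_L1_U1_def
    by (rule continuous_map_eq[OF continuous_map_weak_topology_pairing[OF T1_adj_pairing(1)[OF \<eta>]]])
      (simp add: T1_adj_pairing(2)[OF \<eta>])
qed

lemma minimizing_seq_ex_cluster_point:
  assumes fin: "inf_P \<Phi> T C < \<infinity>" and s: "minimizing_seq (Phi_conj \<Phi>) (feas_P T C) s"
  shows "\<exists>l. seq_cluster_point (sigma_L1_U1 \<Phi>) s l"
proof -
  obtain c where c: "inf_P \<Phi> T C = ereal c"
    using fin inf_P_nonneg[of C] by (cases "inf_P \<Phi> T C") auto
  have "(\<lambda>n. Phi_conj \<Phi> (s n)) \<longlonglongrightarrow> ereal c"
    using s c by (simp add: minimizing_seq_def inf_P_def)
  \<comment> \<open>Any level above the infimum would do; the sequence eventually stays in this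
    compact sublevel set.\<close>
  then have "\<forall>\<^sub>F n in sequentially. Phi_conj \<Phi> (s n) < ereal (c + 1)"
    by (rule order_tendstoD) simp
  then have "\<forall>\<^sub>F n in sequentially. s n \<in> {l. Phi_conj \<Phi> l \<le> ereal (c + 1)}"
    by (auto elim!: eventually_mono)
  then show ?thesis
    by (rule compactin_ex_seq_cluster_point[rotated])
      (simp add: sigma_L1_U1_def L1_eq U1_eq gP.compactin_conj_sublevel)
qed

text \<open>Failure of feasibility or of optimality at \<open>l\<close> is witnessed by a weakly
  open set around \<open>l\<close>, which the sequence visits infinitely often. Such visits take
  place inside \<open>L1\<close>, although some terms of the sequence may lie outside it.\<close>

lemma cluster_point_solves:
  assumes H: "H_C \<Phi> T C" and fin: "inf_P \<Phi> T C < \<infinity>"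
    and s: "minimizing_seq (Phi_conj \<Phi>) (feas_P T C) s"
    and l: "seq_cluster_point (sigma_L1_U1 \<Phi>) s l"
  shows "l \<in> sol_P \<Phi> T C"
proof -
  have top: "topspace (sigma_L1_U1 \<Phi>) = L1 \<Phi>" by (simp add: sigma_L1_U1_def)
  have "l \<in> L1 \<Phi>" using l by (simp add: seq_cluster_point_def top)
  have freq: "\<exists>\<^sub>F n in sequentially. s n \<in> O'" if "openin (sigma_L1_U1 \<Phi>) O'" "l \<in> O'" for O'
    using l that by (simp add: seq_cluster_point_def)
  have "T l \<in> C"
  proof (rule ccontr)
    assume "T l \<notin> C"
    let ?O = "{l \<in> L1 \<Phi>. T l \<in> X1 \<Phi> T - C1 \<Phi> T C}"
    have "openin (sigma_X1_Y1 \<Phi> T) (X1 \<Phi> T - C1 \<Phi> T C)"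
      using H by (simp add: H_C_def closedin_def sigma_X1_Y1_def)
    from openin_continuous_map_preimage[OF continuous_map_T this]
    have "openin (sigma_L1_U1 \<Phi>) ?O" unfolding top .
    moreover have "l \<in> ?O" using \<open>l \<in> L1 \<Phi>\<close> \<open>T l \<notin> C\<close> T_L1 by (simp add: C1_def)
    ultimately have "\<exists>\<^sub>F n in sequentially. s n \<in> ?O" by (rule freq)
    then obtain n where "s n \<in> ?O" by (auto dest: frequently_ex)
    moreover have "T (s n) \<in> C" using s by (simp add: minimizing_seq_def feas_P_def)
    ultimately show False by (simp add: C1_def)
  qed
  then have feas: "l \<in> feas_P T C" by (simp add: feas_P_def)
  have "Phi_conj \<Phi> l \<le> inf_P \<Phi> T C"
  proof (rule ccontr)
    assume "\<not> Phi_conj \<Phi> l \<le> inf_P \<Phi> T C"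
    then obtain b where b: "inf_P \<Phi> T C < ereal b" "ereal b < Phi_conj \<Phi> l"
      using ereal_dense2[of "inf_P \<Phi> T C" "Phi_conj \<Phi> l"] unfolding not_le by blast
    then have "\<not> Phi_conj \<Phi> l \<le> ereal b" by simp
    \<comment> \<open>A single test vector \<open>v\<close> witnesses that the conjugate at
      \<open>l\<close> exceeds \<open>b\<close>. It defines an open half-space whose members all
      have conjugate above \<open>b\<close>, while the terms of the sequence eventually have
      conjugate below \<open>b\<close>.\<close>
    then obtain v r where v: "\<Phi> v \<le> ereal r" "b + r < dual_app l v"
      unfolding gP.conj_le_iff by (meson not_le)
    let ?u = "gP.cls (\<lambda>_. v)"
    let ?O = "{l \<in> topspace (sigma_L1_U1 \<Phi>). compl_app l ?u \<in> {b + r<..}}"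
    have "?u \<in> U1 \<Phi>"
      unfolding U1_eq by (rule gP.cls_in_completion[OF gP.Cauchy_wrt_const])
    then have "openin (sigma_L1_U1 \<Phi>) ?O"
      unfolding sigma_L1_U1_def
      by (intro openin_continuous_map_preimage[OF continuous_map_weak_topology_pairing]) auto
    moreover have app: "compl_app l' ?u = dual_app l' v" if "l' \<in> L1 \<Phi>" for l'
      using that by (simp add: L1_eq gP.compl_app_const)
    ultimately have "\<exists>\<^sub>F n in sequentially. s n \<in> ?O"
      using v(2) \<open>l \<in> L1 \<Phi>\<close> by (intro freq) (simp_all add: top)
    moreover have "(\<lambda>n. Phi_conj \<Phi> (s n)) \<longlonglongrightarrow> inf_P \<Phi> T C"
      using s by (simp add: minimizing_seq_def inf_P_def)
    then have "\<forall>\<^sub>F n in sequentially. Phi_conj \<Phi> (s n) < ereal b"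
      using b(1) by (rule order_tendstoD)
    ultimately have "\<exists>\<^sub>F n in sequentially. s n \<in> ?O \<and> Phi_conj \<Phi> (s n) < ereal b"
      by (rule frequently_eventually_frequently)
    then obtain n where n: "s n \<in> ?O" "Phi_conj \<Phi> (s n) < ereal b"
      by (auto dest: frequently_ex)
    then have "dual_app (s n) v \<le> b + r"
      using gP.conj_le_iff[of "s n" b] v(1) by (simp add: less_imp_le)
    then show False using n(1) app[of "s n"] by (auto simp: top)
  qed
  then have "Phi_conj \<Phi> l = inf_P \<Phi> T C"
    by (rule antisym[OF _ inf_P_le[OF feas]])
  then show ?thesis
    using feas fin by (simp add: sol_P_def solutions_def inf_P_def)
qed

text \<open>A solution is in particular optimal in its own fibre, so \<open>conj_T_le\<close> is an
  equality at it.\<close>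

lemma sol_P_image:
  assumes l: "l \<in> sol_P \<Phi> T C"
  shows "T l \<in> sol_P1X \<Phi> T C" and "inf_P \<Phi> T C = Phi_conj \<Phi> l"
    and "Phi_conj \<Phi> l = Lam0_conj \<Phi> T (T l)"
proof -
  have *: "T l \<in> C" "Phi_conj \<Phi> l = inf_P \<Phi> T C" "Phi_conj \<Phi> l < \<infinity>"
    using l by (auto simp: sol_P_def solutions_def feas_P_def inf_P_def)
  then show "inf_P \<Phi> T C = Phi_conj \<Phi> l" by simp
  have mem: "T l \<in> C1 \<Phi> T C" using *(1) T_L1[OF conj_finite_L1[OF *(3)]] by (simp add: C1_def)
  have "Phi_conj \<Phi> l \<le> Phi_conj (Lam \<Phi> T) (T l)"
    unfolding *(2) inf_P_eq by (rule INF_lower[OF *(1)])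
  then show eq: "Phi_conj \<Phi> l = Lam0_conj \<Phi> T (T l)"
    using conj_T_le[of l] by (simp add: Lam0_conj_eq)
  show "T l \<in> sol_P1X \<Phi> T C"
    using mem * eq inf_P_eq_C1[of C]
    by (simp add: sol_P1X_def solutions_def min_value_def Lam0_conj_eq)
qed

end

theorem theorem2p6:
  fixes \<Phi> :: "'u::real_vector \<Rightarrow> ereal"
    and T :: "'u alg_dual \<Rightarrow> 'y::real_vector alg_dual"
    and C :: "'y alg_dual set"
  assumes "linear T" and "convex C" and "H_Phi \<Phi>" and "H_T T"
  shows
    \<comment> \<open>(a)\<close>
    "((\<forall>x. (INF l\<in>{l. T l = x}. Phi_conj \<Phi> l) = Lam0_conj \<Phi> T x \<and> 0 \<le> Lam0_conj \<Phi> T x) \<and>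
      (\<forall>x\<in>X1 \<Phi> T. Lam0_conj \<Phi> T x = Lam1_conj \<Phi> T x) \<and>
      inf_compact (sigma_X1_Y1 \<Phi> T) (Lam1_conj \<Phi> T))
     \<and>
     \<comment> \<open>(b)\<close>
     (sol_P \<Phi> T C = sol_P1 \<Phi> T C \<and> inf_P \<Phi> T C = inf_P1 \<Phi> T C \<and> 0 \<le> inf_P \<Phi> T C)
     \<and>
     \<comment> \<open>(c)\<close>
     (closedin sigma_X_Y C \<longrightarrow> inf_P \<Phi> T C = sup_D0 \<Phi> T C \<and> 0 \<le> inf_P \<Phi> T C)
     \<and>
     (H_C \<Phi> T C \<longrightarrow>
       \<comment> \<open>(d)\<close>
       (inf_P \<Phi> T C = inf_P1 \<Phi> T C \<and>
        inf_P1 \<Phi> T C = sup_D1 \<Phi> T C \<and>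
        sup_D1 \<Phi> T C = sup_D2 \<Phi> T C \<and>
        sup_D2 \<Phi> T C = (INF x\<in>C. Lam0_conj \<Phi> T x) \<and>
        0 \<le> inf_P \<Phi> T C)
       \<and>
       \<comment> \<open>(e)\<close>
       (inf_P \<Phi> T C < \<infinity> \<longrightarrow>
         (\<exists>l\<in>L1 \<Phi>. l \<in> sol_P \<Phi> T C) \<and>
         (\<forall>s. minimizing_seq (Phi_conj \<Phi>) (feas_P T C) s \<longrightarrow>
           (\<exists>l. seq_cluster_point (sigma_L1_U1 \<Phi>) s l) \<and>
           (\<forall>l. seq_cluster_point (sigma_L1_U1 \<Phi>) s l \<longrightarrow> l \<in> sol_P \<Phi> T C)))
       \<and>
       \<comment> \<open>(f)\<close>
       (\<forall>l\<in>L1 \<Phi>. l \<in> sol_P \<Phi> T C \<longrightarrow>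
         T l \<in> sol_P1X \<Phi> T C \<and>
         inf_P \<Phi> T C = Phi_conj \<Phi> l \<and> Phi_conj \<Phi> l = Lam0_conj \<Phi> T (T l)))"
proof -
  interpret constrained_problem \<Phi> T
    by (rule constrained_problem.intro[OF assms(1,3,4)])
  have INF_l: "(INF l\<in>{l. T l = x}. Phi_conj \<Phi> l) = Lam0_conj \<Phi> T x" for x
    by (simp add: INF_conj_eq Lam0_conj_eq)
  have nonneg: "0 \<le> Lam0_conj \<Phi> T x" for x
    by (simp add: Lam0_conj_eq gL.conj_nonneg)
  have Lam01: "Lam0_conj \<Phi> T x = Lam1_conj \<Phi> T x" if "x \<in> X1 \<Phi> T" for x
    by (simp add: Lam0_conj_eq Lam1_conj_eq[OF that])
  have dual_eqs: "inf_P1 \<Phi> T C = sup_D1 \<Phi> T C" "sup_D1 \<Phi> T C = sup_D2 \<Phi> T C"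
    "sup_D2 \<Phi> T C = (INF x\<in>C. Lam0_conj \<Phi> T x)" if "H_C \<Phi> T C"
    using dual_values[OF that] P_P1(1)[of C] inf_P_eq[of C] by (simp_all add: Lam0_conj_eq)
  show ?thesis
    by (intro conjI allI impI ballI;
        rule INF_l nonneg Lam01 inf_compact_Lam1_conj P_P1 inf_P_nonneg
          inf_P_eq_sup_D0[OF \<open>convex C\<close>] dual_eqs P_attained minimizing_seq_ex_cluster_point
          cluster_point_solves sol_P_image;
        assumption)
qed

end
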